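(* Let $\partial\Omega=\Gamma_0\cup\Gamma_3$, $c_0\ge0$, $c_1>0$, and $c_1\ge0$ if $\Gamma_0$ is nonempty (i.e. $c_1=0$ is also allowed when $\Gamma_0$ is nonempty). Let $k\ge0$ be an integer and let $\{\tau_h\}$, $0<h\le1$, be a quasiuniform family of triangular (simplicial) meshes of $\Omega$. Then the problem of finding $(u_h,\vec v_h,\vec\alpha_h)\in DG_k(\Omega,\tau_h)\times RT_{k+1}^{\Gamma_3}(\Omega,\tau_h)\times RT_{k+1}^{\Gamma_3}(\Omega,\tau_h)$ such that $$a\big((u_h,\vec v_h),(\phi_h,\vec\psi_h)\big)+b\big((\phi_h,\vec\psi_h),\vec\alpha_h\big)=F(\phi_h),\qquad b\big((u_h,\vec v_h),\vec\beta_h\big)=0$$ for all $(\phi_h,\vec\psi_h,\vec\beta_h)\in DG_k(\Omega,\tau_h)\times RT_{k+1}^{\Gamma_3}(\Omega,\tau_h)\times RT_{k+1}^{\Gamma_3}(\Omega,\tau_h)$ has a unique solution for any $\tau_h$ in the family.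
   Context: $\Omega\subset\mathbb R^d$, $d\in\{2,3\}$, is an open, connected, bounded polytope with Lipschitz boundary and outward pointing normal $\vec n$. The $\Gamma_i$ are segments of $\partial\Omega$ carrying different boundary conditions for the fourth-order problem $\Delta^2u-c_0\Delta u+c_1u=f$: $u=\Delta u=0$ on $\Gamma_0$, and $\frac{\partial(\Delta u-c_0u)}{\partial n}=\frac{\partial u}{\partial n}=0$ on $\Gamma_3$. The datum satisfies $f\in V^*$, the dual space of $V=\{v\in H^1(\Omega):\Delta v\in L^2(\Omega)\}$ (with inner product $\int_\Omega uv+\nabla u\cdot\nabla v+\Delta u\,\Delta v$). A family of simplicial meshes is quasiuniform if there is $\rho>0$ such that for all $h$ and all $T\in\tau_h$, $\operatorname{diam}T\le h\operatorname{diam}\Omega$ and the largest ball contained in $T$ has diameter at least $\rho h\operatorname{diam}\Omega$. $DG_k(\Omega,\tau_h)$ is the space of functions whose restriction to each $T\in\tau_h$ is a polynomial of degree at most $k$. $RT_{k+1}(\Omega,\tau_h)$ is the Raviart–Thomas space of $\vec v\in H(\mathrm{div};\Omega)$ with $\vec v|_T\in[P_k(T)]^d+\vec x\,P_k(T)$ for all $T\in\tau_h$ (so $RT_1$ is lowest order), where $P_k(T)$ denotes polynomials of degree at most $k$ on $T$, and $RT_{k+1}^{\Gamma}(\Omega,\tau_h)=\{\vec v_h\in RT_{k+1}(\Omega,\tau_h):\vec v_h\cdot\vec n=0\text{ on }\Gamma\}$. The forms are $$a\big((u,\vec v),(\phi,\vec\psi)\big)=c_0\int_\Omega\vec v\cdot\vec\psi+\int_\Omega\nabla\cdot\vec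 v\,\nabla\cdot\vec\psi+c_1\int_\Omega u\phi,$$ $$b\big((u,\vec v),\vec\beta\big)=\int_\Omega\vec\beta\cdot\vec v+u\,\nabla\cdot\vec\beta,\qquad F(\phi)=\int_\Omega f\phi.$$
   Formalization: Each boundary facet of every mesh is assumed to lie in Γ₀ or in Γ₃ (otherwise uniqueness can fail when c₁=0), and f∈V* is assumed to be also defined and linear on DG_k(Ω,τ_h), so that F(φ_h) has a meaning. *)

theory Defs
  imports "HOL-Analysis.Analysis"
begin

text \<open>
  Throughout, \<open>R\<^sup>d\<close> is a Euclidean space \<open>'a\<close> with \<open>DIM('a) = d\<close>. Elements of the function spaces are
  represented by functions on all of \<open>'a\<close>. Only their values almost everywhere in \<open>\<Omega>\<close> matter: every
  space below is closed under a.e. modification, and equality in a space is a.e. equality on \<open>\<Omega>\<close>.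
\<close>


section \<open>The domain and the boundary pieces\<close>

definition lipschitz_boundary :: "'a::euclidean_space set \<Rightarrow> bool" where
  "lipschitz_boundary \<Omega> \<longleftrightarrow>
     (\<forall>x\<in>frontier \<Omega>. \<exists>U e \<gamma> L. open U \<and> x \<in> U \<and> norm e = 1 \<and> L-lipschitz_on {z. z \<bullet> e = 0} \<gamma> \<and>
        \<Omega> \<inter> U = {y \<in> U. \<gamma> (y - (y \<bullet> e) *\<^sub>R e) < y \<bullet> e})"

text \<open>A polytopal domain need not be convex: its closure is a finite union of convex polytopes.\<close>

definition polytopal_domain :: "'a::euclidean_space set \<Rightarrow> bool" where
  "polytopal_domain \<Omega> \<longleftrightarrow>
     open \<Omega> \<and> connected \<Omega> \<and> bounded \<Omega> \<and> \<Omega> \<noteq> {} \<and> lipschitz_boundary \<Omega> \<and>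
     (\<exists>\<P>. finite \<P> \<and> (\<forall>P\<in>\<P>. polytope P) \<and> closure \<Omega> = \<Union>\<P>)"

text \<open>
  A (closed) boundary piece is a finite union of \<open>(d-1)\<close>-dimensional flat segments of the boundary.
  It may be empty; if it is not, it has positive surface measure.
\<close>

definition boundary_piece :: "'a::euclidean_space set \<Rightarrow> 'a set \<Rightarrow> bool" where
  "boundary_piece \<Omega> \<Gamma> \<longleftrightarrow>
     (\<exists>\<G>. finite \<G> \<and> \<Gamma> = \<Union>\<G> \<and>
        (\<forall>G\<in>\<G>. polytope G \<and> aff_dim G = int DIM('a) - 1 \<and> G \<subseteq> frontier \<Omega>))"

text \<open>Closed boundary pieces covering the boundary, which may only share lower-dimensional sets.\<close>

definition boundary_partition :: "'a::euclidean_space set \<Rightarrow> 'a set \<Rightarrow> 'a set \<Rightarrow> bool" where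
  "boundary_partition \<Omega> \<Gamma>\<^sub>0 \<Gamma>\<^sub>3 \<longleftrightarrow>
     boundary_piece \<Omega> \<Gamma>\<^sub>0 \<and> boundary_piece \<Omega> \<Gamma>\<^sub>3 \<and> frontier \<Omega> = \<Gamma>\<^sub>0 \<union> \<Gamma>\<^sub>3 \<and>
     (top_of_set (frontier \<Omega>)) interior_of (\<Gamma>\<^sub>0 \<inter> \<Gamma>\<^sub>3) = {}"

text \<open>
  This holds for at most one \<open>n\<close>, and for some \<open>n\<close> exactly at those boundary points near which
  \<open>\<Omega>\<close> is a half space, i.e. everywhere except on the edges and corners of the polytope.
\<close>

definition outward_unit_normal :: "'a::euclidean_space set \<Rightarrow> 'a \<Rightarrow> 'a \<Rightarrow> bool" where
  "outward_unit_normal \<Omega> x n \<longleftrightarrow>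
     norm n = 1 \<and> (\<exists>\<epsilon>>0. \<Omega> \<inter> ball x \<epsilon> = {y \<in> ball x \<epsilon>. (y - x) \<bullet> n < 0})"


section \<open>Weak derivatives and the spaces \<open>H(div)\<close>, \<open>V\<close>, \<open>V*\<close>\<close>

fun iterated_partial :: "'a::euclidean_space list \<Rightarrow> ('a \<Rightarrow> real) \<Rightarrow> 'a \<Rightarrow> real" where
  "iterated_partial [] f = f"
| "iterated_partial (b # bs) f = (\<lambda>x. frechet_derivative (iterated_partial bs f) (at x) b)"

definition smooth_fun :: "('a::euclidean_space \<Rightarrow> real) \<Rightarrow> bool" where
  "smooth_fun f \<longleftrightarrow>
     (\<forall>bs x. set bs \<subseteq> Basis \<longrightarrow> iterated_partial bs f differentiable at x)"

definition test_functions :: "'a::euclidean_space set \<Rightarrow> ('a \<Rightarrow> real) set" where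
  "test_functions \<Omega> =
     {\<phi>. smooth_fun \<phi> \<and> compact (closure {x. \<phi> x \<noteq> 0}) \<and> closure {x. \<phi> x \<noteq> 0} \<subseteq> \<Omega>}"

definition grad :: "('a::euclidean_space \<Rightarrow> real) \<Rightarrow> 'a \<Rightarrow> 'a" where
  "grad \<phi> x = (\<Sum>b\<in>Basis. frechet_derivative \<phi> (at x) b *\<^sub>R b)"

definition L2 :: "'a::euclidean_space set \<Rightarrow> ('a \<Rightarrow> 'b::euclidean_space) set" where
  "L2 \<Omega> = {f \<in> borel_measurable (lebesgue_on \<Omega>). integrable (lebesgue_on \<Omega>) (\<lambda>x. (norm (f x))\<^sup>2)}"

definition has_weak_grad :: "'a::euclidean_space set \<Rightarrow> ('a \<Rightarrow> real) \<Rightarrow> ('a \<Rightarrow> 'a) \<Rightarrow> bool" where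
  "has_weak_grad \<Omega> v g \<longleftrightarrow>
     (\<forall>\<phi>\<in>test_functions \<Omega>.
        (\<integral>x. v x *\<^sub>R grad \<phi> x \<partial>lebesgue_on \<Omega>) = - (\<integral>x. \<phi> x *\<^sub>R g x \<partial>lebesgue_on \<Omega>))"

definition has_weak_div :: "'a::euclidean_space set \<Rightarrow> ('a \<Rightarrow> 'a) \<Rightarrow> ('a \<Rightarrow> real) \<Rightarrow> bool" where
  "has_weak_div \<Omega> v w \<longleftrightarrow>
     (\<forall>\<phi>\<in>test_functions \<Omega>.
        (\<integral>x. v x \<bullet> grad \<phi> x \<partial>lebesgue_on \<Omega>) = - (\<integral>x. \<phi> x * w x \<partial>lebesgue_on \<Omega>))"

definition weak_grad :: "'a::euclidean_space set \<Rightarrow> ('a \<Rightarrow> real) \<Rightarrow> 'a \<Rightarrow> 'a" where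
  "weak_grad \<Omega> v = (SOME g. g \<in> L2 \<Omega> \<and> has_weak_grad \<Omega> v g)"

definition weak_div :: "'a::euclidean_space set \<Rightarrow> ('a \<Rightarrow> 'a) \<Rightarrow> 'a \<Rightarrow> real" where
  "weak_div \<Omega> v = (SOME w. w \<in> L2 \<Omega> \<and> has_weak_div \<Omega> v w)"

definition H1 :: "'a::euclidean_space set \<Rightarrow> ('a \<Rightarrow> real) set" where
  "H1 \<Omega> = {v \<in> L2 \<Omega>. \<exists>g\<in>L2 \<Omega>. has_weak_grad \<Omega> v g}"

definition Hdiv :: "'a::euclidean_space set \<Rightarrow> ('a \<Rightarrow> 'a) set" where
  "Hdiv \<Omega> = {v \<in> L2 \<Omega>. \<exists>w\<in>L2 \<Omega>. has_weak_div \<Omega> v w}"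

definition V_space :: "'a::euclidean_space set \<Rightarrow> ('a \<Rightarrow> real) set" where
  "V_space \<Omega> = {v \<in> H1 \<Omega>. \<exists>w\<in>L2 \<Omega>. has_weak_div \<Omega> (weak_grad \<Omega> v) w}"

definition weak_laplacian :: "'a::euclidean_space set \<Rightarrow> ('a \<Rightarrow> real) \<Rightarrow> 'a \<Rightarrow> real" where
  "weak_laplacian \<Omega> v = weak_div \<Omega> (weak_grad \<Omega> v)"

definition V_norm :: "'a::euclidean_space set \<Rightarrow> ('a \<Rightarrow> real) \<Rightarrow> real" where
  "V_norm \<Omega> v =
     sqrt (\<integral>x. (v x)\<^sup>2 + (norm (weak_grad \<Omega> v x))\<^sup>2 + (weak_laplacian \<Omega> v x)\<^sup>2 \<partial>lebesgue_on \<Omega>)"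

text \<open>The second conjunct says that \<open>f\<close> is a functional on the a.e. equivalence classes.\<close>

definition linear_functional_on ::
    "'a::euclidean_space set \<Rightarrow> ('a \<Rightarrow> real) set \<Rightarrow> (('a \<Rightarrow> real) \<Rightarrow> real) \<Rightarrow> bool" where
  "linear_functional_on \<Omega> S f \<longleftrightarrow>
     (\<forall>u\<in>S. \<forall>v\<in>S. \<forall>a b. f (\<lambda>x. a * u x + b * v x) = a * f u + b * f v) \<and>
     (\<forall>u\<in>S. \<forall>v\<in>S. (AE x in lebesgue_on \<Omega>. u x = v x) \<longrightarrow> f u = f v)"

definition V_dual :: "'a::euclidean_space set \<Rightarrow> (('a \<Rightarrow> real) \<Rightarrow> real) set" where
  "V_dual \<Omega> =
     {f. linear_functional_on \<Omega> (V_space \<Omega>) f \<and> (\<exists>C. \<forall>v\<in>V_space \<Omega>. \<bar>f v\<bar> \<le> C * V_norm \<Omega> v)}"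


section \<open>Meshes\<close>

text \<open>
  Conforming simplicial meshes by closed simplices. Note that \<open>triangulation\<close> alone allows simplices
  of any dimension.
\<close>

definition simplicial_mesh :: "'a::euclidean_space set \<Rightarrow> 'a set set \<Rightarrow> bool" where
  "simplicial_mesh \<Omega> \<tau> \<longleftrightarrow>
     triangulation \<tau> \<and> (\<forall>T\<in>\<tau>. int DIM('a) simplex T) \<and> \<Union>\<tau> = closure \<Omega>"

text \<open>Each boundary facet of the mesh carries one type of boundary condition.\<close>

definition mesh_resolves :: "'a::euclidean_space set \<Rightarrow> 'a set \<Rightarrow> 'a set \<Rightarrow> 'a set set \<Rightarrow> bool" where
  "mesh_resolves \<Omega> \<Gamma>\<^sub>0 \<Gamma>\<^sub>3 \<tau> \<longleftrightarrow>
     (\<forall>T\<in>\<tau>. \<forall>F. F facet_of T \<and> F \<subseteq> frontier \<Omega> \<longrightarrow> F \<subseteq> \<Gamma>\<^sub>0 \<or> F \<subseteq> \<Gamma>\<^sub>3)"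

definition largest_ball_diameter :: "'a::euclidean_space set \<Rightarrow> real" where
  "largest_ball_diameter T = Sup {2 * r | r. 0 \<le> r \<and> (\<exists>x. cball x r \<subseteq> T)}"

definition quasiuniform :: "'a::euclidean_space set \<Rightarrow> (real \<Rightarrow> 'a set set) \<Rightarrow> bool" where
  "quasiuniform \<Omega> \<tau> \<longleftrightarrow>
     (\<exists>\<rho>>0. \<forall>h\<in>{0<..1}. \<forall>T\<in>\<tau> h.
        diameter T \<le> h * diameter \<Omega> \<and> \<rho> * h * diameter \<Omega> \<le> largest_ball_diameter T)"


section \<open>Finite element spaces\<close>

definition multi_indices :: "nat \<Rightarrow> ('a::euclidean_space \<Rightarrow> nat) set" where
  "multi_indices k = {m \<in> Basis \<rightarrow>\<^sub>E {..k}. (\<Sum>b\<in>Basis. m b) \<le> k}"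

definition poly_space :: "nat \<Rightarrow> ('a::euclidean_space \<Rightarrow> real) set" where
  "poly_space k = {p. \<exists>c. \<forall>x. p x = (\<Sum>m\<in>multi_indices k. c m * (\<Prod>b\<in>Basis. (x \<bullet> b) ^ m b))}"

text \<open>The local space \<open>[P\<^sub>k]\<^sup>d + x P\<^sub>k\<close>.\<close>

definition RT_poly_space :: "nat \<Rightarrow> ('a::euclidean_space \<Rightarrow> 'a) set" where
  "RT_poly_space k =
     {q. \<exists>p r. (\<forall>b\<in>Basis. p b \<in> poly_space k) \<and> r \<in> poly_space k \<and>
             (\<forall>x. q x = (\<Sum>b\<in>Basis. p b x *\<^sub>R b) + r x *\<^sub>R x)}"

definition DG :: "nat \<Rightarrow> 'a::euclidean_space set set \<Rightarrow> ('a \<Rightarrow> real) set" where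
  "DG k \<tau> = {u. \<forall>T\<in>\<tau>. \<exists>p\<in>poly_space k. AE x in lebesgue_on T. u x = p x}"

text \<open>The index convention is that \<open>m = 1\<close> is the lowest order; \<open>m = 0\<close> is not meaningful.\<close>

definition RT :: "nat \<Rightarrow> 'a::euclidean_space set \<Rightarrow> 'a set set \<Rightarrow> ('a \<Rightarrow> 'a) set" where
  "RT m \<Omega> \<tau> =
     {v \<in> Hdiv \<Omega>. \<forall>T\<in>\<tau>. \<exists>q\<in>RT_poly_space (m - 1). AE x in lebesgue_on T. v x = q x}"

text \<open>
  The boundary values of a piecewise polynomial field are those of its polynomial on the adjacent
  simplex. They are taken at relative interior points of facets, so that only simplices having a
  facet on \<open>\<Gamma>\<close>, and not those merely touching \<open>\<Gamma>\<close> in a lower-dimensional face, are constrained.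
\<close>

definition RT_bc :: "nat \<Rightarrow> 'a::euclidean_space set \<Rightarrow> 'a set set \<Rightarrow> 'a set \<Rightarrow> ('a \<Rightarrow> 'a) set" where
  "RT_bc m \<Omega> \<tau> \<Gamma> =
     {v \<in> RT m \<Omega> \<tau>.
        \<forall>T\<in>\<tau>. \<forall>q\<in>RT_poly_space (m - 1). (AE x in lebesgue_on T. v x = q x) \<longrightarrow>
          (\<forall>F. F facet_of T \<longrightarrow>
             (\<forall>x\<in>\<Gamma> \<inter> rel_interior F. \<forall>n. outward_unit_normal \<Omega> x n \<longrightarrow> q x \<bullet> n = 0))}"


section \<open>The discrete mixed problem\<close>

definition form_a :: "'a::euclidean_space set \<Rightarrow> real \<Rightarrow> real \<Rightarrow>
    ('a \<Rightarrow> real) \<times> ('a \<Rightarrow> 'a) \<Rightarrow> ('a \<Rightarrow> real) \<times> ('a \<Rightarrow> 'a) \<Rightarrow> real" where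
  "form_a \<Omega> c\<^sub>0 c\<^sub>1 = (\<lambda>(u, v) (\<phi>, \<psi>).
     c\<^sub>0 * (\<integral>x. v x \<bullet> \<psi> x \<partial>lebesgue_on \<Omega>)
     + (\<integral>x. weak_div \<Omega> v x * weak_div \<Omega> \<psi> x \<partial>lebesgue_on \<Omega>)
     + c\<^sub>1 * (\<integral>x. u x * \<phi> x \<partial>lebesgue_on \<Omega>))"

definition form_b :: "'a::euclidean_space set \<Rightarrow>
    ('a \<Rightarrow> real) \<times> ('a \<Rightarrow> 'a) \<Rightarrow> ('a \<Rightarrow> 'a) \<Rightarrow> real" where
  "form_b \<Omega> = (\<lambda>(u, v) \<beta>. \<integral>x. \<beta> x \<bullet> v x + u x * weak_div \<Omega> \<beta> x \<partial>lebesgue_on \<Omega>)"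

text \<open>
  For \<open>f \<in> V*\<close> the integral of \<open>f \<phi>\<close> is a duality pairing, so the right-hand side is \<open>f \<phi>\<close>, the value
  of the functional.
\<close>

definition discrete_solution :: "'a::euclidean_space set \<Rightarrow> 'a set set \<Rightarrow> 'a set \<Rightarrow> nat \<Rightarrow>
    real \<Rightarrow> real \<Rightarrow> (('a \<Rightarrow> real) \<Rightarrow> real) \<Rightarrow>
    ('a \<Rightarrow> real) \<Rightarrow> ('a \<Rightarrow> 'a) \<Rightarrow> ('a \<Rightarrow> 'a) \<Rightarrow> bool" where
  "discrete_solution \<Omega> \<tau> \<Gamma>\<^sub>3 k c\<^sub>0 c\<^sub>1 f u v \<alpha> \<longleftrightarrow>
     u \<in> DG k \<tau> \<and> v \<in> RT_bc (k + 1) \<Omega> \<tau> \<Gamma>\<^sub>3 \<and> \<alpha> \<in> RT_bc (k + 1) \<Omega> \<tau> \<Gamma>\<^sub>3 \<and>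
     (\<forall>\<phi>\<in>DG k \<tau>. \<forall>\<psi>\<in>RT_bc (k + 1) \<Omega> \<tau> \<Gamma>\<^sub>3.
        form_a \<Omega> c\<^sub>0 c\<^sub>1 (u, v) (\<phi>, \<psi>) + form_b \<Omega> (\<phi>, \<psi>) \<alpha> = f \<phi>) \<and>
     (\<forall>\<beta>\<in>RT_bc (k + 1) \<Omega> \<tau> \<Gamma>\<^sub>3. form_b \<Omega> (u, v) \<beta> = 0)"

end

theory Submission
  imports Defs
begin

text \<open>
  The discrete problem is a symmetric linear system, so it suffices to show that the homogeneous
  problem has only the zero solution. Testing it with \<open>(u, v)\<close> gives \<open>div v = 0\<close>, and \<open>u = 0\<close> if
  \<open>c\<^sub>1 > 0\<close>; then \<open>\<beta> = v\<close> gives \<open>v = 0\<close>, and \<open>\<psi> = \<alpha>\<close> gives \<open>\<alpha> = 0\<close> once \<open>u = 0\<close>. If \<open>c\<^sub>1 = 0\<close>,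
  what is left is that \<open>u\<close> is orthogonal to the divergence of every discrete field. Explicit
  fields show \<open>u = 0\<close>. Bubbles \<open>\<Sum>\<^sub>i \<lambda>\<^sub>i (x\<^sub>i \<bullet> grad u) (x - x\<^sub>i)\<close> make \<open>u\<close> constant on each simplex with
  vertices \<open>x\<^sub>i\<close> and barycentric coordinates \<open>\<lambda>\<^sub>i\<close>. The lowest-order fields of interior facets make these
  constants equal on neighbours, hence everywhere, since faces of codimension two do not
  disconnect \<open>\<Omega>\<close>. The field of a boundary facet in \<open>\<Gamma>\<^sub>0\<close> makes the constant zero.
  All these fields are sums of cone fields \<open>\<psi> (x - v)\<close>, where \<open>v\<close> is a vertex of a simplex.
\<close>

section \<open>Symmetric forms on finitely generated function spaces\<close>

text \<open>Two obstacles shape the proof. The discrete spaces are sets of functions, not of classes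
  modulo null sets, so there is no dimension to count. The passage from uniqueness to existence
  therefore runs through finitely many moments, which separate elements up to null sets. And
  membership in H(div) has to be verified for explicit fields without traces or surface integrals.
  For this the flux of \<phi> (x - v) is written as the volume integral of its divergence over the
  simplex. It sees \<phi> only on the facet opposite v, because x - v is tangential to the other
  facets. Divided by the volume it is d times the mean of \<phi> over that facet, hence the same
  from both sides. This is the origin of the weights 1/volume, with opposite signs, in the fields of
  interior facets. In the bubbles the coefficients are the inner products of grad u with the
  vertices, because integration by parts then leaves their weighted variance; zero variance makes
  grad u orthogonal to every edge.\<close>

definition lin_closed :: "('x \<Rightarrow> 'b::real_vector) set \<Rightarrow> bool" where
  "lin_closed W \<longleftrightarrow> W \<noteq> {} \<and> (\<forall>u\<in>W. \<forall>v\<in>W. \<forall>a b. (\<lambda>x. a *\<^sub>R u x + b *\<^sub>R v x) \<in> W)"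

text \<open>Linearity is asked only on \<open>W\<close>, because integrals are additive only on
  integrable functions.\<close>

definition lin_on :: "('x \<Rightarrow> 'b::real_vector) set \<Rightarrow> (('x \<Rightarrow> 'b) \<Rightarrow> real) \<Rightarrow> bool" where
  "lin_on W f \<longleftrightarrow> (\<forall>u\<in>W. \<forall>v\<in>W. \<forall>a b. f (\<lambda>x. a *\<^sub>R u x + b *\<^sub>R v x) = a * f u + b * f v)"

lemma lin_closedD:
  "lin_closed W \<Longrightarrow> u \<in> W \<Longrightarrow> v \<in> W \<Longrightarrow> (\<lambda>x. a *\<^sub>R u x + b *\<^sub>R v x) \<in> W"
  by (auto simp: lin_closed_def)

lemma lin_onD:
  "lin_on W f \<Longrightarrow> u \<in> W \<Longrightarrow> v \<in> W \<Longrightarrow> f (\<lambda>x. a *\<^sub>R u x + b *\<^sub>R v x) = a * f u + b * f v"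
  by (auto simp: lin_on_def)

lemma lin_closed_zero: "lin_closed W \<Longrightarrow> (\<lambda>x. 0) \<in> W"
  using lin_closedD[of W _ _ 0 0] by (auto simp: lin_closed_def)

lemma lin_on_zero: "lin_closed W \<Longrightarrow> lin_on W f \<Longrightarrow> f (\<lambda>x. 0) = 0"
  using lin_onD[of W f "\<lambda>x. 0" "\<lambda>x. 0" 0 0] lin_closed_zero by fastforce

lemma lin_closed_kernel:
  assumes "lin_closed W" "lin_on W f"
  shows "lin_closed {w\<in>W. f w = 0}"
  using assms lin_closed_zero[OF assms(1)] lin_on_zero[OF assms]
  by (auto simp: lin_closed_def lin_on_def)

lemma lin_closed_sum:
  assumes "lin_closed W" "finite I" "\<And>i. i \<in> I \<Longrightarrow> e i \<in> W"
  shows "(\<lambda>x. \<Sum>i\<in>I. c i *\<^sub>R e i x) \<in> W"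
  using assms(2,3)
proof (induction I rule: finite_induct)
  case empty
  then show ?case using lin_closed_zero[OF assms(1)] by simp
next
  case (insert i I)
  then show ?case using lin_closedD[OF assms(1), of "e i" "\<lambda>x. \<Sum>i\<in>I. c i *\<^sub>R e i x" "c i" 1] by simp
qed

lemma lin_on_sum:
  assumes W: "lin_closed W" and f: "lin_on W f" and "finite I" "\<And>i. i \<in> I \<Longrightarrow> e i \<in> W"
  shows "f (\<lambda>x. \<Sum>i\<in>I. c i *\<^sub>R e i x) = (\<Sum>i\<in>I. c i * f (e i))"
  using assms(3,4)
proof (induction I rule: finite_induct)
  case empty
  then show ?case using lin_on_zero[OF W f] by simp
next
  case (insert i I)
  then show ?case
    using lin_onD[OF f, of "e i" "\<lambda>x. \<Sum>i\<in>I. c i *\<^sub>R e i x" "c i" 1] lin_closed_sum[OF W, of I e c]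
    by simp
qed

text \<open>Induction on \<open>I\<close>. On the kernel of one functional \<open>g j\<close> the
  induction hypothesis represents \<open>F\<close>. What remains vanishes on that kernel, so it is a
  multiple of \<open>g j\<close>, with the factor read off at one point where \<open>g j\<close> is
  not zero.\<close>

lemma functional_in_span:
  fixes W :: "('x \<Rightarrow> 'b::real_vector) set"
  assumes "lin_closed W" "finite I" "\<And>i. i \<in> I \<Longrightarrow> lin_on W (g i)" "lin_on W F"
    and "\<And>w. w \<in> W \<Longrightarrow> (\<And>i. i \<in> I \<Longrightarrow> g i w = 0) \<Longrightarrow> F w = 0"
  shows "\<exists>c. \<forall>w\<in>W. F w = (\<Sum>i\<in>I. c i * g i w)"
  using assms(2,1,3-)
proof (induction I arbitrary: W F rule: finite_induct)
  case empty
  then show ?case by auto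
next
  case (insert j I)
  define K where "K = {w\<in>W. g j w = 0}"
  have K: "lin_closed K" unfolding K_def using insert.prems by (intro lin_closed_kernel) auto
  have sub: "lin_on W f \<Longrightarrow> lin_on K f" for f by (auto simp: lin_on_def K_def)
  obtain c where c: "\<And>w. w \<in> K \<Longrightarrow> F w = (\<Sum>i\<in>I. c i * g i w)"
    using insert.IH[OF K, of F] insert.prems sub by (force simp: K_def)
  show ?case
  proof (cases "\<exists>w0\<in>W. g j w0 \<noteq> 0")
    case False
    then have "K = W" by (auto simp: K_def)
    then show ?thesis using c insert.hyps False
      by (intro exI[of _ c]) auto
  next
    case True
    then obtain w0 where w0: "w0 \<in> W" "g j w0 \<noteq> 0" by blast
    define G where "G w = F w - (\<Sum>i\<in>I. c i * g i w)" for w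
    define cj where "cj = G w0 / g j w0"
    have "F w = cj * g j w + (\<Sum>i\<in>I. c i * g i w)" if w: "w \<in> W" for w
    proof -
      \<comment> \<open>Subtracting this multiple of \<open>w0\<close> projects \<open>w\<close>
        into the kernel of \<open>g j\<close>.\<close>
      define z where "z = (\<lambda>x. 1 *\<^sub>R w x + (- (g j w / g j w0)) *\<^sub>R w0 x)"
      have lin: "f z = f w - (g j w / g j w0) * f w0" if "lin_on W f" for f
        unfolding z_def using lin_onD[OF that w w0(1), of 1 "- (g j w / g j w0)"] by simp
      have "z \<in> W" unfolding z_def by (rule lin_closedD[OF insert.prems(1) w w0(1)])
      moreover have "g j z = 0" using lin[of "g j"] insert.prems w0 by simp
      ultimately have "z \<in> K" by (simp add: K_def)
      then have "G z = 0" using c by (simp add: G_def)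
      moreover have "G z = G w - (g j w / g j w0) * G w0"
      proof -
        have gi: "g i z = g i w - (g j w / g j w0) * g i w0" if "i \<in> I" for i
          using lin[of "g i"] insert.prems that by simp
        have Fz: "F z = F w - (g j w / g j w0) * F w0" using lin[of F] insert.prems by simp
        show ?thesis unfolding G_def Fz
          by (simp add: gi sum_distrib_left right_diff_distrib sum_subtractf algebra_simps
              cong: sum.cong)
      qed
      ultimately show ?thesis unfolding cj_def G_def by (simp add: field_simps)
    qed
    then show ?thesis using insert.hyps
      by (intro exI[of _ "c(j := cj)"]) (auto intro!: sum.cong)
  qed
qed

text \<open>Stands in for a basis of the quotient of \<open>W\<close> by the common kernel of the
  \<open>l i\<close>. A new functional either vanishes on the common kernel of the earlier ones and
  costs nothing, or that kernel supplies one more generator.\<close>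

lemma finite_generators:
  fixes W :: "('x \<Rightarrow> 'b::real_vector) set"
  assumes "lin_closed W" "finite I" "\<And>i. i \<in> I \<Longrightarrow> lin_on W (l i)"
  shows "\<exists>(n::nat) e. (\<forall>j<n. e j \<in> W) \<and>
    (\<forall>w\<in>W. \<exists>c. \<forall>i\<in>I. l i (\<lambda>x. w x - (\<Sum>j<n. c j *\<^sub>R e j x)) = 0)"
  using assms(2,3)
proof (induction I rule: finite_induct)
  case empty
  show ?case by (intro exI[of _ 0]) auto
next
  case (insert i I)
  have "\<exists>(n::nat) e. (\<forall>j<n. e j \<in> W) \<and>
      (\<forall>w\<in>W. \<exists>c. \<forall>i\<in>I. l i (\<lambda>x. w x - (\<Sum>j<n. c j *\<^sub>R e j x)) = 0)"
    using insert.prems by (intro insert.IH) auto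
  then obtain n :: nat and e
    where gen: "(\<forall>j<n. e j \<in> W) \<and>
      (\<forall>w\<in>W. \<exists>c. \<forall>i\<in>I. l i (\<lambda>x. w x - (\<Sum>j<n. c j *\<^sub>R e j x)) = 0)"
    by (elim exE)
  then have e: "\<And>j. j < n \<Longrightarrow> e j \<in> W" by simp
  have span: "\<exists>c. \<forall>i\<in>I. l i (\<lambda>x. w x - (\<Sum>j<n. c j *\<^sub>R e j x)) = 0" if "w \<in> W" for w
    using gen that by simp
  have li: "lin_on W (l i)" using insert.prems by simp
  have diffW: "(\<lambda>x. w x - (\<Sum>j<m. c j *\<^sub>R e' j x)) \<in> W"
    if "w \<in> W" "\<And>j. j < m \<Longrightarrow> e' j \<in> W" for w c and e' :: "nat \<Rightarrow> _" and m :: nat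
    using lin_closedD[OF assms(1) that(1) lin_closed_sum[OF assms(1), of "{..<m}" e' c], of 1 "-1"]
      that(2) by simp
  show ?case
  proof (cases "\<exists>w0\<in>W. (\<forall>i\<in>I. l i w0 = 0) \<and> l i w0 \<noteq> 0")
    case False
    have "\<exists>c. \<forall>i\<in>insert i I. l i (\<lambda>x. w x - (\<Sum>j<n. c j *\<^sub>R e j x)) = 0" if w: "w \<in> W" for w
    proof -
      obtain c where "\<forall>i\<in>I. l i (\<lambda>x. w x - (\<Sum>j<n. c j *\<^sub>R e j x)) = 0" using span w by blast
      then show ?thesis using False diffW[OF w, of n e c] e by blast
    qed
    then show ?thesis using e by (intro exI[of _ n] exI[of _ e]) auto
  next
    case True
    then obtain w0 where w0: "w0 \<in> W" "\<And>i. i \<in> I \<Longrightarrow> l i w0 = 0" "l i w0 \<noteq> 0" by blast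
    have "\<exists>c. \<forall>i\<in>insert i I. l i (\<lambda>x. w x - (\<Sum>j<Suc n. c j *\<^sub>R (e(n := w0)) j x)) = 0"
      if w: "w \<in> W" for w
    proof -
      obtain c where c: "\<forall>i\<in>I. l i (\<lambda>x. w x - (\<Sum>j<n. c j *\<^sub>R e j x)) = 0" using span w by blast
      define r where "r = (\<lambda>x. w x - (\<Sum>j<n. c j *\<^sub>R e j x))"
      have r: "r \<in> W" unfolding r_def using diffW[OF w] e by blast
      \<comment> \<open>The earlier functionals vanish at \<open>w0\<close>, so correcting by this
        multiple kills the new functional and leaves the old ones at zero.\<close>
      define a where "a = l i r / l i w0"
      have "(\<lambda>x. w x - (\<Sum>j<Suc n. (c(n := a)) j *\<^sub>R (e(n := w0)) j x))
          = (\<lambda>x. 1 *\<^sub>R r x + (-a) *\<^sub>R w0 x)"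
        by (auto simp: r_def)
      moreover have "l i' (\<lambda>x. 1 *\<^sub>R r x + (-a) *\<^sub>R w0 x) = l i' r - a * l i' w0"
        if "i' \<in> insert i I" for i'
        using lin_onD[OF insert.prems[OF that] r w0(1), of 1 "-a"] by simp
      moreover have "l i' r - a * l i' w0 = 0" if "i' \<in> insert i I" for i'
        using that c w0 by (auto simp: a_def r_def)
      ultimately have "\<forall>i'\<in>insert i I. l i' (\<lambda>x. w x - (\<Sum>j<Suc n. (c(n := a)) j *\<^sub>R (e(n := w0)) j x)) = 0"
        by simp
      then show ?thesis by (intro exI[of _ "c(n := a)"])
    qed
    then show ?thesis using e w0
      by (intro exI[of _ "Suc n"] exI[of _ "e(n := w0)"]) (auto simp: less_Suc_eq)
  qed
qed

text \<open>\<open>Z\<close> contains the elements of \<open>W\<close> that vanish almost everywhere; the form need only be nondegenerate modulo \<open>Z\<close>.\<close>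

lemma symmetric_form_solvable:
  fixes W :: "('x \<Rightarrow> 'b::real_vector) set"
  assumes W: "lin_closed W" and I: "finite I" and l: "\<And>i. i \<in> I \<Longrightarrow> lin_on W (l i)"
    and sep: "\<And>w. w \<in> W \<Longrightarrow> (\<And>i. i \<in> I \<Longrightarrow> l i w = 0) \<Longrightarrow> w \<in> Z"
    and sym: "\<And>u w. u \<in> W \<Longrightarrow> w \<in> W \<Longrightarrow> B u w = B w u"
    and lin: "\<And>u. u \<in> W \<Longrightarrow> lin_on W (B u)"
    and null: "\<And>u w. u \<in> W \<Longrightarrow> w \<in> W \<Longrightarrow> w \<in> Z \<Longrightarrow> B u w = 0"
    and nondeg: "\<And>w. w \<in> W \<Longrightarrow> (\<And>u. u \<in> W \<Longrightarrow> B w u = 0) \<Longrightarrow> w \<in> Z"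
    and F: "lin_on W F" "\<And>w. w \<in> W \<Longrightarrow> w \<in> Z \<Longrightarrow> F w = 0"
  shows "\<exists>w\<in>W. \<forall>u\<in>W. B w u = F u"
proof -
  have "\<exists>(n::nat) e. (\<forall>j<n. e j \<in> W) \<and>
      (\<forall>w\<in>W. \<exists>c. \<forall>i\<in>I. l i (\<lambda>x. w x - (\<Sum>j<n. c j *\<^sub>R e j x)) = 0)"
    by (rule finite_generators[OF W I l])
  then obtain n :: nat and e
    where gen: "(\<forall>j<n. e j \<in> W) \<and>
      (\<forall>w\<in>W. \<exists>c. \<forall>i\<in>I. l i (\<lambda>x. w x - (\<Sum>j<n. c j *\<^sub>R e j x)) = 0)"
    by (elim exE)
  then have e: "\<And>j. j < n \<Longrightarrow> e j \<in> W" by simp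
  have span: "\<exists>c. \<forall>i\<in>I. l i (\<lambda>x. w x - (\<Sum>j<n. c j *\<^sub>R e j x)) = 0" if "w \<in> W" for w
    using gen that by simp
  \<comment> \<open>An element annihilated by all generators is annihilated by all of
    \<open>W\<close>, because the generators span \<open>W\<close> up to elements of
    \<open>Z\<close>, where the form vanishes. Nondegeneracy then puts it into \<open>Z\<close>, and
    there \<open>F\<close> vanishes.\<close>
  have "F w = 0" if w: "w \<in> W" and 0: "\<And>j. j \<in> {..<n} \<Longrightarrow> B (e j) w = 0" for w
  proof -
    have "B w u = 0" if u: "u \<in> W" for u
    proof -
      obtain c where c: "\<And>i. i \<in> I \<Longrightarrow> l i (\<lambda>x. u x - (\<Sum>j<n. c j *\<^sub>R e j x)) = 0"
        using span[OF u] by blast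
      define s where "s = (\<lambda>x. \<Sum>j<n. c j *\<^sub>R e j x)"
      have s: "s \<in> W" unfolding s_def using lin_closed_sum[OF W] e by blast
      have eq: "(\<lambda>x. 1 *\<^sub>R u x + (-1) *\<^sub>R s x) = (\<lambda>x. u x - (\<Sum>j<n. c j *\<^sub>R e j x))"
        by (simp add: s_def)
      have "(\<lambda>x. 1 *\<^sub>R u x + (-1) *\<^sub>R s x) \<in> W" by (rule lin_closedD[OF W u s])
      then have "B w (\<lambda>x. 1 *\<^sub>R u x + (-1) *\<^sub>R s x) = 0"
        using null[OF w] sep c unfolding eq by blast
      then have "B w u = B w s" using lin_onD[OF lin[OF w] u s, of 1 "-1"] by simp
      also have "B w s = (\<Sum>j<n. c j * B w (e j))"
        unfolding s_def using lin_on_sum[OF W lin[OF w], of "{..<n}" e c] e by simp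
      also have "\<dots> = 0" using 0 e sym[OF w] by (intro sum.neutral) auto
      finally show ?thesis .
    qed
    then show ?thesis using F(2) nondeg w by blast
  qed
  then have "\<exists>c. \<forall>w\<in>W. F w = (\<Sum>j\<in>{..<n}. c j * B (e j) w)"
    using lin e by (intro functional_in_span[OF W _ _ F(1)]) auto
  then obtain c where c: "\<And>w. w \<in> W \<Longrightarrow> F w = (\<Sum>j<n. c j * B (e j) w)" by auto
  \<comment> \<open>By symmetry, the coefficients that express \<open>F\<close> through the
    functionals \<open>B (e j)\<close> are the coefficients of a solution in the generators.\<close>
  define s where "s = (\<lambda>x. \<Sum>j<n. c j *\<^sub>R e j x)"
  have s: "s \<in> W" unfolding s_def using lin_closed_sum[OF W] e by blast
  have "B s u = F u" if u: "u \<in> W" for u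
  proof -
    have "B s u = B u s" using sym s u by simp
    also have "\<dots> = (\<Sum>j<n. c j * B u (e j))"
      unfolding s_def using lin_on_sum[OF W lin[OF u], of "{..<n}" e c] e by simp
    also have "\<dots> = F u" unfolding c[OF u] using sym[OF u] e by (intro sum.cong) auto
    finally show ?thesis .
  qed
  then show ?thesis using s by blast
qed

section \<open>Lebesgue measure under affine bijections\<close>

lemma nn_integral_lborel_translate:
  fixes f :: "'a::euclidean_space \<Rightarrow> ennreal"
  assumes [measurable]: "f \<in> borel_measurable borel"
  shows "(\<integral>\<^sup>+x. f (x + t) \<partial>lborel) = (\<integral>\<^sup>+x. f x \<partial>lborel)"
proof -
  have "(\<integral>\<^sup>+x. f x \<partial>lborel) = (\<integral>\<^sup>+x. f x \<partial>distr lborel borel ((+) t))"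
    by (simp add: lborel_distr_plus)
  also have "\<dots> = (\<integral>\<^sup>+x. f (x + t) \<partial>lborel)"
    by (subst nn_integral_distr) (auto simp: add.commute)
  finally show ?thesis by simp
qed

lemma nn_integral_lborel_reflect:
  fixes f :: "'a::euclidean_space \<Rightarrow> ennreal"
  assumes [measurable]: "f \<in> borel_measurable borel"
  shows "(\<integral>\<^sup>+x. f (t - x) \<partial>lborel) = (\<integral>\<^sup>+x. f x \<partial>lborel)"
proof -
  have "(\<integral>\<^sup>+x. f x \<partial>lborel) = (\<integral>\<^sup>+x. f x \<partial>density (distr lborel borel (\<lambda>x. t + (-1) *\<^sub>R x)) (\<lambda>_. ennreal (\<bar>-1::real\<bar>^DIM('a))))"
    by (subst lborel_affine[of "-1" t]) simp_all
  also have "\<dots> = (\<integral>\<^sup>+x. f (t - x) \<partial>lborel)"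
    by (simp add: nn_integral_density nn_integral_distr)
  finally show ?thesis by simp
qed

text \<open>The image of Lebesgue measure under a linear bijection is translation invariant, hence a
  multiple of Lebesgue measure; integrating \<open>g (A y) f (x + A y)\<close> in both orders compares the two.\<close>

lemma nn_integral_linear_bij:
  fixes A :: "'a::euclidean_space \<Rightarrow> 'a"
  assumes A: "linear A" "linear B" and inv: "\<And>x. A (B x) = x" "\<And>x. B (A x) = x"
  shows "\<exists>c>0. \<forall>f\<in>borel_measurable borel. (\<integral>\<^sup>+x. f (A x) \<partial>lborel) = ennreal c * (\<integral>\<^sup>+x. f x \<partial>lborel)"
proof -
  \<comment> \<open>The unit cube has measure one, so integrating a shifted \<open>g\<close> gives
    the factor one, and \<open>C\<close> is the measure of the cube's preimage under
    \<open>A\<close>.\<close>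
  define g :: "'a \<Rightarrow> ennreal" where "g = indicator (cbox 0 One)"
  have gm[measurable]: "g \<in> borel_measurable borel" unfolding g_def by measurable
  have cA: "continuous_on S A" and cB: "continuous_on S B" for S
    using A linear_continuous_on linear_conv_bounded_linear by blast+
  have Am[measurable]: "A \<in> borel \<rightarrow>\<^sub>M borel" by (intro borel_measurable_continuous_onI cA)
  have eq: "{y. A y \<in> cbox 0 One} = B ` cbox 0 One" using inv by (auto simp: image_iff) metis
  define C where "C = (\<integral>\<^sup>+y. g (A y) \<partial>lborel)"
  have C: "C = emeasure lborel (B ` cbox 0 One)"
  proof -
    have "C = (\<integral>\<^sup>+y. indicator (B ` cbox 0 One) y \<partial>lborel)"
      unfolding C_def g_def eq[symmetric] by (intro nn_integral_cong) (auto simp: indicator_def)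
    then show ?thesis
      using compact_continuous_image[OF cB[of "cbox 0 One"]] by (simp add: borel_compact)
  qed
  have fin: "C < \<infinity>" unfolding C
    by (intro emeasure_bounded_finite compact_imp_bounded compact_continuous_image cB compact_cbox)
  have pos: "C > 0"
  proof -
    have "open {y. A y \<in> box 0 One}" using cA[of UNIV]
      by (intro open_vimage[of _ A, unfolded vimage_def]) auto
    moreover have "B (One /\<^sub>R 2) \<in> {y. A y \<in> box 0 One}" using inv by (auto simp: mem_box)
    ultimately have "emeasure lborel {y. A y \<in> box 0 One} > 0"
      using open_not_negligible[of "{y. A y \<in> box 0 One}"]
      by (auto simp: negligible_iff_null_sets null_sets_completion_iff borel_open null_sets_def zero_less_iff_neq_zero)
    also have "emeasure lborel {y. A y \<in> box 0 One} \<le> C" unfolding C eq[symmetric]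
      using box_subset_cbox[of 0 "One::'a"] eq compact_continuous_image[OF cB[of "cbox 0 One"]]
      by (intro emeasure_mono) (auto simp: borel_compact)
    finally show ?thesis .
  qed
  have "(\<integral>\<^sup>+x. f (A x) \<partial>lborel) = C * (\<integral>\<^sup>+x. f x \<partial>lborel)" if [measurable]: "f \<in> borel_measurable borel" for f
  proof -
    have "C * (\<integral>\<^sup>+x. f x \<partial>lborel) = (\<integral>\<^sup>+y. g (A y) * (\<integral>\<^sup>+x. f x \<partial>lborel) \<partial>lborel)"
      unfolding C_def by (subst nn_integral_multc) auto
    also have "\<dots> = (\<integral>\<^sup>+y. (\<integral>\<^sup>+x. g (A y) * f (x + A y) \<partial>lborel) \<partial>lborel)"
      by (simp add: nn_integral_cmult nn_integral_lborel_translate)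
    also have "\<dots> = (\<integral>\<^sup>+x. (\<integral>\<^sup>+y. g (A y) * f (x + A y) \<partial>lborel) \<partial>lborel)"
      by (intro lborel_pair.Fubini') measurable
    \<comment> \<open>In the new variable \<open>y + B x\<close>, whose image under \<open>A\<close>
      is \<open>x + A y\<close>, the shift by \<open>x\<close> sits in \<open>g\<close> and no
      longer in \<open>f\<close>; the integral over \<open>x\<close> then involves \<open>g\<close>
      alone.\<close>
    also have "\<dots> = (\<integral>\<^sup>+x. (\<integral>\<^sup>+y. g (A y - x) * f (A y) \<partial>lborel) \<partial>lborel)"
    proof (rule nn_integral_cong)
      fix x
      have "(\<integral>\<^sup>+y. g (A y - x) * f (A y) \<partial>lborel) = (\<integral>\<^sup>+y. g (A (y + B x) - x) * f (A (y + B x)) \<partial>lborel)"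
        by (rule nn_integral_lborel_translate[symmetric]) measurable
      also have "\<dots> = (\<integral>\<^sup>+y. g (A y) * f (x + A y) \<partial>lborel)"
        using linear_add[OF A(1)] inv by (simp add: add.commute)
      finally show "(\<integral>\<^sup>+y. g (A y) * f (x + A y) \<partial>lborel) = (\<integral>\<^sup>+y. g (A y - x) * f (A y) \<partial>lborel)" by simp
    qed
    also have "\<dots> = (\<integral>\<^sup>+y. (\<integral>\<^sup>+x. g (A y - x) * f (A y) \<partial>lborel) \<partial>lborel)"
      by (intro lborel_pair.Fubini') measurable
    also have "\<dots> = (\<integral>\<^sup>+y. f (A y) \<partial>lborel)"
    proof (rule nn_integral_cong)
      fix y
      have "(\<integral>\<^sup>+x. g (A y - x) \<partial>lborel) = 1"
        by (subst nn_integral_lborel_reflect) (auto simp: g_def)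
      then show "(\<integral>\<^sup>+x. g (A y - x) * f (A y) \<partial>lborel) = f (A y)"
        by (subst nn_integral_multc) auto
    qed
    finally show ?thesis by simp
  qed
  moreover obtain c where "C = ennreal c" "c > 0"
    using fin pos by (cases C) (auto simp: ennreal_less_zero_iff)
  ultimately show ?thesis by blast
qed

text \<open>The comparison of nonnegative integrals, applied to indicators, identifies the image of
  \<open>lborel\<close> as the measure with constant density \<open>c\<close>. Arguing through
  measures covers functions of either sign, integrable or not.\<close>

lemma integral_affine_bij:
  fixes A :: "'a::euclidean_space \<Rightarrow> 'a"
  assumes A: "linear A" "linear B" and inv: "\<And>x. A (B x) = x" "\<And>x. B (A x) = x"
  shows "\<exists>c>0. \<forall>f\<in>borel_measurable borel. (\<integral>x. f (t + A x) \<partial>lborel) = c * (\<integral>x. f x \<partial>lborel :: real)"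
proof -
  obtain c where c: "c > 0"
    "\<And>f. f\<in>borel_measurable borel \<Longrightarrow> (\<integral>\<^sup>+x. f (A x) \<partial>lborel) = ennreal c * (\<integral>\<^sup>+x. f x \<partial>lborel)"
    using nn_integral_linear_bij[OF assms] by blast
  have Am[measurable]: "A \<in> borel \<rightarrow>\<^sub>M borel"
    using A(1) linear_continuous_on linear_conv_bounded_linear by (intro borel_measurable_continuous_onI) blast
  have "distr lborel borel (\<lambda>x. t + A x) = density lborel (\<lambda>_. ennreal c)"
  proof (rule measure_eqI)
    fix X assume "X \<in> sets (distr lborel borel (\<lambda>x. t + A x))"
    then have [measurable]: "X \<in> sets borel" by simp
    have "emeasure (distr lborel borel (\<lambda>x. t + A x)) X = (\<integral>\<^sup>+x. indicator X (t + A x) \<partial>lborel)"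
      by (subst nn_integral_indicator[symmetric]) (auto simp: nn_integral_distr simp del: nn_integral_indicator)
    also have "\<dots> = ennreal c * (\<integral>\<^sup>+x. indicator X (t + x) \<partial>lborel)"
      by (rule c(2)) measurable
    also have "(\<integral>\<^sup>+x. indicator X (t + x) \<partial>lborel) = (\<integral>\<^sup>+x. indicator X (x) \<partial>lborel)"
      using nn_integral_lborel_translate[of "indicator X" t] by (simp add: add.commute)
    also have "ennreal c * (\<integral>\<^sup>+x. indicator X x \<partial>lborel) = emeasure (density lborel (\<lambda>_. ennreal c)) X"
      by (subst emeasure_density) (auto simp: nn_integral_cmult)
    finally show "emeasure (distr lborel borel (\<lambda>x. t + A x)) X = emeasure (density lborel (\<lambda>_. ennreal c)) X" .
  qed simp
  then have "(\<integral>x. f (t + A x) \<partial>lborel) = c * (\<integral>x. f x \<partial>lborel)" if [measurable]: "f \<in> borel_measurable borel" for f :: "'a \<Rightarrow> real"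
  proof -
    have "(\<integral>x. f (t + A x) \<partial>lborel) = (\<integral>x. f x \<partial>distr lborel borel (\<lambda>x. t + A x))"
      by (subst integral_distr) auto
    also have "\<dots> = (\<integral>x. f x \<partial>density lborel (\<lambda>_. ennreal c))" using \<open>distr _ _ _ = _\<close> by simp
    also have "\<dots> = c * (\<integral>x. f x \<partial>lborel)" using c(1) by (subst integral_density) auto
    finally show ?thesis .
  qed
  then show ?thesis using c(1) by blast
qed

section \<open>Smooth bumps and the fundamental lemma\<close>

text \<open>With s = 1/t, the derivative of p(s) exp(-c s) with respect to t is s^2 (c p(s) - p'(s))
  exp(-c s), which gives the recursion.\<close>

fun flat_poly :: "real \<Rightarrow> nat \<Rightarrow> real poly" where
  "flat_poly c 0 = 1"
| "flat_poly c (Suc n) = [:0, 0, 1:] * (smult c (flat_poly c n) - pderiv (flat_poly c n))"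

text \<open>The \<open>n\<close>-th derivative of the function that is \<open>exp (- c / t)\<close> for \<open>t > 0\<close> and vanishes for \<open>t \<le> 0\<close>.\<close>

definition flat_deriv :: "real \<Rightarrow> nat \<Rightarrow> real \<Rightarrow> real" where
  "flat_deriv c n t = (if 0 < t then poly (flat_poly c n) (1 / t) * exp (- c / t) else 0)"

text \<open>The power \<open>s ^ k\<close> is carried along for the induction over \<open>p\<close>:
  splitting off the constant coefficient leaves a polynomial multiplied by \<open>s\<close>.\<close>

lemma poly_times_exp_tendsto_0:
  assumes c: "(c::real) > 0"
  shows "((\<lambda>s. s ^ k * poly p s * exp (- c * s)) \<longlongrightarrow> 0) at_top"
proof (induction p arbitrary: k)
  case 0
  then show ?case by simp
next
  case (pCons a p)
  have "((\<lambda>s. (c * s) ^ k / exp (c * s)) \<longlongrightarrow> 0) at_top"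
    by (rule filterlim_compose[OF tendsto_power_div_exp_0])
      (use c in \<open>auto intro!: filterlim_tendsto_pos_mult_at_top[OF tendsto_const] filterlim_ident\<close>)
  then have "((\<lambda>s. a / c ^ k * ((c * s) ^ k / exp (c * s))) \<longlongrightarrow> a / c ^ k * 0) at_top"
    by (intro tendsto_mult tendsto_const)
  moreover have "a / c ^ k * ((c * s) ^ k / exp (c * s)) = a * s ^ k * exp (- c * s)" for s
    using c by (simp add: power_mult_distrib exp_minus field_simps)
  ultimately have "((\<lambda>s. a * s ^ k * exp (- c * s)) \<longlongrightarrow> 0) at_top" by simp
  from tendsto_add[OF this pCons.IH[of "Suc k"]] show ?case by (simp add: algebra_simps)
qed

text \<open>Only the origin needs an argument: for h > 0 the difference quotient is s p(s) exp(-c s)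
  at s = 1/h, and exponential decay beats the polynomial.\<close>

lemma flat_deriv_has_real_derivative:
  assumes c: "c > 0"
  shows "(flat_deriv c n has_real_derivative flat_deriv c (Suc n) t) (at t)"
proof -
  consider "t > 0" | "t < 0" | "t = 0" by linarith
  then show ?thesis
  proof cases
    case 1
    have ev: "\<forall>\<^sub>F s in nhds t. flat_deriv c n s = poly (flat_poly c n) (1 / s) * exp (- c / s)"
      using eventually_nhds_in_open[of "{0<..}" t] 1
      by (auto simp: flat_deriv_def elim!: eventually_mono)
    have "((\<lambda>s. poly (flat_poly c n) (1 / s) * exp (- c / s)) has_real_derivative flat_deriv c (Suc n) t) (at t)"
      using 1 by (auto intro!: derivative_eq_intros simp: flat_deriv_def field_simps power2_eq_square)
    then show ?thesis using DERIV_cong_ev[OF refl ev refl] by blast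
  next
    case 2
    have ev: "\<forall>\<^sub>F s in nhds t. flat_deriv c n s = 0"
      using eventually_nhds_in_open[of "{..<0}" t] 2
      by (auto simp: flat_deriv_def elim!: eventually_mono)
    have "((\<lambda>s. 0) has_real_derivative flat_deriv c (Suc n) t) (at t)"
      using 2 by (simp add: flat_deriv_def)
    then show ?thesis using DERIV_cong_ev[OF refl ev refl] by blast
  next
    case 3
    have l: "((\<lambda>h. flat_deriv c n h / h) \<longlongrightarrow> 0) (at_left 0)"
      by (rule tendsto_eventually) (auto simp: eventually_at_left_field flat_deriv_def intro!: exI[of _ "-1"])
    have r0: "((\<lambda>h. inverse h ^ 1 * poly (flat_poly c n) (inverse h) * exp (- c * inverse h)) \<longlongrightarrow> 0) (at_right 0)"
      by (rule filterlim_compose[OF poly_times_exp_tendsto_0[OF c] filterlim_inverse_at_top_right])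
    have r: "((\<lambda>h. flat_deriv c n h / h) \<longlongrightarrow> 0) (at_right 0)"
      by (rule Lim_transform_eventually[OF r0])
        (auto simp: eventually_at_right_field flat_deriv_def field_simps intro!: exI[of _ 1])
    have "((\<lambda>h. flat_deriv c n h / h) \<longlongrightarrow> 0) (at 0)"
      using l r filterlim_split_at by blast
    then show ?thesis using 3 by (simp add: DERIV_def flat_deriv_def)
  qed
qed

text \<open>A class of functions that contains the bumps and is closed under partial derivatives.
  Smoothness of its members is then an induction over the list of directions.\<close>

inductive_set smooth_alg :: "('a::euclidean_space \<Rightarrow> real) set" where
  const: "(\<lambda>x. c) \<in> smooth_alg"
| flat: "c > 0 \<Longrightarrow> (\<lambda>x. flat_deriv c n (x \<bullet> v + t)) \<in> smooth_alg"
| add: "f \<in> smooth_alg \<Longrightarrow> g \<in> smooth_alg \<Longrightarrow> (\<lambda>x. f x + g x) \<in> smooth_alg"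
| mult: "f \<in> smooth_alg \<Longrightarrow> g \<in> smooth_alg \<Longrightarrow> (\<lambda>x. f x * g x) \<in> smooth_alg"

lemma smooth_alg_partials:
  "f \<in> smooth_alg \<Longrightarrow> \<exists>D. (\<forall>x. (f has_derivative D x) (at x)) \<and> (\<forall>b. (\<lambda>x. D x b) \<in> smooth_alg)"
proof (induction rule: smooth_alg.induct)
  case (const c)
  show ?case by (intro exI[of _ "\<lambda>x b. 0"]) (auto intro: smooth_alg.const)
next
  case (flat c n v t)
  have "((\<lambda>x. flat_deriv c n (x \<bullet> v + t)) has_derivative
      (\<lambda>b. flat_deriv c (Suc n) (x \<bullet> v + t) * (b \<bullet> v))) (at x)" for x
    by (rule has_derivative_compose[OF _ flat_deriv_has_real_derivative[OF flat, unfolded has_field_derivative_def]])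
      (auto intro!: derivative_eq_intros)
  then show ?case using flat
    by (intro exI[of _ "\<lambda>x b. flat_deriv c (Suc n) (x \<bullet> v + t) * (b \<bullet> v)"])
      (auto intro!: smooth_alg.intros)
next
  case (add f g)
  then obtain D E where "\<And>x. (f has_derivative D x) (at x)" "\<And>b. (\<lambda>x. D x b) \<in> smooth_alg"
    "\<And>x. (g has_derivative E x) (at x)" "\<And>b. (\<lambda>x. E x b) \<in> smooth_alg" by metis
  then show ?case
    by (intro exI[of _ "\<lambda>x b. D x b + E x b"]) (auto intro!: smooth_alg.add has_derivative_add)
next
  case (mult f g)
  then obtain D E where "\<And>x. (f has_derivative D x) (at x)" "\<And>b. (\<lambda>x. D x b) \<in> smooth_alg"
    "\<And>x. (g has_derivative E x) (at x)" "\<And>b. (\<lambda>x. E x b) \<in> smooth_alg" by metis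
  then show ?case using mult.hyps
    by (intro exI[of _ "\<lambda>x b. f x * E x b + D x b * g x"])
      (auto intro!: smooth_alg.add smooth_alg.mult has_derivative_mult)
qed

lemma smooth_alg_iterated_partial:
  assumes "f \<in> smooth_alg"
  shows "iterated_partial bs f \<in> smooth_alg"
proof (induction bs)
  case Nil
  then show ?case using assms by simp
next
  case (Cons b bs)
  obtain D where D: "\<And>x. (iterated_partial bs f has_derivative D x) (at x)" "(\<lambda>x. D x b) \<in> smooth_alg"
    using smooth_alg_partials[OF Cons] by blast
  then have "frechet_derivative (iterated_partial bs f) (at x) = D x" for x
    using frechet_derivative_at by metis
  then show ?case using D(2) by simp
qed

lemma smooth_alg_smooth: "f \<in> smooth_alg \<Longrightarrow> smooth_fun f"
  unfolding smooth_fun_def using smooth_alg_partials smooth_alg_iterated_partial differentiable_def by metis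

lemma smooth_alg_prod: "finite I \<Longrightarrow> (\<And>i. i \<in> I \<Longrightarrow> f i \<in> smooth_alg) \<Longrightarrow> (\<lambda>x. \<Prod>i\<in>I. f i x) \<in> smooth_alg"
  by (induction I rule: finite_induct) (auto intro: smooth_alg.intros)

text \<open>There is one flat factor for each face of the box. Its parameter
  \<open>1 / real (Suc n)\<close> tends to zero, so the factor tends to one wherever it does not
  vanish.\<close>

lemma box_bump:
  fixes a b :: "'a::euclidean_space"
  obtains \<phi> :: "nat \<Rightarrow> 'a \<Rightarrow> real" where
    "\<And>n. smooth_fun (\<phi> n)" "\<And>n x. 0 \<le> \<phi> n x" "\<And>n x. \<phi> n x \<le> 1"
    "\<And>n x. \<phi> n x \<noteq> 0 \<Longrightarrow> x \<in> box a b" "\<And>x. x \<in> box a b \<Longrightarrow> (\<lambda>n. \<phi> n x) \<longlonglongrightarrow> 1"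
proof
  define e where "e n t = flat_deriv (1 / real (Suc n)) 0 t" for n t
  have e: "e n t = (if 0 < t then exp (- (1 / real (Suc n)) / t) else 0)" for n t
    by (simp add: e_def flat_deriv_def)
  define \<phi> where "\<phi> n x = (\<Prod>i\<in>Basis. e n (x \<bullet> i + - (a \<bullet> i)) * e n (x \<bullet> (-i) + b \<bullet> i))" for n and x :: 'a
  show "smooth_fun (\<phi> n)" for n
    unfolding \<phi>_def e_def by (intro smooth_alg_smooth smooth_alg_prod smooth_alg.mult smooth_alg.flat) auto
  have e01: "0 \<le> e n t" "e n t \<le> 1" for n t by (auto simp: e)
  show "0 \<le> \<phi> n x" for n x unfolding \<phi>_def by (intro prod_nonneg mult_nonneg_nonneg) (auto simp: e01)
  show "\<phi> n x \<le> 1" for n x unfolding \<phi>_def by (intro prod_le_1) (auto simp: e01 mult_le_one)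
  show "x \<in> box a b" if "\<phi> n x \<noteq> 0" for n x
    using that by (auto simp: \<phi>_def mem_box e split: if_splits)
  show "(\<lambda>n. \<phi> n x) \<longlonglongrightarrow> 1" if x: "x \<in> box a b" for x
  proof -
    have lim: "(\<lambda>n. e n t) \<longlonglongrightarrow> 1" if "t > 0" for t
    proof -
      have "(\<lambda>n. exp (- (1 / real (Suc n)) / t)) \<longlonglongrightarrow> exp (- 0 / t)"
        using that by (intro tendsto_intros LIMSEQ_Suc[OF lim_1_over_n]) auto
      then show ?thesis using that by (simp add: e)
    qed
    have "(\<lambda>n. \<phi> n x) \<longlonglongrightarrow> (\<Prod>i\<in>(Basis::'a set). 1 * 1)"
      unfolding \<phi>_def using x by (intro tendsto_prod tendsto_mult lim) (auto simp: mem_box)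
    then show ?thesis by simp
  qed
qed

section \<open>Test functions and vanishing integrals\<close>

lemma test_function_bump:
  assumes "smooth_fun \<phi>" "cbox a b \<subseteq> \<Omega>" "\<And>x. \<phi> x \<noteq> 0 \<Longrightarrow> x \<in> box a b"
  shows "\<phi> \<in> test_functions \<Omega>"
proof -
  have "{x. \<phi> x \<noteq> 0} \<subseteq> cbox a b" using assms(3) box_subset_cbox by blast
  then have "closure {x. \<phi> x \<noteq> 0} \<subseteq> cbox a b" by (intro closure_minimal closed_cbox)
  moreover from this have "compact (closure {x. \<phi> x \<noteq> 0})"
    using bounded_subset[OF bounded_cbox] by (simp add: compact_eq_bounded_closed)
  ultimately show ?thesis using assms by (auto simp: test_functions_def)
qed

text \<open>Boxes are stable under intersection and generate the Borel sets, so the integral over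
  every Borel set vanishes, and then over every Lebesgue set, which is Borel up to a null set.
  Uniqueness of densities concludes.\<close>

lemma AE_zero_if_box_integrals_zero:
  fixes f :: "'a::euclidean_space \<Rightarrow> real"
  assumes f: "integrable lebesgue f" and 0: "\<And>a b. (\<integral>x. indicator (box a b) x * f x \<partial>lebesgue) = 0"
  shows "AE x in lebesgue. f x = 0"
proof -
  have fb: "integrable lebesgue (\<lambda>x. indicator A x * f x)" if "A \<in> sets lebesgue" for A
    using f that integrable_mult_indicator[of A lebesgue f] by simp
  have borel0: "(\<integral>x. indicator A x * f x \<partial>lebesgue) = 0" if "A \<in> sets borel" for A
  proof -
    let ?E = "range (\<lambda>(a, b). box a b::'a set)"
    have "Int_stable ?E" by (auto simp: Int_stable_def box_Int_box)
    moreover have "?E \<subseteq> Pow UNIV" by auto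
    moreover have "A \<in> sigma_sets UNIV ?E" using that by (simp add: borel_eq_box)
    ultimately show ?thesis
    proof (induction rule: sigma_sets_induct_disjoint)
      case (basic A)
      then show ?case using 0 by auto
    next
      case empty
      then show ?case by simp
    next
      case (compl A)
      have A: "A \<in> sets lebesgue" using compl by (metis borel_eq_box sets_completionI_sets sets_lborel sets_measure_of subset_UNIV Pow_UNIV)
      \<comment> \<open>Complements require the total integral, which is the limit over growing
        boxes.\<close>
      have all: "(\<integral>x. f x \<partial>lebesgue) = 0"
      proof -
        have "(\<lambda>n. \<integral>x. indicator (box (- (real n *\<^sub>R One)) (real n *\<^sub>R One)) x * f x \<partial>lebesgue) \<longlonglongrightarrow> (\<integral>x. f x \<partial>lebesgue)"
        proof (rule integral_dominated_convergence[where w="\<lambda>x. norm (f x)"])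
          show "AE x in lebesgue. (\<lambda>n. indicator (box (- (real n *\<^sub>R One)) (real n *\<^sub>R One)) x * f x) \<longlonglongrightarrow> f x"
          proof (intro AE_I2)
            fix x :: 'a
            have "x \<in> (\<Union>n::nat. box (- (real n *\<^sub>R One)) (real n *\<^sub>R One))" using UN_box_eq_UNIV by auto
            then obtain N :: nat where N: "x \<in> box (- (real N *\<^sub>R One)) (real N *\<^sub>R One)" by blast
            have "\<forall>\<^sub>F n in sequentially. indicator (box (- (real n *\<^sub>R One)) (real n *\<^sub>R One)) x * f x = f x"
              using eventually_ge_at_top[of N]
            proof eventually_elim
              case (elim n)
              have "box (- (real N *\<^sub>R One)) (real N *\<^sub>R One) \<subseteq> box (- (real n *\<^sub>R One)) (real n *\<^sub>R (One::'a))"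
                using elim by (intro subset_box_imp) (auto simp: subset_box)
              then show ?case using N by (auto simp: indicator_def)
            qed
            then show "(\<lambda>n. indicator (box (- (real n *\<^sub>R One)) (real n *\<^sub>R One)) x * f x) \<longlonglongrightarrow> f x"
              by (rule tendsto_eventually)
          qed
        qed (use f in \<open>auto simp: abs_mult indicator_def simp del: of_bool_eq_1_iff intro: borel_measurable_integrable intro!: borel_measurable_integrable[OF fb, unfolded indicator_def]\<close>)
        then show ?thesis using 0 by (simp add: LIMSEQ_const_iff)
      qed
      have "(\<lambda>x. indicator (UNIV - A) x * f x) = (\<lambda>x. f x - indicator A x * f x)"
        by (auto simp: indicator_def)
      then show ?case using all compl fb[OF A] f by simp
    next
      case (union A)
      have A: "A i \<in> sets lebesgue" for i using union by (metis borel_eq_box sets_completionI_sets sets_lborel sets_measure_of subset_UNIV Pow_UNIV range_subsetD)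
      have "set_integrable lebesgue (\<Union>i. A i) f"
        unfolding set_integrable_def using fb A by (auto intro!: fb)
      then have "(\<integral>x\<in>(\<Union>i. A i). f x \<partial>lebesgue) = (\<Sum>i. \<integral>x\<in>A i. f x \<partial>lebesgue)"
        using union(1) A by (intro lebesgue_integral_countable_add) (auto simp: disjoint_family_on_def)
      then show ?case using union by (simp add: set_lebesgue_integral_def)
    qed
  qed
  have leb0: "(\<integral>x. indicator A x * f x \<partial>lebesgue) = 0" if "A \<in> sets lebesgue" for A
  proof -
    obtain S N N' where SN: "A = S \<union> N" "N \<subseteq> N'" "N' \<in> null_sets lborel" "S \<in> sets lborel"
      using \<open>A \<in> sets lebesgue\<close> unfolding sets_completion by blast
    have "N' \<in> null_sets lebesgue" using SN by (simp add: null_sets_completionI)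
    then have "AE x in lebesgue. x \<notin> N'" by (rule AE_not_in)
    then have "AE x in lebesgue. indicator A x * f x = indicator S x * f x"
      by eventually_elim (use SN in \<open>auto simp: indicator_def\<close>)
    then have "(\<integral>x. indicator A x * f x \<partial>lebesgue) = (\<integral>x. indicator S x * f x \<partial>lebesgue)"
      using SN that by (intro integral_cong_AE borel_measurable_integrable fb) auto
    then show ?thesis using borel0 SN by simp
  qed
  show ?thesis
    using leb0 by (intro density_unique_real[of lebesgue f "\<lambda>_. 0"])
      (auto simp: f set_lebesgue_integral_def)
qed

text \<open>Bumps converge to the indicator of any box whose closure lies in
  \<open>\<Omega>\<close>, dominated by the norm of \<open>w\<close>. Hence \<open>w\<close>
  vanishes almost everywhere on each such box, and countably many of them cover
  \<open>\<Omega>\<close>.\<close>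

lemma fundamental_lemma:
  fixes w :: "'a::euclidean_space \<Rightarrow> real"
  assumes "open \<Omega>" and w: "integrable (lebesgue_on \<Omega>) w"
    and 0: "\<And>\<phi>. \<phi> \<in> test_functions \<Omega> \<Longrightarrow> (\<integral>x. \<phi> x * w x \<partial>lebesgue_on \<Omega>) = 0"
  shows "AE x in lebesgue_on \<Omega>. w x = 0"
proof -
  have \<Omega>: "\<Omega> \<in> sets lebesgue" using \<open>open \<Omega>\<close> by simp
  have box0: "(\<integral>x. indicator (box a b) x * w x \<partial>lebesgue_on \<Omega>) = 0" if "cbox a b \<subseteq> \<Omega>" for a b
  proof -
    obtain \<phi> :: "nat \<Rightarrow> 'a \<Rightarrow> real" where \<phi>: "\<And>n. smooth_fun (\<phi> n)" "\<And>n x. 0 \<le> \<phi> n x" "\<And>n x. \<phi> n x \<le> 1"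
      "\<And>n x. \<phi> n x \<noteq> 0 \<Longrightarrow> x \<in> box a b" "\<And>x. x \<in> box a b \<Longrightarrow> (\<lambda>n. \<phi> n x) \<longlonglongrightarrow> 1"
      using box_bump[of a b] by metis
    have \<phi>m: "\<phi> n \<in> borel_measurable borel" for n
    proof (intro borel_measurable_continuous_onI continuous_at_imp_continuous_on ballI)
      fix x
      have "\<phi> n differentiable at x" using \<phi>(1)[of n] unfolding smooth_fun_def
        by (elim allE[of _ "[]"]) auto
      then show "isCont (\<phi> n) x" by (rule differentiable_imp_continuous_within)
    qed
    have \<phi>m': "\<phi> n \<in> borel_measurable (lebesgue_on \<Omega>)" for n
      using \<phi>m by (simp add: borel_measurable_if_I measurable_completion measurable_restrict_space1)
    have wm: "w \<in> borel_measurable (lebesgue_on \<Omega>)" using w by auto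
    have "(\<lambda>n. \<integral>x. \<phi> n x * w x \<partial>lebesgue_on \<Omega>) \<longlonglongrightarrow> (\<integral>x. indicator (box a b) x * w x \<partial>lebesgue_on \<Omega>)"
    proof (rule integral_dominated_convergence[where w="\<lambda>x. norm (w x)"])
      show "(\<lambda>x. indicator (box a b) x * w x) \<in> borel_measurable (lebesgue_on \<Omega>)"
        using wm \<Omega> that box_subset_cbox[of a b] by (intro borel_measurable_times borel_measurable_indicator) (auto simp: sets_restrict_space_iff measurable_restrict_space1)
      show "(\<lambda>x. \<phi> i x * w x) \<in> borel_measurable (lebesgue_on \<Omega>)" for i
        using wm \<phi>m' by (intro borel_measurable_times)
      show "AE x in lebesgue_on \<Omega>. (\<lambda>n. \<phi> n x * w x) \<longlonglongrightarrow> indicator (box a b) x * w x"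
      proof (intro AE_I2)
        fix x
        show "(\<lambda>n. \<phi> n x * w x) \<longlonglongrightarrow> indicator (box a b) x * w x"
        proof (cases "x \<in> box a b")
          case True
          then show ?thesis using \<phi>(5) by (intro tendsto_mult tendsto_const) auto
        next
          case False
          then have "\<phi> n x = 0" for n using \<phi>(4) by blast
          then show ?thesis using False by simp
        qed
      qed
      show "AE x in lebesgue_on \<Omega>. norm (\<phi> n x * w x) \<le> norm (w x)" for n
        using \<phi>(2,3)[of n] by (auto simp: abs_mult intro!: mult_left_le_one_le)
    qed (use w in auto)
    moreover have "(\<integral>x. \<phi> n x * w x \<partial>lebesgue_on \<Omega>) = 0" for n
      using 0[OF test_function_bump[OF \<phi>(1)[of n] that \<phi>(4)[of n]]] .
    ultimately show ?thesis by (simp add: LIMSEQ_const_iff)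
  qed
  have loc: "AE x in lebesgue. x \<in> box a b \<longrightarrow> w x = 0" if ab: "cbox a b \<subseteq> \<Omega>" for a b
  proof -
    have sub: "box a b \<subseteq> \<Omega>" using ab box_subset_cbox by blast
    have int: "integrable lebesgue (\<lambda>x. indicator \<Omega> x * w x)"
      using w \<Omega> by (simp add: integrable_restrict_space)
    have eq: "(\<lambda>x. indicator (box a b) x * w x) = (\<lambda>x. indicator (box a b) x * (indicator \<Omega> x * w x))"
      using sub by (auto simp: indicator_def fun_eq_iff)
    have "integrable lebesgue (\<lambda>x. indicator (box a b) x * (indicator \<Omega> x * w x))"
      using integrable_mult_indicator[OF _ int, of "box a b"] by simp
    then have "integrable lebesgue (\<lambda>x. indicator (box a b) x * w x)" by (rule back_subst[of "integrable lebesgue", OF _ eq[symmetric]])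
    \<comment> \<open>Vanishing integrals are known only for boxes compactly inside
      \<open>\<Omega>\<close>, so \<open>w\<close> is cut off by \<open>box a b\<close>; a nonempty
      intersection with an arbitrary box is again such a box. An empty one is treated apart, since
      its corners may still span a closed box outside \<open>\<Omega>\<close>.\<close>
    moreover have "(\<integral>x. indicator (box c d) x * (indicator (box a b) x * w x) \<partial>lebesgue) = 0" for c d
    proof -
      obtain p q where pq: "box c d \<inter> box a b = box p q" using that box_Int_box[of c d a b] by blast
      show ?thesis
      proof (cases "box p q = {}")
        case True
        then have "(\<integral>x. indicator (box c d) x * (indicator (box a b) x * w x) \<partial>lebesgue) = (\<integral>x. 0 \<partial>(lebesgue::'a measure))"
          using pq by (intro Bochner_Integration.integral_cong) (auto simp: indicator_def)
        then show ?thesis by simp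
      next
        case False
        have "box p q \<subseteq> cbox a b" using pq box_subset_cbox[of a b] by blast
        then have "cbox p q \<subseteq> cbox a b"
          using closure_minimal[OF _ closed_cbox] closure_box[OF False] by metis
        then have "(\<integral>x. indicator (box p q) x * w x \<partial>lebesgue_on \<Omega>) = 0" using box0 ab by blast
        then have "(\<integral>x. indicator \<Omega> x * (indicator (box p q) x * w x) \<partial>lebesgue) = 0"
          using \<Omega> by (simp add: integral_restrict_space)
        moreover have "(\<integral>x. indicator (box c d) x * (indicator (box a b) x * w x) \<partial>lebesgue)
            = (\<integral>x. indicator \<Omega> x * (indicator (box p q) x * w x) \<partial>lebesgue)"
          using pq sub by (intro Bochner_Integration.integral_cong) (auto simp: indicator_def)
        ultimately show ?thesis by simp
      qed
    qed
    ultimately have "AE x in lebesgue. indicator (box a b) x * w x = 0"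
      by (intro AE_zero_if_box_integrals_zero)
    then show ?thesis by eventually_elim auto
  qed
  obtain D :: "'a set set" where D: "countable D" "\<And>X. X \<in> D \<Longrightarrow> \<exists>a b. cbox a b \<subseteq> \<Omega> \<and> X = box a b" "\<Union>D = \<Omega>"
  proof -
    have "\<exists>a b. cbox a b \<subseteq> \<Omega> \<and> x \<in> box a b" if "x \<in> \<Omega>" for x
      by (rule open_contains_cbox[OF \<open>open \<Omega>\<close> that]) blast
    then obtain A B where AB: "\<And>x. x \<in> \<Omega> \<Longrightarrow> cbox (A x) (B x) \<subseteq> \<Omega> \<and> x \<in> box (A x) (B x)" by metis
    obtain F where F: "F \<subseteq> (\<lambda>x. box (A x) (B x)) ` \<Omega>" "countable F" "\<Union>F = \<Union>((\<lambda>x. box (A x) (B x)) ` \<Omega>)"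
      by (rule Lindelof[of "(\<lambda>x. box (A x) (B x)) ` \<Omega>"]) (auto simp: open_box)
    show ?thesis
    proof
      show "countable F" by fact
      show "\<exists>a b. cbox a b \<subseteq> \<Omega> \<and> X = box a b" if "X \<in> F" for X using that F(1) AB by blast
      show "\<Union>F = \<Omega>" unfolding F(3) using AB box_subset_cbox by fastforce
    qed
  qed
  have "AE x in lebesgue. \<forall>X\<in>D. x \<in> X \<longrightarrow> w x = 0"
    using D(1,2) loc by (subst AE_ball_countable) fast+
  then have "AE x in lebesgue. x \<in> \<Omega> \<longrightarrow> w x = 0"
    by eventually_elim (use D(3) in blast)
  then show ?thesis using \<Omega> by (simp add: AE_restrict_space_iff)
qed

section \<open>Polynomials\<close>

definition monomial_fun :: "('a::euclidean_space \<Rightarrow> nat) \<Rightarrow> 'a \<Rightarrow> real" where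
  "monomial_fun m x = (\<Prod>b\<in>Basis. (x \<bullet> b) ^ m b)"

lemma poly_space_alt: "poly_space k = {p. \<exists>c. \<forall>x. p x = (\<Sum>m\<in>multi_indices k. c m * monomial_fun m x)}"
  by (simp add: poly_space_def monomial_fun_def)

lemma finite_multi_indices: "finite (multi_indices k :: ('a::euclidean_space \<Rightarrow> nat) set)"
  by (rule finite_subset[of _ "Basis \<rightarrow>\<^sub>E {..k}"]) (auto simp: multi_indices_def intro: finite_PiE)

lemma poly_space_comb:
  assumes "p \<in> poly_space k" "q \<in> poly_space k"
  shows "(\<lambda>x. a * p x + b * q x) \<in> poly_space k"
proof -
  obtain c d where "\<And>x. p x = (\<Sum>m\<in>multi_indices k. c m * monomial_fun m x)"
    "\<And>x. q x = (\<Sum>m\<in>multi_indices k. d m * monomial_fun m x)"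
    using assms by (auto simp: poly_space_alt)
  then show ?thesis unfolding poly_space_alt
    by (intro CollectI exI[of _ "\<lambda>m. a * c m + b * d m"])
      (simp add: sum_distrib_left sum.distrib algebra_simps)
qed

lemma poly_space_zero: "(\<lambda>x. 0) \<in> poly_space k"
  unfolding poly_space_alt by (intro CollectI exI[of _ "\<lambda>_. 0"]) simp

lemma poly_space_scale: "p \<in> poly_space k \<Longrightarrow> (\<lambda>x. a * p x) \<in> poly_space k"
  using poly_space_comb[of p k p a 0] by simp

lemma poly_space_add: "p \<in> poly_space k \<Longrightarrow> q \<in> poly_space k \<Longrightarrow> (\<lambda>x. p x + q x) \<in> poly_space k"
  using poly_space_comb[of p k q 1 1] by simp

lemma poly_space_sum:
  "finite I \<Longrightarrow> (\<And>i. i \<in> I \<Longrightarrow> p i \<in> poly_space k) \<Longrightarrow> (\<lambda>x. \<Sum>i\<in>I. p i x) \<in> poly_space k"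
  by (induction I rule: finite_induct) (auto simp: poly_space_zero intro: poly_space_add)

lemma monomial_in_poly_space: "m \<in> multi_indices k \<Longrightarrow> monomial_fun m \<in> poly_space k"
  unfolding poly_space_alt
  by (intro CollectI exI[of _ "\<lambda>m'. if m' = m then 1 else 0"]) (simp add: finite_multi_indices if_distrib[of "\<lambda>t. t * _"] cong: if_cong)

lemma poly_space_mono:
  assumes "k \<le> l"
  shows "poly_space k \<subseteq> poly_space l"
proof
  fix p :: "'a \<Rightarrow> real" assume "p \<in> poly_space k"
  then obtain c where p: "p = (\<lambda>x. \<Sum>m\<in>multi_indices k. c m * monomial_fun m x)"
    by (auto simp: poly_space_alt)
  have "(multi_indices k :: ('a \<Rightarrow> nat) set) \<subseteq> multi_indices l"
    using assms by (fastforce simp: multi_indices_def PiE_def Pi_def)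
  then show "p \<in> poly_space l" unfolding p
    by (intro poly_space_sum poly_space_scale monomial_in_poly_space finite_multi_indices) auto
qed

lemma poly_space_const: "(\<lambda>x. c) \<in> poly_space k"
proof -
  have "(\<lambda>b\<in>Basis. 0) \<in> (multi_indices k :: ('a \<Rightarrow> nat) set)" by (auto simp: multi_indices_def)
  from poly_space_scale[OF monomial_in_poly_space[OF this], of c] show ?thesis
    by (simp add: monomial_fun_def)
qed

text \<open>Reduces statements that are compatible with linear combinations to single monomials,
  where degrees are explicit.\<close>

lemma poly_space_induct [consumes 1, case_names monomial add scale]:
  assumes "p \<in> poly_space k"
    and mono: "\<And>m. m \<in> multi_indices k \<Longrightarrow> P (monomial_fun m)"
    and add: "\<And>p q. P p \<Longrightarrow> P q \<Longrightarrow> P (\<lambda>x. p x + q x)"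
    and scale: "\<And>p a. P p \<Longrightarrow> P (\<lambda>x. a * p x)"
  shows "P p"
proof -
  obtain c where p: "p = (\<lambda>x. \<Sum>m\<in>multi_indices k. c m * monomial_fun m x)"
    using assms(1) by (auto simp: poly_space_alt)
  have "(\<lambda>b\<in>Basis. 0) \<in> (multi_indices k :: ('a \<Rightarrow> nat) set)" by (auto simp: multi_indices_def)
  then have P0: "P (\<lambda>x. 0)" using scale[OF mono, of _ 0] by simp
  have "finite I \<Longrightarrow> I \<subseteq> multi_indices k \<Longrightarrow> P (\<lambda>x. \<Sum>m\<in>I. c m * monomial_fun m x)" for I
  proof (induction I rule: finite_induct)
    case (insert m I)
    then show ?case using add[OF scale[OF mono[of m]], of "\<lambda>x. \<Sum>m\<in>I. c m * monomial_fun m x" "c m"] by simp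
  qed (simp add: P0)
  then show ?thesis unfolding p using finite_multi_indices by blast
qed

lemma poly_space_mult_coord:
  assumes "p \<in> poly_space k" and b: "b \<in> Basis"
  shows "(\<lambda>x. (x \<bullet> b) * p x) \<in> poly_space (Suc k)"
  using assms(1)
proof (induction rule: poly_space_induct)
  case (monomial m)
  have "m(b := Suc (m b)) \<in> multi_indices (Suc k)"
  proof -
    have "(\<Sum>b'\<in>Basis. (m(b := Suc (m b))) b') = Suc (\<Sum>b'\<in>Basis. m b')"
      using b by (simp add: sum.remove[of Basis b])
    moreover have "m(b := Suc (m b)) \<in> Basis \<rightarrow>\<^sub>E {..Suc k}"
      using monomial b by (fastforce simp: multi_indices_def PiE_def Pi_def extensional_def)
    ultimately show ?thesis using monomial by (simp add: multi_indices_def)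
  qed
  moreover have "monomial_fun (m(b := Suc (m b))) = (\<lambda>x. (x \<bullet> b) * monomial_fun m x)"
    using b by (simp add: monomial_fun_def fun_eq_iff prod.remove[of Basis b])
  ultimately show ?case by (metis monomial_in_poly_space)
next
  case (add p q)
  then show ?case using poly_space_add by (fastforce simp: algebra_simps)
next
  case (scale p a)
  then show ?case using poly_space_scale[OF scale, of a] by (simp add: algebra_simps)
qed

lemma poly_space_mult_affine:
  assumes p: "p \<in> poly_space k"
  shows "(\<lambda>x. (x \<bullet> n + c) * p x) \<in> poly_space (Suc k)"
proof -
  have "(\<lambda>x. (n \<bullet> b) * ((x \<bullet> b) * p x)) \<in> poly_space (Suc k)" if "b \<in> Basis" for b
    by (rule poly_space_scale[OF poly_space_mult_coord[OF p that]])
  then have "(\<lambda>x. \<Sum>b\<in>Basis. (n \<bullet> b) * ((x \<bullet> b) * p x)) \<in> poly_space (Suc k)"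
    by (intro poly_space_sum) auto
  moreover have "(\<lambda>x. c * p x) \<in> poly_space (Suc k)"
    using poly_space_scale[OF p] poly_space_mono[of k "Suc k"] by auto
  ultimately have "(\<lambda>x. (\<Sum>b\<in>Basis. (n \<bullet> b) * ((x \<bullet> b) * p x)) + c * p x) \<in> poly_space (Suc k)"
    by (rule poly_space_add)
  moreover have "(\<Sum>b\<in>Basis. (n \<bullet> b) * ((x \<bullet> b) * p x)) = (x \<bullet> n) * p x" for x
    unfolding euclidean_inner[of x n] sum_distrib_right by (rule sum.cong) (simp_all add: mult_ac)
  ultimately show ?thesis by (simp add: algebra_simps)
qed

lemma monomial_fun_has_derivative:
  "(monomial_fun m has_derivative
     (\<lambda>h. \<Sum>b\<in>Basis. (of_nat (m b) * (x \<bullet> b) ^ (m b - 1) * (h \<bullet> b)) * (\<Prod>b'\<in>Basis - {b}. (x \<bullet> b') ^ m b'))) (at x)"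
  unfolding monomial_fun_def[abs_def]
  by (rule has_derivative_prod) (auto intro!: derivative_eq_intros)

text \<open>The truncated \<open>k - 1\<close> is harmless at \<open>k = 0\<close>: the gradient
  vanishes, and zero lies in every space. The gradient is paired with arbitrary vectors instead of
  basis vectors because vertices of simplices take that place later.\<close>

lemma poly_space_gradient:
  assumes "p \<in> poly_space k"
  shows "\<exists>g. (\<forall>x. (p has_derivative (\<lambda>h. g x \<bullet> h)) (at x)) \<and> (\<forall>n. (\<lambda>x. g x \<bullet> n) \<in> poly_space (k - 1))"
  using assms
proof (induction rule: poly_space_induct)
  case (monomial m)
  define d where "d b x = of_nat (m b) * monomial_fun (m(b := m b - 1)) x" for b x
  have d: "d b \<in> poly_space (k - 1)" if b: "b \<in> Basis" for b
  proof (cases "m b = 0")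
    case True
    then have "d b = (\<lambda>x. 0)" by (intro ext) (simp add: d_def)
    then show ?thesis by (simp add: poly_space_zero)
  next
    case False
    have s: "(\<Sum>b'\<in>Basis. (m(b := m b - 1)) b') = (\<Sum>b'\<in>Basis. m b') - 1"
      using b False by (simp add: sum.remove[of Basis b])
    have le: "m' b' \<le> (\<Sum>b'\<in>Basis. m' b')" if "b' \<in> Basis" for b' :: 'a and m' :: "'a \<Rightarrow> nat"
      using that by (simp add: member_le_sum)
    have "(m(b := m b - 1)) \<in> extensional Basis"
      using monomial b by (auto simp: multi_indices_def PiE_def extensional_def)
    moreover have "(m(b := m b - 1)) b' \<le> k - 1" if "b' \<in> Basis" for b'
    proof -
      have "(m(b := m b - 1)) b' \<le> (\<Sum>b'\<in>Basis. m b') - 1" using le[OF that, of "m(b := m b - 1)"] s by metis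
      moreover have "(\<Sum>b'\<in>Basis. m b') \<le> k" using monomial by (simp add: multi_indices_def)
      ultimately show ?thesis by linarith
    qed
    ultimately have "m(b := m b - 1) \<in> multi_indices (k - 1)"
      using s monomial by (auto simp: multi_indices_def PiE_def Pi_def)
    from poly_space_scale[OF monomial_in_poly_space[OF this]] show ?thesis by (simp add: d_def[abs_def])
  qed
  define g where "g x = (\<Sum>b\<in>Basis. d b x *\<^sub>R b)" for x
  have "(monomial_fun m has_derivative (\<lambda>h. g x \<bullet> h)) (at x)" for x
  proof -
    have "(\<Sum>b\<in>Basis. (of_nat (m b) * (x \<bullet> b) ^ (m b - 1) * (h \<bullet> b)) * (\<Prod>b'\<in>Basis - {b}. (x \<bullet> b') ^ m b')) = g x \<bullet> h" for h
      unfolding g_def inner_sum_left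
      by (intro sum.cong) (auto simp: d_def monomial_fun_def prod.remove[of Basis] inner_commute)
    then show ?thesis using monomial_fun_has_derivative[of m x] by simp
  qed
  moreover have "(\<lambda>x. g x \<bullet> n) \<in> poly_space (k - 1)" for n
  proof -
    have "(\<lambda>x. \<Sum>b\<in>Basis. (b \<bullet> n) * d b x) \<in> poly_space (k - 1)"
      by (intro poly_space_sum poly_space_scale d) auto
    then show ?thesis by (simp add: g_def inner_sum_left mult.commute)
  qed
  ultimately show ?case by blast
next
  case (add p q)
  then obtain g g' where "\<And>x. (p has_derivative (\<lambda>h. g x \<bullet> h)) (at x)" "\<And>n. (\<lambda>x. g x \<bullet> n) \<in> poly_space (k - 1)"
    "\<And>x. (q has_derivative (\<lambda>h. g' x \<bullet> h)) (at x)" "\<And>n. (\<lambda>x. g' x \<bullet> n) \<in> poly_space (k - 1)" by metis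
  then show ?case
    by (intro exI[of _ "\<lambda>x. g x + g' x"]) (auto simp: inner_add_left intro!: has_derivative_add poly_space_add)
next
  case (scale p a)
  then obtain g where "\<And>x. (p has_derivative (\<lambda>h. g x \<bullet> h)) (at x)" "\<And>n. (\<lambda>x. g x \<bullet> n) \<in> poly_space (k - 1)" by metis
  then show ?case
    by (intro exI[of _ "\<lambda>x. a *\<^sub>R g x"]) (auto intro!: has_derivative_mult_right poly_space_scale)
qed

lemma poly_space_continuous: "p \<in> poly_space k \<Longrightarrow> continuous_on S p"
  using poly_space_gradient[of p k] has_derivative_continuous
  by (metis continuous_at_imp_continuous_on)

text \<open>Inner products with arbitrary vectors replace components along \<open>Basis\<close>, so
  that the fields below need no coordinates.\<close>

lemma RT_poly_space_alt:
  "RT_poly_space k = {q. \<exists>p r. (\<forall>n. (\<lambda>x. p x \<bullet> n) \<in> poly_space k) \<and> r \<in> poly_space k \<and> (\<forall>x. q x = p x + r x *\<^sub>R x)}"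
  (is "_ = ?R")
proof
  show "RT_poly_space k \<subseteq> ?R"
  proof
    fix q :: "'a \<Rightarrow> 'a" assume "q \<in> RT_poly_space k"
    then obtain p r where pr: "\<And>b. b \<in> Basis \<Longrightarrow> p b \<in> poly_space k" "r \<in> poly_space k"
      "\<And>x. q x = (\<Sum>b\<in>Basis. p b x *\<^sub>R b) + r x *\<^sub>R x" by (auto simp: RT_poly_space_def)
    have "(\<lambda>x. \<Sum>b\<in>Basis. (b \<bullet> n) * p b x) \<in> poly_space k" for n
      using pr by (intro poly_space_sum poly_space_scale) auto
    then have "(\<lambda>x. (\<Sum>b\<in>Basis. p b x *\<^sub>R b) \<bullet> n) \<in> poly_space k" for n
      by (simp add: inner_sum_left mult.commute)
    then show "q \<in> ?R" using pr
      by (intro CollectI exI[of _ "\<lambda>x. \<Sum>b\<in>Basis. p b x *\<^sub>R b"] exI[of _ r]) auto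
  qed
  show "?R \<subseteq> RT_poly_space k"
  proof
    fix q :: "'a \<Rightarrow> 'a" assume "q \<in> ?R"
    then obtain p r where pr: "\<And>n. (\<lambda>x. p x \<bullet> n) \<in> poly_space k" "r \<in> poly_space k"
      "\<And>x. q x = p x + r x *\<^sub>R x" by auto
    then show "q \<in> RT_poly_space k" unfolding RT_poly_space_def
      by (intro CollectI exI[of _ "\<lambda>b x. p x \<bullet> b"] exI[of _ r]) (simp add: euclidean_representation)
  qed
qed

lemma RT_poly_space_comb:
  assumes "p \<in> RT_poly_space k" "q \<in> RT_poly_space k"
  shows "(\<lambda>x. a *\<^sub>R p x + b *\<^sub>R q x) \<in> RT_poly_space k"
proof -
  obtain p1 r1 p2 r2 where pr: "\<And>n. (\<lambda>x. p1 x \<bullet> n) \<in> poly_space k" "r1 \<in> poly_space k"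
      "\<And>x. p x = p1 x + r1 x *\<^sub>R x" "\<And>n. (\<lambda>x. p2 x \<bullet> n) \<in> poly_space k" "r2 \<in> poly_space k"
      "\<And>x. q x = p2 x + r2 x *\<^sub>R x" using assms unfolding RT_poly_space_alt by auto
  then show ?thesis unfolding RT_poly_space_alt
    by (intro CollectI exI[of _ "\<lambda>x. a *\<^sub>R p1 x + b *\<^sub>R p2 x"] exI[of _ "\<lambda>x. a * r1 x + b * r2 x"])
      (auto simp: inner_add_left algebra_simps intro!: poly_space_comb)
qed

lemma RT_poly_space_zero: "(\<lambda>x. 0) \<in> RT_poly_space k"
  unfolding RT_poly_space_alt by (intro CollectI exI[of _ "\<lambda>x. 0"]) (auto simp: poly_space_zero)

text \<open>This is why cone fields fit the element: \<open>r x *\<^sub>R x\<close> is the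
  admissible part of higher degree, and the shift to the apex adds only a vector polynomial of
  degree at most \<open>k\<close>.\<close>

lemma RT_poly_space_cone:
  assumes "r \<in> poly_space k"
  shows "(\<lambda>x. r x *\<^sub>R (x - a)) \<in> RT_poly_space k"
proof -
  have "(\<lambda>x. (r x *\<^sub>R - a) \<bullet> n) \<in> poly_space k" for n
    using poly_space_scale[OF assms, of "- a \<bullet> n"] by (simp add: mult.commute)
  then show ?thesis unfolding RT_poly_space_alt using assms
    by (intro CollectI exI[of _ "\<lambda>x. r x *\<^sub>R - a"] exI[of _ r]) (auto simp: algebra_simps)
qed

lemma RT_poly_space_inner:
  assumes "q \<in> RT_poly_space k"
  shows "(\<lambda>x. q x \<bullet> n) \<in> poly_space (Suc k)"
proof -
  obtain p r where pr: "\<And>n. (\<lambda>x. p x \<bullet> n) \<in> poly_space k" "r \<in> poly_space k"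
      "\<And>x. q x = p x + r x *\<^sub>R x" using assms unfolding RT_poly_space_alt by auto
  have "(\<lambda>x. p x \<bullet> n + (x \<bullet> n + 0) * r x) \<in> poly_space (Suc k)"
    using pr poly_space_mono[of k "Suc k"] poly_space_mult_affine[OF pr(2), of n 0]
    by (intro poly_space_add) auto
  then show ?thesis using pr by (simp add: inner_add_left mult.commute)
qed

lemma RT_poly_space_continuous:
  assumes "q \<in> RT_poly_space k"
  shows "continuous_on S q"
proof -
  have "continuous_on S (\<lambda>x. \<Sum>b\<in>Basis. (q x \<bullet> b) *\<^sub>R b)"
    by (intro continuous_on_sum continuous_on_scaleR continuous_on_const
        poly_space_continuous[OF RT_poly_space_inner[OF assms]])
  then show ?thesis by (simp add: euclidean_representation)
qed

section \<open>Barycentric coordinates\<close>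

definition full_simplex :: "'a::euclidean_space set \<Rightarrow> bool" where
  "full_simplex C \<longleftrightarrow> \<not> affine_dependent C \<and> card C = Suc (DIM('a))"

text \<open>Meant for every point of the space: for a full simplex the coefficients exist because
  its affine hull is everything, they are unique by affine independence, and some are negative
  outside the simplex.\<close>

definition bary :: "'a::euclidean_space set \<Rightarrow> 'a \<Rightarrow> 'a \<Rightarrow> real" where
  "bary C v y = (SOME u. sum u C = 1 \<and> (\<Sum>w\<in>C. u w *\<^sub>R w) = y) v"

lemma full_simplex_finite: "full_simplex C \<Longrightarrow> finite C"
  by (simp add: full_simplex_def aff_independent_finite)

lemma bary:
  assumes "full_simplex C"
  shows bary_sum: "(\<Sum>v\<in>C. bary C v y) = 1" and bary_repr: "(\<Sum>v\<in>C. bary C v y *\<^sub>R v) = y"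
proof -
  have "aff_dim C = int DIM('a)" using assms aff_dim_affine_independent[of C] by (simp add: full_simplex_def)
  then have "affine hull C = UNIV" by (simp add: aff_dim_eq_full)
  then have "y \<in> affine hull C" by simp
  then have "\<exists>u. sum u C = 1 \<and> (\<Sum>w\<in>C. u w *\<^sub>R w) = y"
    using affine_hull_finite[OF full_simplex_finite[OF assms]] by auto
  from someI_ex[OF this] show "(\<Sum>v\<in>C. bary C v y) = 1" "(\<Sum>v\<in>C. bary C v y *\<^sub>R v) = y"
    unfolding bary_def[abs_def] by auto
qed

lemma bary_unique:
  assumes C: "full_simplex C" and u: "sum u C = 1" "(\<Sum>w\<in>C. u w *\<^sub>R w) = y" and v: "v \<in> C"
  shows "bary C v y = u v"
proof (rule ccontr)
  assume ne: "bary C v y \<noteq> u v"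
  have "affine_dependent C"
    unfolding affine_dependent_explicit_finite[OF full_simplex_finite[OF C]]
    using ne v u bary_sum[OF C, of y] bary_repr[OF C, of y]
    by (intro exI[of _ "\<lambda>w. bary C w y - u w"]) (auto simp: sum_subtractf scaleR_left_diff_distrib)
  then show False using C by (simp add: full_simplex_def)
qed

text \<open>By uniqueness of the coefficients, an affine combination of points has the same
  combination of coordinates. The explicit form with \<open>n\<close> and \<open>c\<close> is what
  polynomial degree and continuity are read from.\<close>

lemma bary_affine:
  assumes C: "full_simplex C" and v: "v \<in> C"
  shows "\<exists>n c. \<forall>y. bary C v y = y \<bullet> n + c"
proof -
  define f where "f y = bary C v y - bary C v 0" for y
  have "linear f"
  proof
    fix x y
    have "bary C v (x + y) = bary C v x + bary C v y - bary C v 0"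
      by (rule bary_unique[OF C _ _ v])
        (simp_all add: sum.distrib sum_subtractf scaleR_left_distrib scaleR_left_diff_distrib bary_sum[OF C] bary_repr[OF C])
    then show "f (x + y) = f x + f y" by (simp add: f_def)
  next
    fix r x
    have "bary C v (r *\<^sub>R x) = r * bary C v x + (1 - r) * bary C v 0"
      by (rule bary_unique[OF C _ _ v])
        (simp_all add: sum.distrib scaleR_left_distrib sum_distrib_left[symmetric]
          scaleR_scaleR[symmetric] scaleR_sum_right[symmetric] bary_sum[OF C] bary_repr[OF C] del: scaleR_scaleR)
    then show "f (r *\<^sub>R x) = r *\<^sub>R f x" by (simp add: f_def algebra_simps)
  qed
  define n where "n = (\<Sum>b\<in>Basis. f b *\<^sub>R b)"
  have "f y = y \<bullet> n" for y
  proof -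
    have "f y = f (\<Sum>b\<in>Basis. (y \<bullet> b) *\<^sub>R b)" by (simp add: euclidean_representation)
    also have "\<dots> = y \<bullet> n" unfolding n_def inner_sum_right
      by (simp add: linear_sum[OF \<open>linear f\<close>] linear_cmul[OF \<open>linear f\<close>] mult.commute)
    finally show ?thesis .
  qed
  then show ?thesis
    by (intro exI[of _ n] exI[of _ "bary C v 0"]) (metis f_def diff_add_cancel)
qed

lemma bary_combine:
  assumes C: "full_simplex C" and v: "v \<in> C"
  shows "bary C v (x + t *\<^sub>R (y - x)) = (1 - t) * bary C v x + t * bary C v y"
proof -
  obtain n c where "\<And>y. bary C v y = y \<bullet> n + c" using bary_affine[OF C v] by blast
  then show ?thesis by (simp add: inner_add_left inner_diff_left algebra_simps)
qed

lemma bary_continuous: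
  assumes "full_simplex C" "v \<in> C"
  shows "continuous_on S (bary C v)"
proof -
  obtain n c where "bary C v = (\<lambda>y. y \<bullet> n + c)" using bary_affine[OF assms] by fast
  then show ?thesis by (auto intro!: continuous_intros)
qed

lemma bary_vertex:
  assumes C: "full_simplex C" and "v \<in> C" "w \<in> C"
  shows "bary C v w = (if v = w then 1 else 0)"
proof (rule bary_unique[OF C _ _ assms(2)])
  show "(\<Sum>v\<in>C. if v = w then 1 else 0) = (1::real)" using full_simplex_finite[OF C] assms(3) by simp
  show "(\<Sum>v\<in>C. (if v = w then 1 else 0) *\<^sub>R v) = w"
    using full_simplex_finite[OF C] assms(3) by (simp add: if_distrib[of "\<lambda>t. t *\<^sub>R _"] cong: if_cong)
qed

text \<open>Turns membership in faces into sign conditions. With the analogous descriptions of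
  relative interiors this carries most arguments about the mesh.\<close>

lemma bary_mem_face:
  assumes C: "full_simplex C" and S: "S \<subseteq> C"
  shows "y \<in> convex hull S \<longleftrightarrow> (\<forall>v\<in>C. 0 \<le> bary C v y) \<and> (\<forall>v\<in>C - S. bary C v y = 0)"
proof -
  have fS: "finite S" using S full_simplex_finite[OF C] finite_subset by blast
  have ext: "(\<Sum>v\<in>C. if v \<in> S then u v else 0) = sum u S"
    "(\<Sum>v\<in>C. (if v \<in> S then u v else 0) *\<^sub>R v) = (\<Sum>v\<in>S. u v *\<^sub>R v)" for u
    using S full_simplex_finite[OF C]
    by (simp_all add: if_distrib[of "\<lambda>t. t *\<^sub>R _"] sum.inter_restrict[symmetric] Int_absorb1 cong: if_cong)
  show ?thesis
  proof
    assume "y \<in> convex hull S"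
    then obtain u where u: "\<And>v. v \<in> S \<Longrightarrow> 0 \<le> u v" "sum u S = 1" "(\<Sum>v\<in>S. u v *\<^sub>R v) = y"
      using convex_hull_finite[OF fS] by auto
    have "bary C v y = (if v \<in> S then u v else 0)" if "v \<in> C" for v
      by (rule bary_unique[OF C _ _ that]) (simp_all add: ext u)
    then show "(\<forall>v\<in>C. 0 \<le> bary C v y) \<and> (\<forall>v\<in>C - S. bary C v y = 0)" using u(1) by auto
  next
    assume r: "(\<forall>v\<in>C. 0 \<le> bary C v y) \<and> (\<forall>v\<in>C - S. bary C v y = 0)"
    have "sum (\<lambda>v. bary C v y) S = 1" "(\<Sum>v\<in>S. bary C v y *\<^sub>R v) = y"
      using r bary_sum[OF C, of y] bary_repr[OF C, of y] S full_simplex_finite[OF C]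
        sum.mono_neutral_left[of C S "\<lambda>v. bary C v y"] sum.mono_neutral_left[of C S "\<lambda>v. bary C v y *\<^sub>R v"]
      by auto
    then show "y \<in> convex hull S" unfolding convex_hull_finite[OF fS] using r S
      by (intro CollectI exI[of _ "\<lambda>v. bary C v y"]) auto
  qed
qed

lemma bary_mem: "full_simplex C \<Longrightarrow> y \<in> convex hull C \<longleftrightarrow> (\<forall>v\<in>C. 0 \<le> bary C v y)"
  using bary_mem_face[of C C] by auto

lemma bary_rel_interior:
  assumes C: "full_simplex C" and S: "S \<subseteq> C"
  shows "y \<in> rel_interior (convex hull S) \<longleftrightarrow> (\<forall>v\<in>S. 0 < bary C v y) \<and> (\<forall>v\<in>C - S. bary C v y = 0)"
proof -
  have fS: "finite S" using S full_simplex_finite[OF C] finite_subset by blast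
  have "\<not> affine_dependent S" using C S affine_independent_subset by (auto simp: full_simplex_def)
  note ri = rel_interior_convex_hull_explicit[OF this]
  have ext: "(\<Sum>v\<in>C. if v \<in> S then u v else 0) = sum u S"
    "(\<Sum>v\<in>C. (if v \<in> S then u v else 0) *\<^sub>R v) = (\<Sum>v\<in>S. u v *\<^sub>R v)" for u
    using S full_simplex_finite[OF C]
    by (simp_all add: if_distrib[of "\<lambda>t. t *\<^sub>R _"] sum.inter_restrict[symmetric] Int_absorb1 cong: if_cong)
  show ?thesis
  proof
    assume "y \<in> rel_interior (convex hull S)"
    then obtain u where u: "\<And>v. v \<in> S \<Longrightarrow> 0 < u v" "sum u S = 1" "(\<Sum>v\<in>S. u v *\<^sub>R v) = y"
      using ri by auto
    have "bary C v y = (if v \<in> S then u v else 0)" if "v \<in> C" for v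
      by (rule bary_unique[OF C _ _ that]) (simp_all add: ext u)
    then show "(\<forall>v\<in>S. 0 < bary C v y) \<and> (\<forall>v\<in>C - S. bary C v y = 0)" using u(1) S by auto
  next
    assume r: "(\<forall>v\<in>S. 0 < bary C v y) \<and> (\<forall>v\<in>C - S. bary C v y = 0)"
    have "sum (\<lambda>v. bary C v y) S = 1" "(\<Sum>v\<in>S. bary C v y *\<^sub>R v) = y"
      using r bary_sum[OF C, of y] bary_repr[OF C, of y] S full_simplex_finite[OF C]
        sum.mono_neutral_left[of C S "\<lambda>v. bary C v y"] sum.mono_neutral_left[of C S "\<lambda>v. bary C v y *\<^sub>R v"]
      by auto
    then show "y \<in> rel_interior (convex hull S)" unfolding ri using r
      by (intro CollectI exI[of _ "\<lambda>v. bary C v y"]) auto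
  qed
qed

lemma full_simplex_aff_dim: "full_simplex (C :: 'a set) \<Longrightarrow> aff_dim (convex hull C) = int DIM('a::euclidean_space)"
  using aff_dim_affine_independent[of C] by (simp add: full_simplex_def aff_dim_convex_hull)

lemma bary_interior:
  assumes C: "full_simplex C"
  shows "y \<in> interior (convex hull C) \<longleftrightarrow> (\<forall>v\<in>C. 0 < bary C v y)"
proof -
  have "interior (convex hull C) = rel_interior (convex hull C)"
    using full_simplex_aff_dim[OF C] interior_rel_interior_gen[of "convex hull C"] by auto
  then show ?thesis using bary_rel_interior[OF C subset_refl] by auto
qed

lemma full_simplex_interior_nonempty:
  assumes "full_simplex C"
  shows "interior (convex hull C) \<noteq> {}"
proof -
  have "interior (convex hull C) = rel_interior (convex hull C)"
    using full_simplex_aff_dim[OF assms] interior_rel_interior_gen[of "convex hull C"] by auto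
  moreover have "C \<noteq> {}" using assms by (auto simp: full_simplex_def)
  ultimately show ?thesis by (simp add: rel_interior_eq_empty)
qed

lemma compact_full_simplex: "full_simplex C \<Longrightarrow> compact (convex hull C)"
  by (simp add: finite_imp_compact_convex_hull full_simplex_finite)

lemma full_simplex_closure_interior:
  assumes "full_simplex C"
  shows "closure (interior (convex hull C)) = convex hull C"
  using convex_closure_interior[OF convex_convex_hull full_simplex_interior_nonempty[OF assms]]
    closure_closed[OF compact_imp_closed[OF compact_full_simplex[OF assms]]] by simp

text \<open>Since there are d + 1 vertices, a proper subset with at least d of them misses exactly
  one; facets are recognised below by this count.\<close>

lemma full_simplex_remove:
  assumes "full_simplex (C :: 'a::euclidean_space set)" "S \<subset> C" "card S \<ge> DIM('a)"
  shows "\<exists>v\<in>C. S = C - {v}"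
proof -
  have fin: "finite C" using assms full_simplex_finite by blast
  have "card S < card C" using assms(2) fin psubset_card_mono by blast
  moreover have "finite S" "S \<subseteq> C" using assms(2) fin finite_subset by blast+
  ultimately have "card (C - S) = 1" using assms by (simp add: full_simplex_def card_Diff_subset)
  then obtain v where "C - S = {v}" by (meson card_1_singletonE)
  then show ?thesis using assms(2) by blast
qed

lemma aff_dim_facet:
  assumes "full_simplex (C :: 'a::euclidean_space set)" "v \<in> C"
  shows "aff_dim (convex hull (C - {v})) = int DIM('a) - 1"
proof -
  have "\<not> affine_dependent (C - {v})" using assms affine_independent_subset[OF _ Diff_subset] unfolding full_simplex_def by blast
  then show ?thesis using aff_dim_affine_independent[of "C - {v}"] assms full_simplex_finite[OF assms(1)]
    by (simp add: full_simplex_def aff_dim_convex_hull)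
qed

section \<open>The divergence theorem for cone fields\<close>

definition has_grad :: "('a::euclidean_space \<Rightarrow> real) \<Rightarrow> ('a \<Rightarrow> 'a) \<Rightarrow> bool" where
  "has_grad \<psi> g \<longleftrightarrow> (\<forall>x. (\<psi> has_derivative (\<lambda>h. g x \<bullet> h)) (at x)) \<and> continuous_on UNIV g"

lemma has_grad_continuous: "has_grad \<psi> g \<Longrightarrow> continuous_on S \<psi>"
  unfolding has_grad_def by (meson continuous_at_imp_continuous_on has_derivative_continuous)

lemma has_grad_continuous_grad: "has_grad \<psi> g \<Longrightarrow> continuous_on S g"
  unfolding has_grad_def by (meson continuous_on_subset subset_UNIV)

lemma has_grad_mult:
  assumes "has_grad \<phi> f" "has_grad \<psi> g"
  shows "has_grad (\<lambda>x. \<phi> x * \<psi> x) (\<lambda>x. \<phi> x *\<^sub>R g x + \<psi> x *\<^sub>R f x)"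
  unfolding has_grad_def
proof (intro conjI allI)
  fix x
  have "((\<lambda>x. \<phi> x * \<psi> x) has_derivative (\<lambda>h. \<phi> x * (g x \<bullet> h) + (f x \<bullet> h) * \<psi> x)) (at x)"
    using assms by (intro has_derivative_mult) (auto simp: has_grad_def)
  moreover have "(\<lambda>h. \<phi> x * (g x \<bullet> h) + (f x \<bullet> h) * \<psi> x) = (\<bullet>) (\<phi> x *\<^sub>R g x + \<psi> x *\<^sub>R f x)"
    by (simp add: fun_eq_iff inner_add_left)
  ultimately show "((\<lambda>x. \<phi> x * \<psi> x) has_derivative (\<bullet>) (\<phi> x *\<^sub>R g x + \<psi> x *\<^sub>R f x)) (at x)"
    by simp
  show "continuous_on UNIV (\<lambda>x. \<phi> x *\<^sub>R g x + \<psi> x *\<^sub>R f x)"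
    using assms by (intro continuous_intros) (auto intro: has_grad_continuous has_grad_continuous_grad)
qed

lemma has_grad_diff:
  assumes "has_grad \<phi> f" "has_grad \<psi> g"
  shows "has_grad (\<lambda>x. \<phi> x - \<psi> x) (\<lambda>x. f x - g x)"
  unfolding has_grad_def
proof (intro conjI allI)
  fix x
  have "((\<lambda>x. \<phi> x - \<psi> x) has_derivative (\<lambda>h. f x \<bullet> h - g x \<bullet> h)) (at x)"
    using assms by (intro has_derivative_diff) (auto simp: has_grad_def)
  moreover have "(\<lambda>h. f x \<bullet> h - g x \<bullet> h) = (\<bullet>) (f x - g x)"
    by (simp add: fun_eq_iff inner_diff_left)
  ultimately show "((\<lambda>x. \<phi> x - \<psi> x) has_derivative (\<bullet>) (f x - g x)) (at x)" by simp
  show "continuous_on UNIV (\<lambda>x. f x - g x)"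
    using assms by (intro continuous_intros) (auto simp: has_grad_def)
qed

lemma has_grad_lipschitz:
  assumes "has_grad \<psi> g" "compact T" "convex T"
  shows "\<exists>M\<ge>0. \<forall>x\<in>T. \<forall>y\<in>T. \<bar>\<psi> x - \<psi> y\<bar> \<le> M * norm (x - y)"
proof -
  have "bounded (g ` T)"
    using assms by (intro compact_imp_bounded compact_continuous_image has_grad_continuous_grad)
  then obtain M where M: "M > 0" "\<And>x. x \<in> T \<Longrightarrow> norm (g x) \<le> M" by (auto simp: bounded_pos)
  have "norm (\<psi> x - \<psi> y) \<le> M * norm (x - y)" if "x \<in> T" "y \<in> T" for x y
  proof (rule differentiable_bound[OF \<open>convex T\<close> _ _ that])
    fix z assume "z \<in> T"
    show "(\<psi> has_derivative (\<lambda>h. g z \<bullet> h)) (at z within T)"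
      using assms by (auto simp: has_grad_def intro: has_derivative_at_withinI)
    show "onorm (\<lambda>h. g z \<bullet> h) \<le> M"
    proof (rule onorm_le)
      fix h
      have "norm (g z \<bullet> h) \<le> norm (g z) * norm h" using Cauchy_Schwarz_ineq2 by simp
      also have "\<dots> \<le> M * norm h" using M(2)[OF \<open>z \<in> T\<close>] by (simp add: mult_right_mono)
      finally show "norm (g z \<bullet> h) \<le> M * norm h" .
    qed
  qed
  then show ?thesis using M(1) by (intro exI[of _ M]) auto
qed

lemma set_integrable_compact:
  fixes f :: "'a::euclidean_space \<Rightarrow> real"
  assumes "compact T" "continuous_on T f"
  shows "set_integrable lborel T f"
  using borel_integrable_compact[OF assms] unfolding set_integrable_def
  by (rule Bochner_Integration.integrable_cong[THEN iffD1, rotated -1]) (auto simp: indicator_def)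

lemma set_integral_affine:
  fixes f :: "'a::euclidean_space \<Rightarrow> real"
  assumes s: "s > 0" and [measurable]: "f \<in> borel_measurable borel" "T \<in> sets borel"
  shows "(LINT y:(\<lambda>x. v + s *\<^sub>R (x - v)) ` T|lborel. f y) = s ^ DIM('a) * (LINT x:T|lborel. f (v + s *\<^sub>R (x - v)))"
proof -
  let ?\<sigma> = "\<lambda>x. v + s *\<^sub>R (x - v)"
  have sig: "?\<sigma> = (\<lambda>x. (v - s *\<^sub>R v) + s *\<^sub>R x)" by (auto simp: algebra_simps)
  define \<tau> where "\<tau> y = v + (1/s) *\<^sub>R (y - v)" for y
  have im: "?\<sigma> ` T = {y. \<tau> y \<in> T}"
  proof (intro set_eqI iffI)
    fix y assume "y \<in> {y. \<tau> y \<in> T}"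
    moreover have "y = ?\<sigma> (\<tau> y)" using s by (simp add: \<tau>_def)
    ultimately show "y \<in> ?\<sigma> ` T" by blast
  qed (use s in \<open>auto simp: \<tau>_def\<close>)
  have [measurable]: "{y. \<tau> y \<in> T} \<in> sets borel" unfolding \<tau>_def by measurable
  have inj: "?\<sigma> x \<in> ?\<sigma> ` T \<longleftrightarrow> x \<in> T" for x using s by auto
  have "(LINT y:?\<sigma> ` T|lborel. f y) = (\<integral>y. indicator (?\<sigma> ` T) y * f y \<partial>density (distr lborel borel (\<lambda>x. (v - s *\<^sub>R v) + s *\<^sub>R x)) (\<lambda>_. ennreal (\<bar>s\<bar>^DIM('a))))"
    unfolding set_lebesgue_integral_def using s by (subst lborel_affine[of s "v - s *\<^sub>R v"]) auto
  also have "\<dots> = s ^ DIM('a) * (\<integral>x. indicator (?\<sigma> ` T) (?\<sigma> x) * f (?\<sigma> x) \<partial>lborel)"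
    unfolding im sig[symmetric] using s by (subst integral_density) (auto simp: integral_distr)
  also have "\<dots> = s ^ DIM('a) * (LINT x:T|lborel. f (?\<sigma> x))"
    unfolding set_lebesgue_integral_def using inj by (simp add: indicator_def)
  finally show ?thesis .
qed

text \<open>The flux of \<open>\<psi> (x - v)\<close> through the facets containing \<open>v\<close> vanishes, as does that through the
  opposite facet since \<open>\<psi> = 0\<close> there. The integral is the derivative at \<open>s = 1\<close> of the integral of
  \<open>\<psi>\<close> over the simplex scaled by \<open>s\<close> about \<open>v\<close>, which only sees \<open>\<psi>\<close> on the opposite facet.\<close>

lemma simplex_cone_divergence:
  fixes C :: "'a::euclidean_space set"
  assumes C: "full_simplex C" and v: "v \<in> C" and \<psi>: "has_grad \<psi> g"
    and zero: "\<And>x. x \<in> convex hull (C - {v}) \<Longrightarrow> \<psi> x = 0"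
  shows "(LINT x:convex hull C|lborel. real DIM('a) * \<psi> x + g x \<bullet> (x - v)) = 0"
proof -
  define T where "T = convex hull C"
  define d where "d = DIM('a)"
  define \<sigma> where "\<sigma> s x = v + s *\<^sub>R (x - v)" for s and x :: 'a
  have T: "compact T" "convex T" unfolding T_def using C by (auto simp: compact_full_simplex)
  have Tb[measurable]: "T \<in> sets borel" using T by (simp add: borel_compact)
  have vT: "v \<in> T" unfolding T_def using v by (rule hull_inc)
  have \<psi>m[measurable]: "\<psi> \<in> borel_measurable borel" and gm: "g \<in> borel_measurable borel"
    using \<psi> by (auto intro!: borel_measurable_continuous_onI has_grad_continuous has_grad_continuous_grad)
  obtain M where M: "M \<ge> 0" "\<And>x y. x \<in> T \<Longrightarrow> y \<in> T \<Longrightarrow> \<bar>\<psi> x - \<psi> y\<bar> \<le> M * norm (x - y)"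
    using has_grad_lipschitz[OF \<psi> T] by blast
  define D where "D = diameter T"
  have D: "norm (x - y) \<le> D" if "x \<in> T" "y \<in> T" for x y
    using diameter_bounded_bound[OF compact_imp_bounded[OF T(1)] that] by (simp add: D_def dist_norm)
  have D0: "D \<ge> 0" using D[OF vT vT] by simp
  obtain P where P: "P > 0" "\<And>x. x \<in> T \<Longrightarrow> \<bar>\<psi> x\<bar> \<le> P"
    using compact_imp_bounded[OF compact_continuous_image[OF has_grad_continuous[OF \<psi>] T(1)]]
    by (auto simp: bounded_pos)
  have \<sigma>T: "\<sigma> s x \<in> T" if "x \<in> T" "0 \<le> s" "s \<le> 1" for s x
    using convexD_alt[OF T(2) vT that(1), of s] that by (simp add: \<sigma>_def algebra_simps)
  \<comment> \<open>Outside the copy of the simplex shrunk towards \<open>v\<close>, the coordinate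
    of \<open>y\<close> at \<open>v\<close> is below \<open>1 - s\<close>, so \<open>y\<close> has
    distance at most \<open>(1 - s) * D\<close> from the opposite facet, on which
    \<open>\<psi>\<close> vanishes.\<close>
  have shell: "\<bar>\<psi> y\<bar> \<le> M * D * (1 - s)" if y: "y \<in> T" "y \<notin> \<sigma> s ` T" and s: "0 < s" "s < 1" for y s
  proof -
    define x where "x = v + (1/s) *\<^sub>R (y - v)"
    have yx: "y = \<sigma> s x" using s by (simp add: \<sigma>_def x_def)
    then have "x \<notin> T" using y by blast
    then obtain w where w: "w \<in> C" "bary C w x < 0" unfolding T_def bary_mem[OF C] by force
    have bx: "bary C w x = (1 - 1/s) * bary C w v + (1/s) * bary C w y"
      unfolding x_def by (rule bary_combine[OF C w(1)])
    have by0: "0 \<le> bary C w y" using y(1) w(1) unfolding T_def bary_mem[OF C] by blast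
    \<comment> \<open>Stretching from \<open>v\<close> multiplies the coordinates at all other
      vertices by the positive number \<open>1 / s\<close>, so only the one at \<open>v\<close> can
      turn negative.\<close>
    have wv: "w = v"
    proof (rule ccontr)
      assume "w \<noteq> v"
      then have "bary C w x = (1/s) * bary C w y" using bx bary_vertex[OF C w(1) v] by simp
      then show False using w(2) by0 s by (simp add: divide_less_0_iff)
    qed
    define l where "l = bary C v y"
    have l: "l < 1 - s" "0 \<le> l"
    proof -
      have "s * ((1 - 1/s) + (1/s) * l) < 0"
        using w(2) bx s bary_vertex[OF C v v] unfolding wv l_def by (intro mult_pos_neg) auto
      then show "l < 1 - s" using s by (simp add: distrib_left right_diff_distrib)
      show "0 \<le> l" using by0 by (simp add: wv l_def)
    qed
    \<comment> \<open>The projection of \<open>y\<close> from \<open>v\<close> onto the opposite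
      facet.\<close>
    define z where "z = v + (1 / (1 - l)) *\<^sub>R (y - v)"
    have bz: "bary C u z = (1 - 1 / (1 - l)) * bary C u v + (1 / (1 - l)) * bary C u y" if "u \<in> C" for u
      unfolding z_def by (rule bary_combine[OF C that])
    have zv: "bary C v z = 0" using bz[OF v] bary_vertex[OF C v v] l s by (simp add: l_def field_simps)
    have zu: "bary C u z \<ge> 0" if "u \<in> C" "u \<noteq> v" for u
      using bz[OF that(1)] bary_vertex[OF C that(1) v] that y(1) l s unfolding T_def bary_mem[OF C] by simp
    have "0 \<le> bary C u z" if "u \<in> C" for u using zv zu[OF that] by (cases "u = v") auto
    then have zF: "z \<in> convex hull (C - {v})"
      unfolding bary_mem_face[OF C Diff_subset] using zv by auto
    have zT: "z \<in> T" using zF hull_mono[of "C - {v}" C] unfolding T_def by blast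
    have "y - z = l *\<^sub>R (v - z)"
    proof -
      have "v - z = - (1 / (1 - l)) *\<^sub>R (y - v)" by (simp add: z_def)
      moreover have "y - z = (1 - 1 / (1 - l)) *\<^sub>R (y - v)" by (simp add: z_def algebra_simps)
      moreover have "1 - 1 / (1 - l) = l * (- (1 / (1 - l)))" using l s by (simp add: field_simps)
      ultimately show ?thesis by (metis scaleR_scaleR)
    qed
    then have "norm (y - z) = l * norm (v - z)" using l by simp
    also have "\<dots> \<le> (1 - s) * D" using D[OF vT zT] l by (intro mult_mono) auto
    finally have nz: "norm (y - z) \<le> (1 - s) * D" .
    have "\<bar>\<psi> y\<bar> = \<bar>\<psi> y - \<psi> z\<bar>" using zero[OF zF] by simp
    also have "\<dots> \<le> M * norm (y - z)" by (rule M(2)[OF y(1) zT])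
    also have "\<dots> \<le> M * ((1 - s) * D)" using nz M(1) by (rule mult_left_mono)
    finally show ?thesis by (simp add: algebra_simps)
  qed
  \<comment> \<open>The offset \<open>2\<close> keeps every \<open>s n\<close> strictly between zero
    and one.\<close>
  define s where "s n = 1 - 1 / real (n + 2)" for n
  have s: "0 < s n" "s n < 1" for n by (auto simp: s_def field_simps)
  have s1: "s \<longlonglongrightarrow> 1" unfolding s_def by real_asymp
  \<comment> \<open>Difference quotient at \<open>s = 1\<close> of the scaled integrand, in which
    \<open>s ^ d\<close> is the Jacobian factor. Its pointwise limit is the divergence of
    \<open>\<psi> (x - v)\<close>.\<close>
  define q where "q n x = (\<psi> x - s n ^ d * \<psi> (\<sigma> (s n) x)) / (1 - s n)" for n x
  have cont\<sigma>: "continuous_on T (\<lambda>x. \<psi> (\<sigma> t x))" for t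
    by (rule continuous_on_compose2[OF has_grad_continuous[OF \<psi>, of UNIV]]) (auto simp: \<sigma>_def intro!: continuous_intros)
  have [measurable]: "(\<lambda>x. \<psi> (\<sigma> t x)) \<in> borel_measurable borel" for t unfolding \<sigma>_def by measurable
  have bound: "\<bar>q n x\<bar> \<le> M * D + real d * P" if x: "x \<in> T" for n x
  proof -
    have y: "\<sigma> (s n) x \<in> T" using \<sigma>T[OF x] s[of n] by (simp add: less_imp_le)
    have "x - \<sigma> (s n) x = (1 - s n) *\<^sub>R (x - v)" by (simp add: \<sigma>_def algebra_simps)
    then have "norm (x - \<sigma> (s n) x) \<le> (1 - s n) * D" using s[of n] D[OF x vT] by (simp add: mult_left_mono)
    then have 1: "\<bar>\<psi> x - \<psi> (\<sigma> (s n) x)\<bar> \<le> M * ((1 - s n) * D)"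
      using M(2)[OF x y] M(1) by (meson mult_left_mono order_trans)
    have pw: "1 - s n ^ d \<le> real d * (1 - s n)" "0 \<le> 1 - s n ^ d"
      using Bernoulli_inequality[of "s n - 1" d] s[of n] by (auto simp: algebra_simps power_le_one)
    have 2: "\<bar>(1 - s n ^ d) * \<psi> (\<sigma> (s n) x)\<bar> \<le> (real d * (1 - s n)) * P"
      unfolding abs_mult using pw P(2)[OF y] by (intro mult_mono) auto
    have "\<psi> x - s n ^ d * \<psi> (\<sigma> (s n) x) = (\<psi> x - \<psi> (\<sigma> (s n) x)) + (1 - s n ^ d) * \<psi> (\<sigma> (s n) x)"
      by (simp add: algebra_simps)
    then have "\<bar>\<psi> x - s n ^ d * \<psi> (\<sigma> (s n) x)\<bar> \<le> M * ((1 - s n) * D) + (real d * (1 - s n)) * P"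
      using 1 2 by linarith
    also have "\<dots> = (M * D + real d * P) * (1 - s n)" by (simp add: algebra_simps)
    finally show ?thesis using s[of n] by (simp add: q_def divide_le_eq)
  qed
  have lim: "(\<lambda>n. q n x) \<longlonglongrightarrow> real d * \<psi> x + g x \<bullet> (x - v)" for x
  proof -
    have \<sigma>1: "\<sigma> 1 x = x" by (simp add: \<sigma>_def)
    have "((\<lambda>t. \<sigma> t x) has_derivative (\<lambda>h. h *\<^sub>R (x - v))) (at 1)"
      unfolding \<sigma>_def by (auto intro!: derivative_eq_intros)
    moreover have "(\<psi> has_derivative (\<lambda>h. g x \<bullet> h)) (at (\<sigma> 1 x))" using \<psi> \<sigma>1 by (simp add: has_grad_def)
    ultimately have "((\<lambda>t. \<psi> (\<sigma> t x)) has_derivative (\<lambda>h. g x \<bullet> (h *\<^sub>R (x - v)))) (at 1)"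
      by (rule has_derivative_compose)
    then have d1: "((\<lambda>t. \<psi> (\<sigma> t x)) has_real_derivative g x \<bullet> (x - v)) (at 1)"
      unfolding has_field_derivative_def by (rule has_derivative_eq_rhs) (simp add: fun_eq_iff)
    have "((\<lambda>t. t ^ d * \<psi> (\<sigma> t x)) has_real_derivative real d * \<psi> x + g x \<bullet> (x - v)) (at 1)"
      by (rule derivative_eq_intros d1 refl)+ (simp add: \<sigma>1)
    then have "((\<lambda>t. (t ^ d * \<psi> (\<sigma> t x) - \<psi> x) / (t - 1)) \<longlongrightarrow> real d * \<psi> x + g x \<bullet> (x - v)) (at 1)"
      by (simp add: has_field_derivative_iff \<sigma>1)
    moreover have "filterlim s (at 1) sequentially"
      using s1 s by (auto simp: filterlim_at intro!: always_eventually) (metis less_irrefl)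
    ultimately have "(\<lambda>n. (s n ^ d * \<psi> (\<sigma> (s n) x) - \<psi> x) / (s n - 1)) \<longlonglongrightarrow> real d * \<psi> x + g x \<bullet> (x - v)"
      by (rule filterlim_compose)
    moreover have "(s n ^ d * \<psi> (\<sigma> (s n) x) - \<psi> x) / (s n - 1) = q n x" for n
      using minus_divide_divide[of "\<psi> x - s n ^ d * \<psi> (\<sigma> (s n) x)" "1 - s n"] by (simp add: q_def)
    ultimately show ?thesis by simp
  qed
  have "(\<lambda>n. \<integral>x. indicator T x * q n x \<partial>lborel) \<longlonglongrightarrow> (\<integral>x. indicator T x * (real d * \<psi> x + g x \<bullet> (x - v)) \<partial>lborel)"
  proof (rule integral_dominated_convergence[where w="\<lambda>x. indicator T x * (M * D + real d * P)"])
    show "integrable lborel (\<lambda>x. indicator T x * (M * D + real d * P))"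
      using set_integrable_compact[OF T(1), of "\<lambda>_. M * D + real d * P"] by (simp add: set_integrable_def)
    show "AE x in lborel. (\<lambda>n. indicator T x * q n x) \<longlonglongrightarrow> indicator T x * (real d * \<psi> x + g x \<bullet> (x - v))"
      by (intro AE_I2 tendsto_mult tendsto_const lim)
    show "AE x in lborel. norm (indicator T x * q n x) \<le> indicator T x * (M * D + real d * P)" for n
      using bound by (intro AE_I2) (auto simp: indicator_def)
    show "(\<lambda>x. indicator T x * q n x) \<in> borel_measurable lborel" for n
      unfolding q_def by measurable
    show "(\<lambda>x. indicator T x * (real d * \<psi> x + g x \<bullet> (x - v))) \<in> borel_measurable lborel"
      using gm by measurable
  qed
  \<comment> \<open>After the change of variables the integral of \<open>q n\<close> is that of
    \<open>\<psi>\<close> over the shell between the two simplices, divided by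
    \<open>1 - s n\<close>. There \<open>\<psi>\<close> is of order \<open>1 - s n\<close>, which
    cancels the denominator, and the volume of the shell tends to zero.\<close>
  moreover have "(\<lambda>n. \<integral>x. indicator T x * q n x \<partial>lborel) \<longlonglongrightarrow> 0"
  proof -
    define V where "V = measure lborel T"
    have "\<bar>\<integral>x. indicator T x * q n x \<partial>lborel\<bar> \<le> M * D * ((1 - s n ^ d) * V)" for n
    proof -
      let ?S = "\<sigma> (s n) ` T"
      have S: "compact ?S" "?S \<subseteq> T"
        using T(1) \<sigma>T s[of n] by (auto intro!: compact_continuous_image continuous_intros simp: \<sigma>_def[abs_def] less_imp_le)
      have Sb[measurable]: "?S \<in> sets borel" using S by (simp add: borel_compact)
      have i1: "integrable lborel (\<lambda>x. indicator T x * \<psi> x)" "integrable lborel (\<lambda>x. indicator ?S x * \<psi> x)"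
        "integrable lborel (\<lambda>x. indicator T x * (\<psi> (\<sigma> (s n) x)))"
        using set_integrable_compact[OF T(1) has_grad_continuous[OF \<psi>]] set_integrable_compact[OF S(1) has_grad_continuous[OF \<psi>]]
          set_integrable_compact[OF T(1) cont\<sigma>]
        by (simp_all add: set_integrable_def)
      have i2: "integrable lborel (\<lambda>x. indicator T x :: real)" "integrable lborel (\<lambda>x. indicator ?S x :: real)"
        using set_integrable_compact[OF T(1), of "\<lambda>_. 1"] set_integrable_compact[OF S(1), of "\<lambda>_. 1"]
        by (simp_all add: set_integrable_def)
      have "(\<integral>x. indicator T x * q n x \<partial>lborel) = (\<integral>x. (indicator T x * \<psi> x - s n ^ d * (indicator T x * \<psi> (\<sigma> (s n) x))) / (1 - s n) \<partial>lborel)"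
        by (intro Bochner_Integration.integral_cong) (auto simp: q_def indicator_def)
      also have "\<dots> = ((\<integral>x. indicator T x * \<psi> x \<partial>lborel) - s n ^ d * (\<integral>x. indicator T x * \<psi> (\<sigma> (s n) x) \<partial>lborel)) / (1 - s n)"
        using i1 by simp
      also have "s n ^ d * (\<integral>x. indicator T x * \<psi> (\<sigma> (s n) x) \<partial>lborel) = (\<integral>x. indicator ?S x * \<psi> x \<partial>lborel)"
        using set_integral_affine[OF s(1)[of n] \<psi>m Tb, of v]
        by (simp add: set_lebesgue_integral_def \<sigma>_def[abs_def] d_def)
      also have "(\<integral>x. indicator T x * \<psi> x \<partial>lborel) - (\<integral>x. indicator ?S x * \<psi> x \<partial>lborel) = (\<integral>x. indicator (T - ?S) x * \<psi> x \<partial>lborel)"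
      proof -
        have "(\<integral>x. indicator (T - ?S) x * \<psi> x \<partial>lborel) = (\<integral>x. indicator T x * \<psi> x - indicator ?S x * \<psi> x \<partial>lborel)"
          using S(2) by (intro Bochner_Integration.integral_cong) (auto simp: indicator_def)
        then show ?thesis using i1 by simp
      qed
      finally have eq: "(\<integral>x. indicator T x * q n x \<partial>lborel) = (\<integral>x. indicator (T - ?S) x * \<psi> x \<partial>lborel) / (1 - s n)" .
      have mS: "measure lborel ?S = s n ^ d * V"
        using set_integral_affine[OF s(1)[of n], of "\<lambda>_. 1" T v] T(1) S(1)
        by (simp add: set_lebesgue_integral_def \<sigma>_def[abs_def] d_def V_def)
      have "\<bar>\<integral>x. indicator (T - ?S) x * \<psi> x \<partial>lborel\<bar> \<le> (\<integral>x. norm (indicator (T - ?S) x * \<psi> x) \<partial>lborel)"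
        using integral_norm_bound[of lborel "\<lambda>x. indicator (T - ?S) x * \<psi> x"] by simp
      also have "\<dots> \<le> (\<integral>x. (M * D * (1 - s n)) * (indicator T x - indicator ?S x) \<partial>lborel)"
      proof (rule integral_mono_AE')
        show "integrable lborel (\<lambda>x. (M * D * (1 - s n)) * (indicator T x - indicator ?S x))" using i2 by simp
        show "AE x in lborel. norm (indicator (T - ?S) x * \<psi> x) \<le> (M * D * (1 - s n)) * (indicator T x - indicator ?S x)"
          using S(2) shell[OF _ _ s[of n]] by (intro AE_I2) (auto simp: indicator_def)
        show "AE x in lborel. 0 \<le> (M * D * (1 - s n)) * (indicator T x - indicator ?S x)"
          using S(2) M(1) D0 s(2)[of n]
          by (intro AE_I2 mult_nonneg_nonneg) (auto intro: indicator_leI simp: less_imp_le)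
      qed
      also have "\<dots> = (M * D * (1 - s n)) * (V - s n ^ d * V)"
        using i2 mS by (simp add: V_def)
      finally have "\<bar>\<integral>x. indicator (T - ?S) x * \<psi> x \<partial>lborel\<bar> \<le> (M * D * ((1 - s n ^ d) * V)) * (1 - s n)"
        by (simp add: algebra_simps)
      then show ?thesis unfolding eq using s[of n] by (simp add: divide_le_eq)
    qed
    then have le: "norm (\<integral>x. indicator T x * q n x \<partial>lborel) \<le> M * D * ((1 - s n ^ d) * V)" for n
      by simp
    have 0: "M * D * ((1 - 1 ^ d) * V) = 0" by simp
    have "(\<lambda>n. M * D * ((1 - s n ^ d) * V)) \<longlonglongrightarrow> M * D * ((1 - 1 ^ d) * V)"
      by (intro tendsto_intros s1)
    then have "(\<lambda>n. M * D * ((1 - s n ^ d) * V)) \<longlonglongrightarrow> 0" unfolding 0 .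
    then show ?thesis by (rule Lim_null_comparison[OF always_eventually[OF allI[OF le]]])
  qed
  ultimately have "(\<integral>x. indicator T x * (real d * \<psi> x + g x \<bullet> (x - v)) \<partial>lborel) = 0"
    by (rule LIMSEQ_unique)
  then show ?thesis by (simp add: set_lebesgue_integral_def T_def d_def)
qed

text \<open>The integrand is the divergence of \<open>\<phi> (x - v)\<close> when \<open>f\<close>
  is the gradient of \<open>\<phi>\<close>. The value is then the flux through the facet opposite
  \<open>v\<close>, that is, the height of the simplex over this facet times the integral of
  \<open>\<phi>\<close> over it.\<close>

definition cone_flux :: "'a::euclidean_space set \<Rightarrow> 'a \<Rightarrow> ('a \<Rightarrow> real) \<Rightarrow> ('a \<Rightarrow> 'a) \<Rightarrow> real" where
  "cone_flux C v \<phi> f = (LINT x:convex hull C|lborel. real DIM('a) * \<phi> x + f x \<bullet> (x - v))"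

lemma cone_flux_zero:
  assumes "full_simplex C" "v \<in> C" "has_grad \<phi> f" "\<And>x. x \<in> convex hull (C - {v}) \<Longrightarrow> \<phi> x = 0"
  shows "cone_flux C v \<phi> f = 0"
  unfolding cone_flux_def by (rule simplex_cone_divergence[OF assms])

lemma cone_integrable:
  fixes C :: "'a::euclidean_space set"
  assumes "full_simplex C" "has_grad \<phi> f"
  shows "set_integrable lborel (convex hull C) (\<lambda>x. real DIM('a) * \<phi> x + f x \<bullet> (x - v))"
  using assms
  by (intro set_integrable_compact compact_full_simplex continuous_intros)
    (auto intro: has_grad_continuous has_grad_continuous_grad)

lemma cone_flux_diff:
  assumes "full_simplex C" "has_grad \<phi> f" "has_grad \<psi> g"
  shows "cone_flux C v (\<lambda>x. \<phi> x - \<psi> x) (\<lambda>x. f x - g x) = cone_flux C v \<phi> f - cone_flux C v \<psi> g"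
proof -
  have "cone_flux C v (\<lambda>x. \<phi> x - \<psi> x) (\<lambda>x. f x - g x)
      = (LINT x:convex hull C|lborel. (real DIM('a) * \<phi> x + f x \<bullet> (x - v)) - (real DIM('a) * \<psi> x + g x \<bullet> (x - v)))"
    unfolding cone_flux_def by (simp add: inner_diff_left algebra_simps)
  also have "\<dots> = cone_flux C v \<phi> f - cone_flux C v \<psi> g"
    unfolding cone_flux_def using assms by (intro set_integral_diff cone_integrable)
  finally show ?thesis .
qed

text \<open>The affine map \<open>A\<close> that fixes the common facet and sends \<open>v\<close> to \<open>v'\<close> transports one flux to the other.\<close>

lemma cone_flux_facet:
  fixes C :: "'a::euclidean_space set"
  assumes C: "full_simplex C" "v \<in> C" and C': "full_simplex C'" "v' \<in> C'"
    and eq: "C - {v} = C' - {v'}" and \<phi>: "has_grad \<phi> f"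
  shows "cone_flux C v \<phi> f / measure lborel (convex hull C) = cone_flux C' v' \<phi> f / measure lborel (convex hull C')"
proof -
  let ?T = "convex hull C" and ?T' = "convex hull C'"
  have T: "compact ?T" "compact ?T'" using C C' by (auto simp: compact_full_simplex)
  have Tb[measurable]: "?T \<in> sets borel" "?T' \<in> sets borel" using T by (auto simp: borel_compact)
  obtain n c where nc: "\<And>y. bary C v y = y \<bullet> n + c" using bary_affine[OF C] by blast
  obtain n' c' where nc': "\<And>y. bary C' v' y = y \<bullet> n' + c'" using bary_affine[OF C'] by blast
  define e where "e = v' - v"
  define A where "A y = y + bary C v y *\<^sub>R e" for y
  define B where "B y = y - bary C' v' y *\<^sub>R e" for y
  have swap: "(\<Sum>w\<in>C. bary C w y *\<^sub>R w) + bary C v y *\<^sub>R e = (\<Sum>w\<in>C - {v}. bary C w y *\<^sub>R w) + bary C v y *\<^sub>R v'" for y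
    using C(2) full_simplex_finite[OF C(1)] by (simp add: sum.remove[of C v] e_def scaleR_diff_right)
  have sum1: "(\<Sum>w\<in>C - {v}. bary C w y) + bary C v y = 1" for y
    using C(2) full_simplex_finite[OF C(1)] bary_sum[OF C(1), of y] by (simp add: sum.remove[of C v])
  have bA: "bary C' w (A y) = (if w = v' then bary C v y else bary C w y)" if "w \<in> C'" for w y
  proof (rule bary_unique[OF C'(1) _ _ that])
    let ?u = "\<lambda>w. if w = v' then bary C v y else bary C w y"
    have "sum ?u C' = ?u v' + sum ?u (C' - {v'})"
      using C' full_simplex_finite[OF C'(1)] by (intro sum.remove) auto
    also have "sum ?u (C' - {v'}) = (\<Sum>w\<in>C - {v}. bary C w y)" unfolding eq by (intro sum.cong) auto
    finally show "sum ?u C' = 1" using sum1[of y] by simp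
    have "(\<Sum>w\<in>C'. ?u w *\<^sub>R w) = ?u v' *\<^sub>R v' + (\<Sum>w\<in>C' - {v'}. ?u w *\<^sub>R w)"
      using C' full_simplex_finite[OF C'(1)] by (intro sum.remove) auto
    also have "(\<Sum>w\<in>C' - {v'}. ?u w *\<^sub>R w) = (\<Sum>w\<in>C - {v}. bary C w y *\<^sub>R w)"
      unfolding eq by (intro sum.cong) auto
    finally show "(\<Sum>w\<in>C'. ?u w *\<^sub>R w) = A y"
      using swap[of y] by (simp add: A_def bary_repr[OF C(1)])
  qed
  have BA: "B (A y) = y" for y unfolding B_def using bA[OF C'(2), of y] by (simp add: A_def)
  have memA: "A y \<in> ?T' \<longleftrightarrow> y \<in> ?T" for y
  proof -
    have "A y \<in> ?T' \<longleftrightarrow> (\<forall>w\<in>C'. 0 \<le> (if w = v' then bary C v y else bary C w y))"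
      unfolding bary_mem[OF C'(1)] using bA by (intro ball_cong) auto
    also have "\<dots> \<longleftrightarrow> 0 \<le> bary C v y \<and> (\<forall>w\<in>C' - {v'}. 0 \<le> bary C w y)" using C'(2) by auto
    also have "\<dots> \<longleftrightarrow> (\<forall>w\<in>C. 0 \<le> bary C w y)" unfolding eq[symmetric] using C(2) by auto
    finally show ?thesis unfolding bary_mem[OF C(1)] .
  qed
  define L where "L y = y + (y \<bullet> n) *\<^sub>R e" for y
  define L' where "L' y = y - (y \<bullet> n') *\<^sub>R e" for y
  have AL: "A y = c *\<^sub>R e + L y" for y by (simp add: A_def L_def nc scaleR_add_left)
  have BL: "B y = L' y - c' *\<^sub>R e" for y by (simp add: B_def L'_def nc' scaleR_add_left)
  have lin: "linear L" "linear L'"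
    by (auto simp: L_def L'_def inner_add_left scaleR_add_left scaleR_diff_right scaleR_add_right intro!: linearI)
  have L'L: "L' (L y) = y" for y
  proof -
    have "y - 0 = B (A y) - B (A 0)" by (simp add: BA)
    also have "\<dots> = L' (A y) - L' (A 0)" by (simp add: BL)
    also have "\<dots> = L' (A y - A 0)" by (simp add: linear_diff[OF lin(2)])
    also have "A y - A 0 = L y" by (simp add: AL linear_0[OF lin(1)])
    finally show ?thesis by simp
  qed
  \<comment> \<open>Only one composition is computed; the other follows from finite
    dimension.\<close>
  have "bij L"
    using linear_injective_imp_surjective[OF lin(1)] L'L by (metis bij_def inj_on_inverseI)
  then have LL': "L (L' y) = y" for y using L'L by (metis bij_pointE)
  obtain k where k: "k > 0" "\<And>h. h \<in> borel_measurable borel \<Longrightarrow> (\<integral>x. h (c *\<^sub>R e + L x) \<partial>lborel) = k * (\<integral>x. h x \<partial>lborel :: real)"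
    using integral_affine_bij[OF lin, of "c *\<^sub>R e"] LL' L'L by blast
  have chg: "(LINT x:?T|lborel. h (A x)) = k * (LINT x:?T'|lborel. h x)"
    if [measurable]: "h \<in> borel_measurable borel" for h :: "'a \<Rightarrow> real"
  proof -
    have "(LINT x:?T|lborel. h (A x)) = (\<integral>x. indicator ?T' (c *\<^sub>R e + L x) *\<^sub>R h (c *\<^sub>R e + L x) \<partial>lborel)"
      unfolding set_lebesgue_integral_def using memA AL
      by (intro Bochner_Integration.integral_cong) (auto simp: indicator_def)
    also have "\<dots> = k * (\<integral>x. indicator ?T' x *\<^sub>R h x \<partial>lborel)" by (rule k(2)) measurable
    finally show ?thesis by (simp add: set_lebesgue_integral_def)
  qed
  \<comment> \<open>\<open>A\<close> fixes the common facet, so \<open>\<phi>\<close> and its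
    transport \<open>\<theta>\<close> agree there. Applied to their difference,
    \<open>cone_flux_zero\<close> shows that they have the same flux from \<open>v\<close>.\<close>
  define \<theta> where "\<theta> x = \<phi> (A x)" for x
  define g where "g x = f (A x) + (f (A x) \<bullet> e) *\<^sub>R n" for x
  have contA: "continuous_on UNIV A"
    unfolding A_def[abs_def] by (intro continuous_intros bary_continuous C)
  have \<theta>: "has_grad \<theta> g"
    unfolding has_grad_def
  proof (intro conjI allI)
    fix x
    have "(A has_derivative L) (at x)"
      unfolding AL[abs_def] using lin(1) linear_conv_bounded_linear bounded_linear_imp_has_derivative
      by (auto intro!: derivative_eq_intros bounded_linear_imp_has_derivative)
    moreover have "(\<phi> has_derivative (\<lambda>h. f (A x) \<bullet> h)) (at (A x))" using \<phi> by (simp add: has_grad_def)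
    ultimately have "(\<theta> has_derivative (\<lambda>h. f (A x) \<bullet> L h)) (at x)"
      unfolding \<theta>_def[abs_def] by (rule has_derivative_compose)
    moreover have "(\<lambda>h. f (A x) \<bullet> L h) = (\<bullet>) (g x)"
      by (auto simp: L_def g_def inner_add_left inner_add_right inner_commute)
    ultimately show "(\<theta> has_derivative (\<bullet>) (g x)) (at x)" by simp
    show "continuous_on UNIV g" unfolding g_def[abs_def]
      by (intro continuous_intros continuous_on_compose2[OF has_grad_continuous_grad[OF \<phi>, of UNIV] contA]) auto
  qed
  have "\<phi> x - \<theta> x = 0" if "x \<in> convex hull (C - {v})" for x
    using that bary_mem_face[OF C(1), of "C - {v}" x] C(2) by (simp add: \<theta>_def A_def)
  then have "cone_flux C v (\<lambda>x. \<phi> x - \<theta> x) (\<lambda>x. f x - g x) = 0"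
    by (intro cone_flux_zero C has_grad_diff \<phi> \<theta>)
  then have "cone_flux C v \<phi> f = cone_flux C v \<theta> g" using cone_flux_diff[OF C(1) \<phi> \<theta>, of v] by simp
  also have "\<dots> = (LINT x:?T|lborel. real DIM('a) * \<phi> (A x) + f (A x) \<bullet> (A x - v'))"
  proof -
    have "A v = v'" using bary_vertex[OF C(1) C(2) C(2)] by (simp add: A_def e_def)
    then have "A x - v' = L (x - v)" for x using AL[of x] AL[of v] by (simp add: linear_diff[OF lin(1)] algebra_simps)
    then have "g x \<bullet> (x - v) = f (A x) \<bullet> (A x - v')" for x
      by (simp add: L_def g_def inner_add_left inner_add_right inner_commute)
    then show ?thesis by (simp add: cone_flux_def \<theta>_def)
  qed
  also have "\<dots> = k * cone_flux C' v' \<phi> f"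
    unfolding cone_flux_def
  proof (rule chg)
    have "continuous_on UNIV (\<lambda>x. real DIM('a) * \<phi> x + f x \<bullet> (x - v'))"
      using \<phi> by (intro continuous_intros) (auto intro: has_grad_continuous has_grad_continuous_grad)
    then show "(\<lambda>x. real DIM('a) * \<phi> x + f x \<bullet> (x - v')) \<in> borel_measurable borel"
      by (rule borel_measurable_continuous_onI)
  qed
  finally have 1: "cone_flux C v \<phi> f = k * cone_flux C' v' \<phi> f" .
  \<comment> \<open>The Jacobian factor \<open>k\<close> is also the ratio of the volumes, so it
    cancels in the quotients.\<close>
  have "measure lborel ?T = k * measure lborel ?T'"
    using chg[of "\<lambda>_. 1"] by (simp add: set_lebesgue_integral_def)
  then show ?thesis using 1 k(1) by simp
qed

lemma simplex_measure_pos: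
  assumes "full_simplex C"
  shows "measure lborel (convex hull C) > 0"
proof -
  have "\<not> negligible (convex hull C)"
    using full_simplex_interior_nonempty[OF assms] by (simp add: negligible_convex_interior)
  then have "measure lebesgue (convex hull C) > 0"
    using compact_full_simplex[OF assms] measure_eq_0_null_sets
    by (simp add: negligible_iff_measure zero_less_measure_iff lmeasurable_compact)
  then show ?thesis using compact_full_simplex[OF assms] by (simp add: borel_compact)
qed

section \<open>Meshes\<close>

text \<open>Finitely many proper affine subspaces are negligible, so every nonempty open set
  contains points in general position.\<close>

lemma open_not_subset_lowdim:
  fixes U :: "'a::euclidean_space set"
  assumes "open U" "U \<noteq> {}" "finite \<A>" "\<And>A. A \<in> \<A> \<Longrightarrow> aff_dim A < int DIM('a)"
  shows "\<not> U \<subseteq> (\<Union>A\<in>\<A>. affine hull A)"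
proof
  assume sub: "U \<subseteq> (\<Union>A\<in>\<A>. affine hull A)"
  have "negligible (affine hull A)" if "A \<in> \<A>" for A
  proof -
    have "interior (affine hull A) = {}"
      using aff_dim_nonempty_interior[of "affine hull A"] assms(4)[OF that] by auto
    then show ?thesis by (simp add: negligible_convex_interior)
  qed
  then have "negligible (\<Union>A\<in>\<A>. affine hull A)" using assms(3) by (intro negligible_Union) auto
  then show False using sub assms(1,2) negligible_subset open_not_negligible by blast
qed

section \<open>Regularity of Lipschitz domains and outward normals\<close>

lemma closure_meets_open: "x \<in> closure S \<Longrightarrow> open U \<Longrightarrow> x \<in> U \<Longrightarrow> \<exists>z\<in>S. z \<in> U"
  using open_Int_closure_eq_empty[of U S] by blast

text \<open>A mesh determines only the closure of \<open>\<Omega>\<close>, so slits and punctures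
  have to be excluded. Near a frontier point \<open>\<Omega>\<close> lies strictly above a graph;
  points strictly below the graph are outside the closure, and they occur arbitrarily close
  by.\<close>

lemma lipschitz_boundary_regular:
  fixes \<Omega> :: "'a::euclidean_space set"
  assumes "open \<Omega>" "lipschitz_boundary \<Omega>"
  shows "interior (closure \<Omega>) = \<Omega>"
proof
  show "\<Omega> \<subseteq> interior (closure \<Omega>)" using assms(1) by (simp add: closure_subset interior_maximal)
  show "interior (closure \<Omega>) \<subseteq> \<Omega>"
  proof
    fix x assume x: "x \<in> interior (closure \<Omega>)"
    show "x \<in> \<Omega>"
    proof (rule ccontr)
      assume nx: "x \<notin> \<Omega>"
      have "x \<in> closure \<Omega>" using x interior_subset by blast
      then have "x \<in> frontier \<Omega>" using nx assms(1) by (simp add: frontier_def interior_open)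
      from bspec[OF assms(2)[unfolded lipschitz_boundary_def] this] obtain U e \<gamma> L
        where U': "open U \<and> x \<in> U \<and> norm e = 1 \<and> L-lipschitz_on {z. z \<bullet> e = 0} \<gamma> \<and>
          \<Omega> \<inter> U = {y \<in> U. \<gamma> (y - (y \<bullet> e) *\<^sub>R e) < y \<bullet> e}" by (elim exE)
      then have U: "open U" "x \<in> U" "norm e = 1" "L-lipschitz_on {z. z \<bullet> e = 0} \<gamma>"
        "\<Omega> \<inter> U = {y \<in> U. \<gamma> (y - (y \<bullet> e) *\<^sub>R e) < y \<bullet> e}" by simp_all
      have ee: "e \<bullet> e = 1" using U(3) by (simp add: norm_eq_1)
      define P where "P y = y - (y \<bullet> e) *\<^sub>R e" for y
      have P0: "P y \<in> {z. z \<bullet> e = 0}" for y by (simp add: P_def inner_diff_left ee)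
      have "continuous_on UNIV (\<lambda>y. \<gamma> (P y))"
        by (rule continuous_on_compose2[OF lipschitz_on_continuous_on[OF U(4)]])
          (use P0 in \<open>auto simp: P_def[abs_def] intro!: continuous_intros\<close>)
      then have opn: "open {y. y \<bullet> e < \<gamma> (P y)}"
        by (intro open_Collect_less continuous_intros)
      have xP: "x \<bullet> e \<le> \<gamma> (P x)" using nx U(2,5) unfolding P_def by force
      have "open (U \<inter> interior (closure \<Omega>))" using U(1) by auto
      then obtain r where r: "r > 0" "ball x r \<subseteq> U \<inter> interior (closure \<Omega>)"
        using x U(2) by (meson IntI open_contains_ball_eq)
      \<comment> \<open>Moving against \<open>e\<close> keeps the foot point \<open>P x\<close> and
        lowers the height, so \<open>z\<close> is strictly below the graph.\<close>
      define z where "z = x - (r/2) *\<^sub>R e"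
      have zb: "z \<in> ball x r" using r(1) U(3) by (simp add: z_def dist_norm)
      have "P z = P x" by (simp add: P_def z_def inner_diff_left ee algebra_simps)
      moreover have "z \<bullet> e < x \<bullet> e" using r(1) by (simp add: z_def inner_diff_left ee)
      ultimately have z1: "z \<in> {y. y \<bullet> e < \<gamma> (P y)} \<inter> U" using xP zb r(2) by auto
      have "z \<in> closure \<Omega>" using zb r(2) interior_subset by blast
      moreover have "open ({y. y \<bullet> e < \<gamma> (P y)} \<inter> U)" using opn U(1) by auto
      ultimately obtain y where "y \<in> \<Omega>" "y \<in> {y. y \<bullet> e < \<gamma> (P y)} \<inter> U"
        using z1 closure_meets_open[of z \<Omega>] by blast
      then show False using U(5) unfolding P_def by force
    qed
  qed
qed

lemma outward_normal_closure:
  assumes "outward_unit_normal \<Omega> x n"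
  obtains \<epsilon> where "\<epsilon> > 0" "\<And>y. y \<in> closure \<Omega> \<Longrightarrow> y \<in> ball x \<epsilon> \<Longrightarrow> (y - x) \<bullet> n \<le> 0"
proof -
  obtain \<epsilon> where e: "\<epsilon> > 0" "\<Omega> \<inter> ball x \<epsilon> = {y \<in> ball x \<epsilon>. (y - x) \<bullet> n < 0}"
    using assms by (auto simp: outward_unit_normal_def)
  show ?thesis
  proof (rule that[OF e(1)], rule ccontr)
    fix y assume y: "y \<in> closure \<Omega>" "y \<in> ball x \<epsilon>" "\<not> (y - x) \<bullet> n \<le> 0"
    have "open (ball x \<epsilon> \<inter> {y. 0 < (y - x) \<bullet> n})"
      by (intro open_Int open_ball open_Collect_less continuous_intros)
    moreover have "y \<in> ball x \<epsilon> \<inter> {y. 0 < (y - x) \<bullet> n}" using y by simp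
    ultimately obtain z where "z \<in> \<Omega>" "z \<in> ball x \<epsilon> \<inter> {y. 0 < (y - x) \<bullet> n}"
      using closure_meets_open[OF y(1)] by blast
    then show False using e(2) by force
  qed
qed

text \<open>From a relative interior point of \<open>F\<close> one can move a little towards
  \<open>w\<close> and a little away from it without leaving \<open>F\<close>. Neither direction
  points outwards, so the inner product is both nonpositive and nonnegative.\<close>

lemma outward_normal_orthogonal:
  assumes n: "outward_unit_normal \<Omega> x n" and F: "convex F" "F \<subseteq> closure \<Omega>" "x \<in> rel_interior F" "w \<in> F"
  shows "(x - w) \<bullet> n = 0"
proof -
  obtain \<epsilon> where e: "\<epsilon> > 0" "\<And>y. y \<in> closure \<Omega> \<Longrightarrow> y \<in> ball x \<epsilon> \<Longrightarrow> (y - x) \<bullet> n \<le> 0"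
    using outward_normal_closure[OF n] by blast
  obtain r where r: "r > 0" "ball x r \<inter> affine hull F \<subseteq> F" using F(3) by (auto simp: mem_rel_interior_ball)
  have xF: "x \<in> F" using F(3) rel_interior_subset by blast
  \<comment> \<open>Small enough for both balls; the added \<open>1\<close> covers the case
    \<open>w = x\<close>.\<close>
  define t where "t = min \<epsilon> r / (2 * (norm (w - x) + 1))"
  have t: "t > 0" using e(1) r(1) by (simp add: t_def add_nonneg_pos)
  have small: "norm (s *\<^sub>R (w - x)) < min \<epsilon> r" if "\<bar>s\<bar> = t" for s
  proof -
    have "norm (s *\<^sub>R (w - x)) = t * norm (w - x)" using that by simp
    also have "\<dots> < t * (2 * (norm (w - x) + 1))" using t by (intro mult_strict_left_mono) (auto simp: add_pos_nonneg intro: le_less_trans[of _ "norm (w - x) + 1"])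
    also have "\<dots> = min \<epsilon> r"
    proof -
      have "2 * (norm (w - x) + 1) \<noteq> 0" by (metis add_nonneg_eq_0_iff mult_eq_0_iff norm_ge_zero zero_le_one zero_neq_numeral zero_neq_one)
      then show ?thesis by (simp add: t_def)
    qed
    finally show ?thesis .
  qed
  have key: "s * ((w - x) \<bullet> n) \<le> 0" if s: "\<bar>s\<bar> = t" for s
  proof -
    have "x + s *\<^sub>R (w - x) \<in> affine hull F"
      using mem_affine[OF affine_affine_hull, of x F w "1 - s" s] hull_inc[of x F] hull_inc[OF F(4)] xF
      by (simp add: algebra_simps)
    moreover have "dist x (x + s *\<^sub>R (w - x)) < min \<epsilon> r" using small[OF s] by (simp add: dist_norm)
    ultimately have "x + s *\<^sub>R (w - x) \<in> closure \<Omega>" "x + s *\<^sub>R (w - x) \<in> ball x \<epsilon>" using r(2) F(2) by auto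
    from e(2)[OF this] show ?thesis by simp
  qed
  have "t * ((w - x) \<bullet> n) \<le> 0" "(- t) * ((w - x) \<bullet> n) \<le> 0" using key[of t] key[of "- t"] t by auto
  then have "t * ((w - x) \<bullet> n) = 0" by linarith
  then have "(w - x) \<bullet> n = 0" using t by simp
  then show ?thesis by (simp add: inner_diff_left)
qed

locale mesh =
  fixes \<Omega> :: "'a::euclidean_space set" and \<tau>
  assumes mesh: "simplicial_mesh \<Omega> \<tau>" and opn: "open \<Omega>" and reg: "interior (closure \<Omega>) = \<Omega>"
begin

section \<open>How simplices of the mesh meet\<close>

lemma finite_mesh: "finite \<tau>" using mesh by (simp add: simplicial_mesh_def triangulation_def)

lemma Union_mesh: "\<Union>\<tau> = closure \<Omega>" using mesh by (simp add: simplicial_mesh_def)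

lemma mesh_vertices:
  assumes "T \<in> \<tau>"
  obtains C where "full_simplex C" "T = convex hull C"
proof -
  have "int DIM('a) simplex T" using mesh assms by (simp add: simplicial_mesh_def)
  then obtain C where "\<not> affine_dependent C" "int (card C) = int DIM('a) + 1" "T = convex hull C"
    unfolding simplex_def by blast
  then show ?thesis using that[of C] unfolding full_simplex_def by linarith
qed

text \<open>The intersection is a face of each simplex, at first spanned by two unrelated vertex
  sets. They agree because both consist of the extreme points of the same polytope. Since
  \<open>C\<close> and \<open>C'\<close> have equal cardinality, equality in one inclusion would
  make the simplices equal.\<close>

lemma mesh_inter:
  assumes C: "full_simplex C" "convex hull C \<in> \<tau>" and C': "full_simplex C'" "convex hull C' \<in> \<tau>"
    and ne: "convex hull C \<noteq> convex hull C'"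
  shows "\<exists>S. S \<subset> C \<and> S \<subset> C' \<and> convex hull C \<inter> convex hull C' = convex hull S"
proof -
  have f: "(convex hull C \<inter> convex hull C') face_of convex hull C" "(convex hull C' \<inter> convex hull C) face_of convex hull C'"
    using mesh C C' by (auto simp: simplicial_mesh_def triangulation_def)
  have ind: "\<not> affine_dependent C" "\<not> affine_dependent C'" using C C' by (auto simp: full_simplex_def)
  obtain S where S: "S \<subseteq> C" "convex hull C \<inter> convex hull C' = convex hull S"
    using f(1) face_of_convex_hull_affine_independent[OF ind(1)] by auto
  obtain S' where S': "S' \<subseteq> C'" "convex hull C' \<inter> convex hull C = convex hull S'"
    using f(2) face_of_convex_hull_affine_independent[OF ind(2)] by auto
  have indS: "\<not> affine_dependent S" "\<not> affine_dependent S'"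
    using S(1) S'(1) ind affine_independent_subset by blast+
  have "x \<in> S \<longleftrightarrow> x \<in> S'" for x
    using extreme_point_of_convex_hull_affine_independent[OF indS(1), of x]
      extreme_point_of_convex_hull_affine_independent[OF indS(2), of x] S(2) S'(2)
    by (simp add: Int_commute)
  then have eq: "S = S'" by blast
  have fin: "finite C" "finite C'" using C C' full_simplex_finite by auto
  have card: "card C = card C'" using C C' by (simp add: full_simplex_def)
  have "S \<noteq> C" "S \<noteq> C'"
    using eq S(1) S'(1) fin card ne by (metis card_subset_eq)+
  then show ?thesis using S S'(1) eq by blast
qed

lemma mesh_interior_disjoint:
  assumes "T \<in> \<tau>" "T' \<in> \<tau>" "T \<noteq> T'" "y \<in> interior T"
  shows "y \<notin> T'"
proof
  assume "y \<in> T'"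
  obtain C where C: "full_simplex C" "T = convex hull C" using mesh_vertices assms by blast
  obtain C' where C': "full_simplex C'" "T' = convex hull C'" using mesh_vertices assms by blast
  obtain S where S: "S \<subset> C" "S \<subset> C'" "convex hull C \<inter> convex hull C' = convex hull S"
    using mesh_inter[of C C'] C C' assms by blast
  have "y \<in> convex hull S" using S(3) C(2) C'(2) \<open>y \<in> T'\<close> assms(4) interior_subset by blast
  then show False using S(1) bary_mem_face[OF C(1), of S y] bary_interior[OF C(1), of y] assms(4) C(2) by force
qed

lemma mesh_interior_subset: "T \<in> \<tau> \<Longrightarrow> interior T \<subseteq> \<Omega>"
  using interior_mono[of T "closure \<Omega>"] Union_mesh reg by blast

text \<open>A relative interior point of a facet has positive coordinates at all vertices of the
  facet, so a common face containing the point contains all of them. The count of vertices then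
  shows that it is a facet of the second simplex as well.\<close>

lemma mesh_shared_facet:
  assumes C: "full_simplex C" "convex hull C \<in> \<tau>" and v: "v \<in> C"
    and x: "x \<in> rel_interior (convex hull (C - {v}))"
    and T': "T' \<in> \<tau>" "T' \<noteq> convex hull C" "x \<in> T'"
  shows "\<exists>C' v'. full_simplex C' \<and> T' = convex hull C' \<and> v' \<in> C' \<and> C - {v} = C' - {v'}"
proof -
  obtain C' where C': "full_simplex C'" "T' = convex hull C'" using mesh_vertices T' by blast
  obtain S where S: "S \<subset> C" "S \<subset> C'" "convex hull C \<inter> convex hull C' = convex hull S"
    using mesh_inter[OF C C'(1)] C'(2) T' by auto
  have "x \<in> convex hull C" using x rel_interior_subset[of "convex hull (C - {v})"] hull_mono[of "C - {v}" C] by blast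
  then have "x \<in> convex hull S" using S(3) T' C' by blast
  then have "bary C w x = 0" if "w \<in> C - S" for w
    using bary_mem_face[OF C(1), of S x] S(1) that by blast
  moreover have "0 < bary C w x" if "w \<in> C - {v}" for w
    using x bary_rel_interior[OF C(1), of "C - {v}" x] that by blast
  ultimately have "C - {v} \<subseteq> S" by force
  then have SC: "S = C - {v}" using S(1) v by blast
  have "card S \<ge> DIM('a)" unfolding SC using C(1) v full_simplex_finite[OF C(1)] by (simp add: full_simplex_def)
  then obtain v' where "v' \<in> C'" "S = C' - {v'}" using full_simplex_remove[OF C'(1) S(2)] by blast
  then show ?thesis using C' SC by blast
qed

text \<open>Two simplices with a common facet lie on opposite sides of it, since otherwise their
  interiors would overlap. Together they fill a neighbourhood of \<open>x\<close>, which lies in the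
  closure of \<open>\<Omega>\<close> and hence, by \<open>reg\<close>, in
  \<open>\<Omega>\<close>.\<close>

lemma mesh_facet_interior:
  assumes C: "full_simplex C" "convex hull C \<in> \<tau>" and C': "full_simplex C'" "convex hull C' \<in> \<tau>"
    and v: "v \<in> C" "v' \<in> C'" and eq: "C - {v} = C' - {v'}" and ne: "convex hull C \<noteq> convex hull C'"
    and x: "x \<in> rel_interior (convex hull (C - {v}))"
  shows "x \<in> \<Omega>"
proof -
  \<comment> \<open>Both coordinates are affine and vanish on the shared facet, so they are
    proportional; the value at \<open>v\<close> gives the factor.\<close>
  define \<kappa> where "\<kappa> = bary C' v' v"
  have k: "bary C' v' y = \<kappa> * bary C v y" for y
  proof -
    obtain n c where nc: "\<And>y. bary C' v' y = y \<bullet> n + c" using bary_affine[OF C'(1) v(2)] by blast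
    have "bary C' v' y = (\<Sum>w\<in>C. bary C w y *\<^sub>R w) \<bullet> n + c * (\<Sum>w\<in>C. bary C w y)"
      using nc by (simp add: bary_repr[OF C(1)] bary_sum[OF C(1)])
    also have "\<dots> = (\<Sum>w\<in>C. bary C w y * (w \<bullet> n + c))"
      by (simp add: inner_sum_left sum_distrib_left sum.distrib distrib_left mult.commute)
    also have "\<dots> = (\<Sum>w\<in>C. bary C w y * bary C' v' w)" using nc by simp
    also have "\<dots> = (\<Sum>w\<in>{v}. bary C w y * bary C' v' w)"
    proof (rule sum.mono_neutral_right)
      show "\<forall>w\<in>C - {v}. bary C w y * bary C' v' w = 0"
      proof
        fix w assume "w \<in> C - {v}"
        then have "w \<in> C'" "v' \<noteq> w" using eq by blast+
        then show "bary C w y * bary C' v' w = 0" using bary_vertex[OF C'(1) v(2), of w] by simp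
      qed
    qed (use v full_simplex_finite[OF C(1)] in auto)
    finally show ?thesis by (simp add: \<kappa>_def)
  qed
  \<comment> \<open>On \<open>U\<close> the coordinates at the vertices of the shared facet are
    positive for both simplices, so the sign of the remaining coordinate alone decides
    membership.\<close>
  define U where "U = (\<Inter>w\<in>C - {v}. {y. 0 < bary C w y}) \<inter> (\<Inter>w\<in>C - {v}. {y. 0 < bary C' w y})"
  have "open U" unfolding U_def
    using full_simplex_finite[OF C(1)] eq
    by (intro open_Int open_INT open_Collect_less ballI continuous_on_const bary_continuous C C') blast+
  have xb: "\<forall>w\<in>C - {v}. 0 < bary C w x" "bary C v x = 0" "\<forall>w\<in>C - {v}. 0 < bary C' w x"
    using x bary_rel_interior[OF C(1), of "C - {v}" x] bary_rel_interior[OF C'(1), of "C - {v}" x] v eq by blast+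
  have xU: "x \<in> U" using xb by (simp add: U_def)
  have "\<kappa> < 0"
  proof (rule ccontr)
    assume "\<not> \<kappa> < 0"
    moreover have "\<kappa> \<noteq> 0" using k[of v'] bary_vertex[OF C'(1) v(2) v(2)] by auto
    ultimately have kp: "\<kappa> > 0" by simp
    obtain r where r: "r > 0" "ball x r \<subseteq> U" using \<open>open U\<close> xU by (meson open_contains_ball_eq)
    \<comment> \<open>A short step from \<open>x\<close> towards \<open>v\<close>; if
      \<open>\<kappa>\<close> were positive it would lead into the interior of one simplex and also
      into the other.\<close>
    define t where "t = min (1/2) (r / (2 * (norm (v - x) + 1)))"
    have n1: "norm (v - x) + 1 > 0" by (simp add: add_nonneg_pos)
    have t: "0 < t" "t < 1" using r(1) n1 by (auto simp: t_def)
    have "t * norm (v - x) \<le> (r / (2 * (norm (v - x) + 1))) * norm (v - x)" by (intro mult_right_mono) (auto simp: t_def)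
    also have "\<dots> < r" using r(1) n1 by (simp add: field_simps) (smt (verit) norm_ge_zero mult_nonneg_nonneg)
    finally have "x + t *\<^sub>R (v - x) \<in> ball x r" using t by (simp add: dist_norm)
    then have yU: "x + t *\<^sub>R (v - x) \<in> U" using r by blast
    have vy: "bary C v (x + t *\<^sub>R (v - x)) = t" using bary_combine[OF C(1) v(1)] xb bary_vertex[OF C(1) v(1) v(1)] by simp
    have "x + t *\<^sub>R (v - x) \<in> interior (convex hull C)"
      using yU vy t unfolding bary_interior[OF C(1)] U_def by auto
    moreover have "x + t *\<^sub>R (v - x) \<in> convex hull C'"
      unfolding bary_mem[OF C'(1)]
    proof
      fix w assume "w \<in> C'"
      then consider "w = v'" | "w \<in> C - {v}" using eq by blast
      then show "0 \<le> bary C' w (x + t *\<^sub>R (v - x))"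
        using k vy t kp yU by cases (auto simp: U_def less_imp_le)
    qed
    ultimately show False using mesh_interior_disjoint[OF C(2) C'(2) ne] by blast
  qed
  have "U \<subseteq> closure \<Omega>"
  proof
    fix y assume y: "y \<in> U"
    have "y \<in> convex hull C \<or> y \<in> convex hull C'"
    proof (cases "bary C v y \<ge> 0")
      case True
      have "0 \<le> bary C w y" if "w \<in> C" for w
        using that y True by (cases "w = v") (auto simp: U_def less_imp_le)
      then show ?thesis unfolding bary_mem[OF C(1)] by blast
    next
      case False
      then have "0 \<le> bary C' v' y" using k[of y] \<open>\<kappa> < 0\<close> by (simp add: mult_nonpos_nonpos)
      moreover have "0 \<le> bary C' w y" if "w \<in> C'" "w \<noteq> v'" for w
        using that y eq unfolding U_def by (auto simp: less_imp_le)
      ultimately show ?thesis unfolding bary_mem[OF C'(1)] by metis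
    qed
    then show "y \<in> closure \<Omega>" using C C' Union_mesh by blast
  qed
  then show ?thesis using interior_maximal[OF _ \<open>open U\<close>] xU reg by blast
qed

text \<open>Formulated by incidence alone: no other simplex touches the relative interior. That such
  a facet lies on the frontier is derived from this.\<close>

definition boundary_facet :: "'a set \<Rightarrow> 'a \<Rightarrow> bool" where
  "boundary_facet C v \<longleftrightarrow> full_simplex C \<and> convex hull C \<in> \<tau> \<and> v \<in> C \<and>
     (\<forall>y\<in>rel_interior (convex hull (C - {v})). \<forall>T'\<in>\<tau>. y \<in> T' \<longrightarrow> T' = convex hull C)"

text \<open>Near \<open>y\<close> the closure of \<open>\<Omega>\<close> is contained in one
  simplex, because the union of the others is closed and misses \<open>y\<close>. A frontier point
  there cannot be interior to that simplex, which leaves only the facet opposite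
  \<open>v\<close>.\<close>

lemma boundary_facet_local:
  assumes F: "boundary_facet C v" and y: "y \<in> rel_interior (convex hull (C - {v}))"
  shows "y \<in> frontier \<Omega>" "\<exists>\<epsilon>>0. frontier \<Omega> \<inter> ball y \<epsilon> \<subseteq> convex hull (C - {v})"
proof -
  have C: "full_simplex C" "convex hull C \<in> \<tau>" "v \<in> C" using F by (auto simp: boundary_facet_def)
  define W where "W = \<Union>(\<tau> - {convex hull C})"
  have "closed T" if "T \<in> \<tau>" for T
    using mesh_vertices[OF that] compact_full_simplex compact_imp_closed by metis
  then have "closed W" unfolding W_def using finite_mesh by (intro closed_Union) auto
  have yW: "y \<notin> W" using F y by (auto simp: W_def boundary_facet_def)
  define U where "U = (\<Inter>w\<in>C - {v}. {y. 0 < bary C w y}) - W"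
  have "open U" unfolding U_def using full_simplex_finite[OF C(1)] \<open>closed W\<close>
    by (intro open_Diff open_INT open_Collect_less ballI continuous_on_const bary_continuous C) auto
  have yb: "\<forall>w\<in>C - {v}. 0 < bary C w y" "bary C v y = 0"
    using y bary_rel_interior[OF C(1), of "C - {v}" y] C(3) by auto
  then have "y \<in> U" using yW by (simp add: U_def)
  then obtain r where r: "r > 0" "ball y r \<subseteq> U" using \<open>open U\<close> by (meson open_contains_ball_eq)
  have inT: "z \<in> convex hull C" if "z \<in> closure \<Omega>" "z \<in> U" for z
    using that Union_mesh by (auto simp: U_def W_def)
  have "frontier \<Omega> \<inter> ball y r \<subseteq> convex hull (C - {v})"
  proof
    fix z assume z: "z \<in> frontier \<Omega> \<inter> ball y r"
    then have zT: "z \<in> convex hull C" "z \<in> U" using inT r by (auto simp: frontier_def)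
    have "bary C v z = 0"
    proof (rule ccontr)
      assume "bary C v z \<noteq> 0"
      then have "0 < bary C v z" using zT(1) C(3) bary_mem[OF C(1)] by force
      then have "z \<in> interior (convex hull C)" using zT(2) unfolding bary_interior[OF C(1)] U_def by auto
      then have "z \<in> \<Omega>" using mesh_interior_subset[OF C(2)] by blast
      then show False using z opn by (simp add: frontier_def interior_open)
    qed
    then show "z \<in> convex hull (C - {v})" using zT bary_mem[OF C(1), of z] bary_mem_face[OF C(1), of "C - {v}" z] by auto
  qed
  then show "\<exists>\<epsilon>>0. frontier \<Omega> \<inter> ball y \<epsilon> \<subseteq> convex hull (C - {v})" using r(1) by blast
  have "y \<notin> \<Omega>"
  proof
    assume "y \<in> \<Omega>"
    then have "y \<in> \<Omega> \<inter> U" using \<open>y \<in> U\<close> by blast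
    then obtain q where q: "q > 0" "ball y q \<subseteq> \<Omega> \<inter> U" using opn \<open>open U\<close> by (meson open_Int open_contains_ball_eq)
    \<comment> \<open>A small step from \<open>y\<close> away from \<open>v\<close> makes the
      coordinate at \<open>v\<close> equal to \<open>- t\<close>, so it leaves the only simplex
      available.\<close>
    define t where "t = q / (2 * (norm (v - y) + 1))"
    have n1: "norm (v - y) + 1 > 0" by (simp add: add_nonneg_pos)
    have t: "0 < t" using q(1) n1 by (auto simp: t_def)
    have "t * norm (v - y) < q" using q(1) n1 unfolding t_def by (simp add: field_simps) (smt (verit) norm_ge_zero mult_nonneg_nonneg)
    then have "y + (-t) *\<^sub>R (v - y) \<in> ball y q" using t by (simp add: dist_norm)
    then have "y + (-t) *\<^sub>R (v - y) \<in> convex hull C" using q inT closure_subset by blast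
    then have "0 \<le> bary C v (y + (-t) *\<^sub>R (v - y))" using bary_mem[OF C(1)] C(3) by blast
    then show False unfolding bary_combine[OF C(1) C(3)] using yb bary_vertex[OF C(1) C(3) C(3)] t by simp
  qed
  moreover have "y \<in> closure \<Omega>"
    using y rel_interior_subset[of "convex hull (C - {v})"] hull_mono[of "C - {v}" C] C(2) Union_mesh by blast
  ultimately show "y \<in> frontier \<Omega>" using opn by (simp add: frontier_def interior_open)
qed

lemma boundary_facet_frontier:
  assumes F: "boundary_facet C v"
  shows "convex hull (C - {v}) \<subseteq> frontier \<Omega>"
proof -
  have "convex hull (C - {v}) \<subseteq> closure (rel_interior (convex hull (C - {v})))"
    using convex_closure_rel_interior[of "convex hull (C - {v})"] closure_subset by auto
  also have "\<dots> \<subseteq> frontier \<Omega>"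
    by (intro closure_minimal frontier_closed subsetI boundary_facet_local[OF F])
  finally show ?thesis .
qed

text \<open>Near \<open>x\<close> the frontier is contained in the facet, so a flat piece
  \<open>G\<close> of the same dimension through \<open>x\<close> spans the same hyperplane, and the
  two overlap in a relatively open set. This is what \<open>boundary_partition\<close> forbids for
  pieces of different type.\<close>

lemma boundary_facet_overlap:
  assumes F: "boundary_facet C v" and x: "x \<in> rel_interior (convex hull (C - {v}))"
    and G: "polytope G" "aff_dim G = int DIM('a) - 1" "G \<subseteq> frontier \<Omega>" "x \<in> G"
  shows "(top_of_set (frontier \<Omega>)) interior_of (convex hull (C - {v}) \<inter> G) \<noteq> {}"
proof -
  let ?F = "convex hull (C - {v})"
  have C: "full_simplex C" "v \<in> C" using F by (auto simp: boundary_facet_def)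
  obtain \<epsilon> where e: "\<epsilon> > 0" "frontier \<Omega> \<inter> ball x \<epsilon> \<subseteq> ?F" using boundary_facet_local(2)[OF F x] by blast
  have cG: "convex G" using G(1) polytope_imp_convex by blast
  have "x \<in> closure (rel_interior G)" using G(4) convex_closure_rel_interior[OF cG] closure_subset by auto
  \<comment> \<open>\<open>x\<close> may lie on the relative boundary of \<open>G\<close>; a nearby
    relative interior point is still in the ball where the frontier is contained in the
    facet.\<close>
  then obtain y where y: "y \<in> rel_interior G" "y \<in> ball x \<epsilon>"
    using e(1) closure_meets_open[of x "rel_interior G" "ball x \<epsilon>"] by auto
  have yG: "y \<in> G" using y(1) rel_interior_subset by blast
  have aff: "affine hull (G \<inter> ball x \<epsilon>) = affine hull G"
    using affine_hull_convex_Int_open[OF cG open_ball] yG y(2) by blast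
  have "G \<inter> ball x \<epsilon> \<subseteq> ?F" using G(3) e(2) by blast
  then have "affine hull G \<subseteq> affine hull ?F" using aff hull_mono[of "G \<inter> ball x \<epsilon>" ?F affine] by simp
  then have "affine hull G = affine hull ?F"
    using G(2) aff_dim_facet[OF C, unfolded aff_dim_convex_hull] yG
    by (intro affine_dim_equal) (auto simp: affine_affine_hull aff_dim_affine_hull aff_dim_convex_hull)
  obtain r where r: "r > 0" "ball y r \<inter> affine hull G \<subseteq> G" using y(1) by (auto simp: mem_rel_interior_ball)
  define U where "U = ball y r \<inter> ball x \<epsilon>"
  have "frontier \<Omega> \<inter> U \<subseteq> ?F \<inter> G"
    using e(2) r(2) \<open>affine hull G = affine hull ?F\<close> hull_subset[of ?F affine] by (auto simp: U_def)
  moreover have "openin (top_of_set (frontier \<Omega>)) (frontier \<Omega> \<inter> U)" by (auto simp: U_def openin_open_Int)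
  moreover have "y \<in> frontier \<Omega> \<inter> U" using yG G(3) y(2) r(1) by (auto simp: U_def)
  ultimately show ?thesis unfolding interior_of_def by blast
qed

text \<open>The vertex sets of the faces of codimension at least two.\<close>

definition low_faces :: "'a set set" where
  "low_faces = {S. \<exists>C. full_simplex C \<and> convex hull C \<in> \<tau> \<and> S \<subseteq> C \<and> card S < DIM('a)}"

lemma finite_low_faces: "finite low_faces"
proof -
  have "inj_on (\<lambda>C. convex hull C) {C::'a set. full_simplex C}"
  proof (rule inj_onI)
    fix C C' :: "'a set" assume "C \<in> {C. full_simplex C}" "C' \<in> {C. full_simplex C}" "convex hull C = convex hull C'"
    then show "C = C'"
      using extreme_point_of_convex_hull_affine_independent[of C] extreme_point_of_convex_hull_affine_independent[of C']
      by (auto simp: full_simplex_def)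
  qed
  then have inj: "inj_on (\<lambda>C. convex hull C) {C. full_simplex C \<and> convex hull C \<in> \<tau>}"
    by (rule inj_on_subset) blast
  have "finite ((\<lambda>C. convex hull C) ` {C. full_simplex C \<and> convex hull C \<in> \<tau>})"
    by (rule finite_subset[OF _ finite_mesh]) blast
  then have "finite {C. full_simplex C \<and> convex hull C \<in> \<tau>}" using inj by (rule finite_imageD)
  then have "finite (\<Union>C\<in>{C. full_simplex C \<and> convex hull C \<in> \<tau>}. Pow C)"
    by (rule finite_UN_I) (simp add: full_simplex_finite)
  then show ?thesis by (rule rev_finite_subset) (unfold low_faces_def, blast)
qed

text \<open>A low face has fewer than d vertices, so together with \<open>p\<close> it still spans a
  proper affine subspace. For \<open>z\<close> outside all of these, the line through
  \<open>p\<close> and \<open>z\<close> meets a low face at most in \<open>p\<close> itself.\<close>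

lemma low_faces_cone:
  fixes U :: "'a set"
  assumes "open U" "U \<noteq> {}"
  shows "\<exists>z\<in>U. \<forall>S\<in>low_faces. z \<notin> affine hull (insert p S)"
proof -
  have dim: "aff_dim A < int DIM('a)" if A: "A \<in> insert p ` low_faces" for A
  proof -
    from A obtain S where S: "A = insert p S" "S \<in> low_faces" by (rule imageE)
    from S(2)[unfolded low_faces_def mem_Collect_eq]
    obtain C where C: "full_simplex C \<and> convex hull C \<in> \<tau> \<and> S \<subseteq> C \<and> card S < DIM('a)" by (rule exE)
    then have fS: "finite S" using full_simplex_finite finite_subset by blast
    then have "finite (insert p S)" by simp
    from aff_dim_le_card[OF this] have "aff_dim A \<le> int (card (insert p S)) - 1" unfolding S(1) .
    moreover have "card (insert p S) \<le> Suc (card S)" by (simp add: fS card_insert_if)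
    ultimately show ?thesis using C by linarith
  qed
  have "finite (insert p ` low_faces)" using finite_low_faces by simp
  from open_not_subset_lowdim[OF assms this dim]
  have "\<not> U \<subseteq> (\<Union>A\<in>insert p ` low_faces. affine hull A)" .
  then obtain z where "z \<in> U" "z \<notin> (\<Union>A\<in>insert p ` low_faces. affine hull A)" by (meson subsetI)
  then show ?thesis by blast
qed

text \<open>\<open>G\<close> need not be a union of mesh facets, so a point of \<open>G\<close> off
  all low faces is required. The cone over \<open>G\<close> with an apex \<open>p\<close> off its
  hyperplane has interior points; a generic one, projected from \<open>p\<close> back to
  \<open>G\<close>, avoids the low faces. Being outside \<open>\<Omega>\<close>, the projection can
  only lie in the relative interior of a facet that no second simplex shares.\<close>

lemma frontier_polytope_facet:
  assumes G: "polytope G" "aff_dim G = int DIM('a) - 1" "G \<subseteq> frontier \<Omega>"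
  obtains C v x where "boundary_facet C v" "x \<in> rel_interior (convex hull (C - {v}))" "x \<in> G"
proof -
  have cG: "convex G" using G(1) polytope_imp_convex by blast
  have "affine hull G \<noteq> UNIV"
  proof
    assume "affine hull G = UNIV"
    then have "aff_dim G = int DIM('a)" by (rule aff_dim_eq_full[THEN iffD2])
    then show False using G(2) by simp
  qed
  then obtain p where p: "p \<notin> affine hull G" by blast
  have dimK: "aff_dim (convex hull (insert p G)) = int DIM('a)"
    using p G(2) by (simp add: aff_dim_convex_hull aff_dim_insert)
  have ne: "G \<noteq> {}"
  proof
    assume "G = {}"
    then have "int DIM('a) - 1 = -1" using G(2) aff_dim_empty[of G] by simp
    then show False using DIM_positive[where 'a = 'a] by linarith
  qed
  have intne: "interior (convex hull (insert p G)) \<noteq> {}"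
    using dimK interior_rel_interior_gen[of "convex hull (insert p G)"] by (simp add: rel_interior_eq_empty)
  obtain z where z: "z \<in> interior (convex hull (insert p G))" "\<And>S. S \<in> low_faces \<Longrightarrow> z \<notin> affine hull (insert p S)"
    using low_faces_cone[OF open_interior intne, of p] by blast
  have "z \<in> convex hull (insert p G)" using z(1) interior_subset by blast
  then obtain a b x where x: "x \<in> G" "0 \<le> a" "0 \<le> b" "a + b = 1" "z = a *\<^sub>R p + b *\<^sub>R x"
    using convex_hull_insert[OF ne, of p] cG by (auto simp: hull_same)
  have xlow: "x \<notin> convex hull S" if "S \<in> low_faces" for S
  proof
    assume "x \<in> convex hull S"
    then have "x \<in> affine hull (insert p S)"
      using convex_hull_subset_affine_hull[of S] hull_mono[of S "insert p S" affine] by blast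
    then have "z \<in> affine hull (insert p S)" unfolding x(5)
      by (intro mem_affine[OF affine_affine_hull] x(4)) (auto simp: hull_inc)
    then show False using z(2)[OF that] by blast
  qed
  have xfr: "x \<in> frontier \<Omega>" using x(1) G(3) by blast
  then have xcl: "x \<in> closure \<Omega>" and xn: "x \<notin> \<Omega>" using opn by (auto simp: frontier_def interior_open)
  obtain T where T: "T \<in> \<tau>" "x \<in> T" using xcl Union_mesh by blast
  obtain C where C: "full_simplex C" "T = convex hull C" using mesh_vertices[OF T(1)] by blast
  \<comment> \<open>The vertices of the smallest face containing \<open>x\<close>.\<close>
  define S where "S = {w\<in>C. 0 < bary C w x}"
  have S0: "S \<subseteq> C" "\<forall>w\<in>S. 0 < bary C w x" unfolding S_def by blast+
  have "bary C w x = 0" if "w \<in> C - S" for w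
  proof -
    have "0 \<le> bary C w x" using T(2) bary_mem[OF C(1), of x] that unfolding C(2) by blast
    moreover have "\<not> 0 < bary C w x" using that unfolding S_def by blast
    ultimately show ?thesis by simp
  qed
  then have xS: "x \<in> rel_interior (convex hull S)"
    unfolding bary_rel_interior[OF C(1) S0(1)] using S0(2) by blast
  have "x \<notin> interior T" using xn mesh_interior_subset[OF T(1)] by blast
  then have "S \<noteq> C" using bary_interior[OF C(1), of x] C(2) by (auto simp: S_def)
  then have SC: "S \<subset> C" using S0(1) by blast
  have "card S \<ge> DIM('a)"
  proof (rule ccontr)
    assume "\<not> card S \<ge> DIM('a)"
    then have "S \<in> low_faces" using C T(1) SC unfolding low_faces_def mem_Collect_eq not_le by blast
    then show False using xlow xS rel_interior_subset by blast
  qed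
  then obtain v where v: "v \<in> C" "S = C - {v}" using full_simplex_remove[OF C(1) SC] by blast
  have xF: "x \<in> rel_interior (convex hull (C - {v}))" using xS v by simp
  \<comment> \<open>A second simplex at any relative interior point would share the whole facet, and
    then \<open>x\<close> would belong to \<open>\<Omega>\<close>.\<close>
  have only: "T' = T" if T': "T' \<in> \<tau>" "y \<in> T'" and y: "y \<in> rel_interior (convex hull (C - {v}))" for T' y
  proof (rule ccontr)
    assume "T' \<noteq> T"
    then obtain C' v' where C': "full_simplex C'" "T' = convex hull C'" "v' \<in> C'" "C - {v} = C' - {v'}"
      using mesh_shared_facet[OF C(1) _ v(1) y T'(1) _ T'(2)] C(2) T(1) by blast
    have "x \<in> \<Omega>"
      using mesh_facet_interior[OF C(1) _ C'(1) _ v(1) C'(3,4) _ xF] C(2) C'(2) T(1) T'(1) \<open>T' \<noteq> T\<close> by auto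
    then show False using xn by blast
  qed
  have "boundary_facet C v" unfolding boundary_facet_def using C T(1) v(1) only by auto
  then show ?thesis using that xF x(1) by blast
qed

text \<open>Otherwise the simplices with \<open>P\<close> and those without form two closed unions
  that cover \<open>\<Omega>\<close> and meet only in low faces. If they met inside
  \<open>\<Omega>\<close>, generic points on either side in a small ball could be joined by a
  segment that avoids all low faces, against the connectedness of the segment. So they are disjoint
  in \<open>\<Omega>\<close>, against the connectedness of \<open>\<Omega>\<close>.\<close>

lemma mesh_connected:
  assumes con: "connected \<Omega>" and T0: "T0 \<in> \<tau>" "P T0"
    and adj: "\<And>C v C' v'. full_simplex C \<Longrightarrow> convex hull C \<in> \<tau> \<Longrightarrow> v \<in> C \<Longrightarrow> full_simplex C' \<Longrightarrow>
      convex hull C' \<in> \<tau> \<Longrightarrow> v' \<in> C' \<Longrightarrow> C - {v} = C' - {v'} \<Longrightarrow> convex hull C \<noteq> convex hull C' \<Longrightarrow>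
      P (convex hull C) \<Longrightarrow> P (convex hull C')"
    and T: "T \<in> \<tau>"
  shows "P T"
proof (rule ccontr)
  assume nT: "\<not> P T"
  define A where "A = \<Union>{T\<in>\<tau>. P T}"
  define B where "B = \<Union>{T\<in>\<tau>. \<not> P T}"
  have cl: "closed T" "interior T \<noteq> {}" "closure (interior T) = T" if "T \<in> \<tau>" for T
    using mesh_vertices[OF that] compact_full_simplex compact_imp_closed full_simplex_interior_nonempty
      full_simplex_closure_interior by metis+
  have AB: "closed A" "closed B" unfolding A_def B_def using finite_mesh cl by (auto intro!: closed_Union)
  have cov: "closure \<Omega> = A \<union> B" using Union_mesh by (auto simp: A_def B_def)
  \<comment> \<open>Simplices of different type cannot share a facet, by \<open>adj\<close>, so
    their intersection is spanned by fewer than d vertices.\<close>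
  have low: "\<exists>S\<in>low_faces. p \<in> convex hull S" if "p \<in> A" "p \<in> B" for p
  proof -
    obtain T1 T2 where T12: "T1 \<in> \<tau>" "P T1" "p \<in> T1" "T2 \<in> \<tau>" "\<not> P T2" "p \<in> T2"
      using \<open>p \<in> A\<close> \<open>p \<in> B\<close> by (auto simp: A_def B_def)
    obtain C where C: "full_simplex C" "T1 = convex hull C" using mesh_vertices[OF T12(1)] by blast
    obtain C' where C': "full_simplex C'" "T2 = convex hull C'" using mesh_vertices[OF T12(4)] by blast
    have ne: "convex hull C \<noteq> convex hull C'" using T12 C C' by auto
    obtain S where S: "S \<subset> C" "S \<subset> C'" "convex hull C \<inter> convex hull C' = convex hull S"
      using mesh_inter[OF C(1) _ C'(1) _ ne] T12 C C' by auto
    have "card S < DIM('a)"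
    proof (rule ccontr)
      assume "\<not> card S < DIM('a)"
      then obtain v v' where "v \<in> C" "S = C - {v}" "v' \<in> C'" "S = C' - {v'}"
        using full_simplex_remove[OF C(1) S(1)] full_simplex_remove[OF C'(1) S(2)] by (meson not_le)
      then have "P (convex hull C')" using adj[OF C(1) _ _ C'(1), of v v'] T12 C C' ne by auto
      then show False using T12 C' by blast
    qed
    then have "S \<in> low_faces" using S(1) C T12(1) unfolding low_faces_def mem_Collect_eq by blast
    then show ?thesis using S(3) T12 C C' by blast
  qed
  have disj: "\<Omega> \<inter> A \<inter> B = {}"
  proof (rule ccontr)
    assume "\<Omega> \<inter> A \<inter> B \<noteq> {}"
    then obtain x T1 T2 where x: "x \<in> \<Omega>" "T1 \<in> \<tau>" "P T1" "x \<in> T1" "T2 \<in> \<tau>" "\<not> P T2" "x \<in> T2"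
      by (auto simp: A_def B_def)
    obtain r where r: "r > 0" "ball x r \<subseteq> \<Omega>" using opn x(1) by (meson open_contains_ball_eq)
    have near: "interior T' \<inter> ball x r \<noteq> {}" if "T' \<in> \<tau>" "x \<in> T'" for T'
      using cl(3)[OF that(1)] that(2) r(1) closure_meets_open[of x "interior T'" "ball x r"] by auto
    obtain y where y: "y \<in> interior T2" "y \<in> ball x r" using near[OF x(5,7)] by blast
    obtain z where z: "z \<in> interior T1 \<inter> ball x r" "\<And>S. S \<in> low_faces \<Longrightarrow> z \<notin> affine hull (insert y S)"
      using low_faces_cone[OF open_Int[OF open_interior open_ball] near[OF x(2,4)], of y] by blast
    have ylow: "y \<notin> convex hull S" if "S \<in> low_faces" for S
    proof
      assume yS: "y \<in> convex hull S"
      obtain C where C: "full_simplex C" "convex hull C \<in> \<tau>" "S \<subseteq> C" "card S < DIM('a)"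
        using \<open>S \<in> low_faces\<close> unfolding low_faces_def mem_Collect_eq by blast
      have "y \<in> convex hull C" using yS hull_mono[OF C(3)] by blast
      then have eq: "convex hull C = T2" using mesh_interior_disjoint[OF x(5) C(2) _ y(1)] by auto
      have "S \<noteq> C" using C by (auto simp: full_simplex_def)
      then obtain w where "w \<in> C - S" using C(3) by blast
      then have "bary C w y = 0" using yS bary_mem_face[OF C(1,3)] by blast
      then show False using bary_interior[OF C(1), of y] eq y(1) \<open>w \<in> C - S\<close> by force
    qed
    have "closed_segment z y \<inter> A \<inter> B = {}"
    proof (rule ccontr)
      assume "closed_segment z y \<inter> A \<inter> B \<noteq> {}"
      then obtain p where p: "p \<in> closed_segment z y" "p \<in> A" "p \<in> B" by blast
      obtain S where S: "S \<in> low_faces" "p \<in> convex hull S" using low[OF p(2,3)] by blast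
      obtain u where u: "p = (1 - u) *\<^sub>R z + u *\<^sub>R y" "0 \<le> u" "u \<le> 1" using p(1) by (auto simp: in_segment)
      have "u \<noteq> 1" using u(1) S ylow by auto
      \<comment> \<open>Solved for \<open>z\<close>, the segment equation makes \<open>z\<close> an
        affine combination of \<open>p\<close> and \<open>y\<close>, so a low face through
        \<open>p\<close> would put \<open>z\<close> into an excluded hull. The endpoint
        \<open>u = 1\<close> cannot occur because \<open>y\<close> itself is on no low face.\<close>
      have zz: "z = (1 / (1 - u)) *\<^sub>R p + (- u / (1 - u)) *\<^sub>R y"
      proof -
        have "(1 / (1 - u)) *\<^sub>R p = z + (u / (1 - u)) *\<^sub>R y" using \<open>u \<noteq> 1\<close> by (simp add: u(1) scaleR_add_right)
        then show ?thesis by simp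
      qed
      have "p \<in> affine hull (insert y S)"
        using S(2) convex_hull_subset_affine_hull[of S] hull_mono[of S "insert y S" affine] by blast
      then have "(1 / (1 - u)) *\<^sub>R p + (- u / (1 - u)) *\<^sub>R y \<in> affine hull (insert y S)"
        using \<open>u \<noteq> 1\<close> by (intro mem_affine[OF affine_affine_hull]) (auto simp: hull_inc field_simps)
      then show False using z(2)[OF S(1)] zz by simp
    qed
    moreover have "closed_segment z y \<subseteq> A \<union> B"
      using closed_segment_subset[of z "ball x r" y] z(1) y(2) r(2) cov closure_subset by blast
    moreover have "z \<in> A" "y \<in> B" using z(1) y(1) x interior_subset by (auto simp: A_def B_def)
    ultimately show False
      using connected_closedD[OF connected_segment[of z y], of A B] AB ends_in_segment[of z y] by blast
  qed
  have "\<Omega> \<subseteq> A \<union> B" using cov closure_subset by blast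
  moreover have "A \<inter> \<Omega> \<noteq> {}" "B \<inter> \<Omega> \<noteq> {}"
    using cl(2)[OF T0(1)] cl(2)[OF T] mesh_interior_subset[OF T0(1)] mesh_interior_subset[OF T] T0 T nT interior_subset
    unfolding A_def B_def by blast+
  ultimately show False using connected_closedD[OF con, of A B] AB disj by blast
qed

end

section \<open>Weak divergence\<close>

lemma has_derivative_grad:
  assumes "\<phi> differentiable (at x)"
  shows "(\<phi> has_derivative (\<lambda>h. grad \<phi> x \<bullet> h)) (at x)"
proof -
  let ?D = "frechet_derivative \<phi> (at x)"
  have D: "(\<phi> has_derivative ?D) (at x)" using assms frechet_derivative_works by blast
  then have lin: "linear ?D" by (rule has_derivative_linear)
  have "?D h = grad \<phi> x \<bullet> h" for h
  proof -
    have "?D h = ?D (\<Sum>b\<in>Basis. (h \<bullet> b) *\<^sub>R b)" by (simp add: euclidean_representation)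
    also have "\<dots> = grad \<phi> x \<bullet> h" unfolding grad_def inner_sum_left
      by (simp add: linear_sum[OF lin] linear_cmul[OF lin] inner_commute mult.commute)
    finally show ?thesis .
  qed
  then have "?D = (\<lambda>h. grad \<phi> x \<bullet> h)" by (rule ext)
  then show ?thesis using D by simp
qed

lemma smooth_has_grad:
  assumes "smooth_fun \<phi>"
  shows "has_grad \<phi> (grad \<phi>)"
  unfolding has_grad_def
proof (intro conjI allI)
  have it: "iterated_partial bs \<phi> differentiable (at x)" if "set bs \<subseteq> Basis" for bs x
    using assms that unfolding smooth_fun_def by blast
  show "(\<phi> has_derivative (\<bullet>) (grad \<phi> x)) (at x)" for x
    using has_derivative_grad[of \<phi> x] it[of "[]" x] by simp
  have "continuous_on UNIV (\<lambda>x. frechet_derivative \<phi> (at x) b)" if "b \<in> Basis" for b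
    using it[of "[b]"] that
    by (intro continuous_at_imp_continuous_on ballI differentiable_imp_continuous_within) simp
  then show "continuous_on UNIV (grad \<phi>)"
    unfolding grad_def[abs_def] by (intro continuous_on_sum continuous_on_scaleR continuous_on_const)
qed

locale bounded_domain =
  fixes \<Omega> :: "'a::euclidean_space set"
  assumes dom_open: "open \<Omega>" and dom_bounded: "bounded \<Omega>"
begin

lemma dom_sets: "\<Omega> \<in> sets lebesgue" using dom_open by simp

lemma dom_sets': "\<Omega> \<inter> space lebesgue \<in> sets lebesgue" using dom_open by simp

lemma dom_finite: "finite_measure (lebesgue_on \<Omega>)"
  using dom_open dom_bounded by (intro finite_measure_lebesgue_on lmeasurable_open)

lemma const_integrable: "integrable (lebesgue_on \<Omega>) (\<lambda>x. c :: real)"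
  using dom_finite finite_measure.integrable_const by blast

lemma continuous_measurable:
  fixes f :: "'a \<Rightarrow> 'b::euclidean_space"
  shows "continuous_on UNIV f \<Longrightarrow> f \<in> borel_measurable (lebesgue_on \<Omega>)"
  by (intro measurable_restrict_space1 measurable_completion) (simp add: borel_measurable_continuous_onI)

section \<open>Square integrable functions on a bounded domain\<close>

lemma L2_measurable: "f \<in> L2 \<Omega> \<Longrightarrow> f \<in> borel_measurable (lebesgue_on \<Omega>)"
  by (simp add: L2_def)

lemma L2_square: "f \<in> L2 \<Omega> \<Longrightarrow> integrable (lebesgue_on \<Omega>) (\<lambda>x. (norm (f x))\<^sup>2)"
  by (simp add: L2_def)

lemma L2_integrable_norm:
  assumes "f \<in> L2 \<Omega>"
  shows "integrable (lebesgue_on \<Omega>) (\<lambda>x. norm (f x))"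
proof (rule Bochner_Integration.integrable_bound)
  show "integrable (lebesgue_on \<Omega>) (\<lambda>x. 1 + (norm (f x))\<^sup>2)"
    using L2_square[OF assms] const_integrable[of 1] by (intro Bochner_Integration.integrable_add)
  show "(\<lambda>x. norm (f x)) \<in> borel_measurable (lebesgue_on \<Omega>)" using L2_measurable[OF assms] by measurable
  show "AE x in lebesgue_on \<Omega>. norm (norm (f x)) \<le> norm (1 + (norm (f x))\<^sup>2)"
  proof (intro AE_I2)
    fix x
    have "2 * norm (f x) \<le> 1 + (norm (f x))\<^sup>2" using sum_squares_bound[of 1 "norm (f x)"] by simp
    then have "norm (f x) \<le> 1 + (norm (f x))\<^sup>2" using norm_ge_zero[of "f x"] by linarith
    then show "norm (norm (f x)) \<le> norm (1 + (norm (f x))\<^sup>2)" by simp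
  qed
qed

lemma L2_integrable: "f \<in> L2 \<Omega> \<Longrightarrow> integrable (lebesgue_on \<Omega>) f"
  using L2_integrable_norm L2_measurable integrable_norm_cancel by blast

lemma L2_inner_integrable:
  assumes "f \<in> L2 \<Omega>" "g \<in> L2 \<Omega>"
  shows "integrable (lebesgue_on \<Omega>) (\<lambda>x. f x \<bullet> g x)"
proof (rule Bochner_Integration.integrable_bound)
  show "integrable (lebesgue_on \<Omega>) (\<lambda>x. (norm (f x))\<^sup>2 + (norm (g x))\<^sup>2)"
    using assms by (intro Bochner_Integration.integrable_add L2_square)
  show "(\<lambda>x. f x \<bullet> g x) \<in> borel_measurable (lebesgue_on \<Omega>)"
    using assms by (intro borel_measurable_inner L2_measurable)
  show "AE x in lebesgue_on \<Omega>. norm (f x \<bullet> g x) \<le> norm ((norm (f x))\<^sup>2 + (norm (g x))\<^sup>2)"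
  proof (intro AE_I2)
    fix x
    have "\<bar>f x \<bullet> g x\<bar> \<le> norm (f x) * norm (g x)" by (rule Cauchy_Schwarz_ineq2)
    also have "\<dots> \<le> 2 * norm (f x) * norm (g x)" by simp
    also have "\<dots> \<le> (norm (f x))\<^sup>2 + (norm (g x))\<^sup>2" by (rule sum_squares_bound)
    finally show "norm (f x \<bullet> g x) \<le> norm ((norm (f x))\<^sup>2 + (norm (g x))\<^sup>2)" by simp
  qed
qed

lemma L2_mult_integrable:
  fixes f g :: "'a \<Rightarrow> real"
  shows "f \<in> L2 \<Omega> \<Longrightarrow> g \<in> L2 \<Omega> \<Longrightarrow> integrable (lebesgue_on \<Omega>) (\<lambda>x. f x * g x)"
  using L2_inner_integrable[of f g] by simp

lemma L2_comb:
  assumes "f \<in> L2 \<Omega>" "g \<in> L2 \<Omega>"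
  shows "(\<lambda>x. a *\<^sub>R f x + b *\<^sub>R g x) \<in> L2 \<Omega>"
proof -
  have m: "(\<lambda>x. a *\<^sub>R f x + b *\<^sub>R g x) \<in> borel_measurable (lebesgue_on \<Omega>)"
    using L2_measurable[OF assms(1)] L2_measurable[OF assms(2)] by measurable
  have eq: "(norm (a *\<^sub>R f x + b *\<^sub>R g x))\<^sup>2 = a\<^sup>2 * (norm (f x))\<^sup>2 + 2 * a * b * (f x \<bullet> g x) + b\<^sup>2 * (norm (g x))\<^sup>2" for x
    unfolding power2_norm_eq_inner inner_add_left inner_add_right inner_scaleR_left inner_scaleR_right
    by (simp only: inner_commute[of "g x" "f x"] power2_eq_square) (simp only: algebra_simps mult_2)
  have "integrable (lebesgue_on \<Omega>) (\<lambda>x. (norm (a *\<^sub>R f x + b *\<^sub>R g x))\<^sup>2)"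
    unfolding eq using assms
    by (intro Bochner_Integration.integrable_add integrable_mult_right L2_square L2_inner_integrable)
  then show ?thesis using m by (simp add: L2_def)
qed

lemma L2_bounded:
  assumes "f \<in> borel_measurable (lebesgue_on \<Omega>)" "\<And>x. x \<in> \<Omega> \<Longrightarrow> norm (f x) \<le> B"
  shows "f \<in> L2 \<Omega>"
proof -
  have "integrable (lebesgue_on \<Omega>) (\<lambda>x. (norm (f x))\<^sup>2)"
  proof (rule Bochner_Integration.integrable_bound[OF const_integrable[of "B\<^sup>2"]])
    show "(\<lambda>x. (norm (f x))\<^sup>2) \<in> borel_measurable (lebesgue_on \<Omega>)" using assms(1) by measurable
    show "AE x in lebesgue_on \<Omega>. norm ((norm (f x))\<^sup>2) \<le> norm (B\<^sup>2)"
      using assms(2) by (intro AE_I2) (auto simp: abs_le_square_iff intro!: power_mono)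
  qed
  then show ?thesis using assms(1) by (simp add: L2_def)
qed

lemma L2_AE_cong:
  assumes "f \<in> L2 \<Omega>" "AE x in lebesgue_on \<Omega>. f x = g x" "g \<in> borel_measurable (lebesgue_on \<Omega>)"
  shows "g \<in> L2 \<Omega>"
proof -
  have "AE x in lebesgue_on \<Omega>. (norm (f x))\<^sup>2 = (norm (g x))\<^sup>2" using assms(2) by eventually_elim simp
  moreover have "(\<lambda>x. (norm (g x))\<^sup>2) \<in> borel_measurable (lebesgue_on \<Omega>)" using assms(3) by measurable
  ultimately have "integrable (lebesgue_on \<Omega>) (\<lambda>x. (norm (g x))\<^sup>2)"
    by (intro integrable_cong_AE_imp[OF L2_square[OF assms(1)]])
  then show ?thesis using assms(3) by (simp add: L2_def)
qed

text \<open>\<open>DG\<close> prescribes its elements only almost everywhere, so their measurability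
  has to come from the completeness of Lebesgue measure.\<close>

lemma measurable_AE:
  fixes f g :: "'a \<Rightarrow> 'b::euclidean_space"
  assumes f: "f \<in> borel_measurable (lebesgue_on \<Omega>)" and ae: "AE x in lebesgue_on \<Omega>. f x = g x"
  shows "g \<in> borel_measurable (lebesgue_on \<Omega>)"
proof -
  have "(\<lambda>x. if x \<in> \<Omega> then f x else 0) \<in> borel_measurable lebesgue"
    using f dom_sets by (intro borel_measurable_if_I)
  moreover have "AE x in lebesgue. (if x \<in> \<Omega> then f x else 0) = (if x \<in> \<Omega> then g x else 0)"
    using ae unfolding AE_restrict_space_iff[OF dom_sets'] by eventually_elim simp
  ultimately have "(\<lambda>x. if x \<in> \<Omega> then g x else 0) \<in> borel_measurable lebesgue" by (rule borel_measurable_AE)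
  then show ?thesis by (rule borel_measurable_if_D)
qed

lemma test_has_grad: "\<phi> \<in> test_functions \<Omega> \<Longrightarrow> has_grad \<phi> (grad \<phi>)"
  by (simp add: test_functions_def smooth_has_grad)

lemma continuous_bounded:
  fixes f :: "'a \<Rightarrow> 'b::euclidean_space"
  assumes "continuous_on UNIV f"
  obtains B where "\<And>x. x \<in> closure \<Omega> \<Longrightarrow> norm (f x) \<le> B"
proof -
  have "compact (f ` closure \<Omega>)"
    using assms dom_bounded by (intro compact_continuous_image) (auto intro: continuous_on_subset)
  then show ?thesis using that compact_imp_bounded[of "f ` closure \<Omega>"] unfolding bounded_iff by blast
qed

lemma continuous_L2:
  fixes f :: "'a \<Rightarrow> 'b::euclidean_space"
  assumes "continuous_on UNIV f"
  shows "f \<in> L2 \<Omega>"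
proof -
  obtain B where "\<And>x. x \<in> closure \<Omega> \<Longrightarrow> norm (f x) \<le> B" using continuous_bounded[OF assms] by blast
  then show ?thesis using closure_subset by (intro L2_bounded[of f B] continuous_measurable assms) blast
qed

lemma test_L2: "\<phi> \<in> test_functions \<Omega> \<Longrightarrow> \<phi> \<in> L2 \<Omega>"
  using test_has_grad by (intro continuous_L2 has_grad_continuous)

lemma test_grad_L2: "\<phi> \<in> test_functions \<Omega> \<Longrightarrow> grad \<phi> \<in> L2 \<Omega>"
  using test_has_grad by (intro continuous_L2 has_grad_continuous_grad)

text \<open>Makes the choice in \<open>weak_div\<close> immaterial up to null sets.\<close>

lemma weak_div_unique:
  assumes "w1 \<in> L2 \<Omega>" "w2 \<in> L2 \<Omega>" "has_weak_div \<Omega> v w1" "has_weak_div \<Omega> v w2"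
  shows "AE x in lebesgue_on \<Omega>. w1 x = w2 x"
proof -
  have "AE x in lebesgue_on \<Omega>. w1 x - w2 x = 0"
  proof (rule fundamental_lemma[OF dom_open])
    show "integrable (lebesgue_on \<Omega>) (\<lambda>x. w1 x - w2 x)"
      using assms by (intro Bochner_Integration.integrable_diff L2_integrable)
    fix \<phi> assume \<phi>: "\<phi> \<in> test_functions \<Omega>"
    have "(\<integral>x. \<phi> x * w1 x \<partial>lebesgue_on \<Omega>) = (\<integral>x. \<phi> x * w2 x \<partial>lebesgue_on \<Omega>)"
      using assms(3,4) \<phi> unfolding has_weak_div_def by (metis neg_equal_iff_equal)
    then show "(\<integral>x. \<phi> x * (w1 x - w2 x) \<partial>lebesgue_on \<Omega>) = 0"
      using \<phi> assms(1,2) by (simp add: right_diff_distrib L2_mult_integrable test_L2)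
  qed
  then show ?thesis by eventually_elim simp
qed

lemma Hdiv_weak_div:
  assumes "v \<in> Hdiv \<Omega>"
  shows "weak_div \<Omega> v \<in> L2 \<Omega>" "has_weak_div \<Omega> v (weak_div \<Omega> v)"
proof -
  have "\<exists>w. w \<in> L2 \<Omega> \<and> has_weak_div \<Omega> v w" using assms by (auto simp: Hdiv_def)
  from someI_ex[OF this] show "weak_div \<Omega> v \<in> L2 \<Omega>" "has_weak_div \<Omega> v (weak_div \<Omega> v)"
    unfolding weak_div_def by auto
qed

lemma Hdiv_L2: "v \<in> Hdiv \<Omega> \<Longrightarrow> v \<in> L2 \<Omega>" by (simp add: Hdiv_def)

lemma HdivI: "v \<in> L2 \<Omega> \<Longrightarrow> w \<in> L2 \<Omega> \<Longrightarrow> has_weak_div \<Omega> v w \<Longrightarrow> v \<in> Hdiv \<Omega>"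
  by (auto simp: Hdiv_def)

lemma weak_div_eq:
  assumes "v \<in> L2 \<Omega>" "w \<in> L2 \<Omega>" "has_weak_div \<Omega> v w"
  shows "AE x in lebesgue_on \<Omega>. weak_div \<Omega> v x = w x"
  using HdivI[OF assms] assms Hdiv_weak_div weak_div_unique by blast

lemma has_weak_div_comb:
  assumes v: "v1 \<in> L2 \<Omega>" "v2 \<in> L2 \<Omega>" and w: "w1 \<in> L2 \<Omega>" "w2 \<in> L2 \<Omega>"
    and "has_weak_div \<Omega> v1 w1" "has_weak_div \<Omega> v2 w2"
  shows "has_weak_div \<Omega> (\<lambda>x. a *\<^sub>R v1 x + b *\<^sub>R v2 x) (\<lambda>x. a *\<^sub>R w1 x + b *\<^sub>R w2 x)"
  unfolding has_weak_div_def
proof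
  fix \<phi> assume \<phi>: "\<phi> \<in> test_functions \<Omega>"
  note i = L2_inner_integrable[OF v(1) test_grad_L2[OF \<phi>]] L2_inner_integrable[OF v(2) test_grad_L2[OF \<phi>]]
    L2_mult_integrable[OF test_L2[OF \<phi>] w(1)] L2_mult_integrable[OF test_L2[OF \<phi>] w(2)]
  have "(\<integral>x. (a *\<^sub>R v1 x + b *\<^sub>R v2 x) \<bullet> grad \<phi> x \<partial>lebesgue_on \<Omega>)
      = a * (\<integral>x. v1 x \<bullet> grad \<phi> x \<partial>lebesgue_on \<Omega>) + b * (\<integral>x. v2 x \<bullet> grad \<phi> x \<partial>lebesgue_on \<Omega>)"
    using i by (simp add: inner_add_left)
  also have "\<dots> = - (a * (\<integral>x. \<phi> x * w1 x \<partial>lebesgue_on \<Omega>) + b * (\<integral>x. \<phi> x * w2 x \<partial>lebesgue_on \<Omega>))"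
    using assms(5,6) \<phi> unfolding has_weak_div_def by simp
  also have "a * (\<integral>x. \<phi> x * w1 x \<partial>lebesgue_on \<Omega>) + b * (\<integral>x. \<phi> x * w2 x \<partial>lebesgue_on \<Omega>)
      = (\<integral>x. a * (\<phi> x * w1 x) + b * (\<phi> x * w2 x) \<partial>lebesgue_on \<Omega>)"
    using i by simp
  also have "\<dots> = (\<integral>x. \<phi> x * (a *\<^sub>R w1 x + b *\<^sub>R w2 x) \<partial>lebesgue_on \<Omega>)"
    by (intro Bochner_Integration.integral_cong) (auto simp: algebra_simps)
  finally show "(\<integral>x. (a *\<^sub>R v1 x + b *\<^sub>R v2 x) \<bullet> grad \<phi> x \<partial>lebesgue_on \<Omega>)
      = - (\<integral>x. \<phi> x * (a *\<^sub>R w1 x + b *\<^sub>R w2 x) \<partial>lebesgue_on \<Omega>)" .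
qed

lemma Hdiv_comb:
  assumes "v1 \<in> Hdiv \<Omega>" "v2 \<in> Hdiv \<Omega>"
  shows "(\<lambda>x. a *\<^sub>R v1 x + b *\<^sub>R v2 x) \<in> Hdiv \<Omega>"
    and "AE x in lebesgue_on \<Omega>. weak_div \<Omega> (\<lambda>x. a *\<^sub>R v1 x + b *\<^sub>R v2 x) x = a * weak_div \<Omega> v1 x + b * weak_div \<Omega> v2 x"
proof -
  note d = Hdiv_weak_div[OF assms(1)] Hdiv_weak_div[OF assms(2)]
  have 1: "(\<lambda>x. a *\<^sub>R v1 x + b *\<^sub>R v2 x) \<in> L2 \<Omega>" using assms by (intro L2_comb Hdiv_L2)
  have 2: "(\<lambda>x. a *\<^sub>R weak_div \<Omega> v1 x + b *\<^sub>R weak_div \<Omega> v2 x) \<in> L2 \<Omega>" using d by (intro L2_comb)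
  have 3: "has_weak_div \<Omega> (\<lambda>x. a *\<^sub>R v1 x + b *\<^sub>R v2 x) (\<lambda>x. a *\<^sub>R weak_div \<Omega> v1 x + b *\<^sub>R weak_div \<Omega> v2 x)"
    using assms d by (intro has_weak_div_comb Hdiv_L2)
  show "(\<lambda>x. a *\<^sub>R v1 x + b *\<^sub>R v2 x) \<in> Hdiv \<Omega>" by (rule HdivI[OF 1 2 3])
  show "AE x in lebesgue_on \<Omega>. weak_div \<Omega> (\<lambda>x. a *\<^sub>R v1 x + b *\<^sub>R v2 x) x = a * weak_div \<Omega> v1 x + b * weak_div \<Omega> v2 x"
    using weak_div_eq[OF 1 2 3] by simp
qed

text \<open>Zero is a weak divergence of such a field, and uniqueness transfers this to the chosen
  one. It is what makes the forms vanish on null functions.\<close>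

lemma weak_div_null:
  assumes v: "v \<in> Hdiv \<Omega>" and 0: "AE x in lebesgue_on \<Omega>. v x = 0"
  shows "AE x in lebesgue_on \<Omega>. weak_div \<Omega> v x = 0"
proof -
  have "has_weak_div \<Omega> v (\<lambda>x. 0)"
    unfolding has_weak_div_def
  proof
    fix \<phi> assume "\<phi> \<in> test_functions \<Omega>"
    have "(\<integral>x. v x \<bullet> grad \<phi> x \<partial>lebesgue_on \<Omega>) = 0"
      by (rule integral_eq_zero_AE) (use 0 in eventually_elim, simp)
    then show "(\<integral>x. v x \<bullet> grad \<phi> x \<partial>lebesgue_on \<Omega>) = - (\<integral>x. \<phi> x * 0 \<partial>lebesgue_on \<Omega>)" by simp
  qed
  moreover have "(\<lambda>x. 0) \<in> L2 \<Omega>" by (intro continuous_L2 continuous_on_const)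
  ultimately show ?thesis using weak_div_eq Hdiv_L2[OF v] by blast
qed

end

section \<open>Cone fields on a mesh\<close>

lemma poly_space_has_grad:
  assumes "p \<in> poly_space k"
  shows "\<exists>g. has_grad p g \<and> (\<forall>n. (\<lambda>x. g x \<bullet> n) \<in> poly_space (k - 1))"
proof -
  obtain g where g: "\<forall>x. (p has_derivative (\<lambda>h. g x \<bullet> h)) (at x)" "\<forall>n. (\<lambda>x. g x \<bullet> n) \<in> poly_space (k - 1)"
    using poly_space_gradient[OF assms] by blast
  have "continuous_on UNIV (\<lambda>x. \<Sum>b\<in>Basis. (g x \<bullet> b) *\<^sub>R b)"
    using g(2) by (intro continuous_on_sum continuous_on_scaleR continuous_on_const poly_space_continuous) auto
  then have "continuous_on UNIV g" by (simp add: euclidean_representation)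
  then show ?thesis using g by (auto simp: has_grad_def)
qed

lemma poly_space_0_const:
  assumes "p \<in> poly_space 0"
  shows "p x = p y"
proof -
  obtain c where p: "\<And>x. p x = (\<Sum>m\<in>multi_indices 0. c m * monomial_fun m x)"
    using assms by (auto simp: poly_space_alt)
  have "monomial_fun m x = 1" if "m \<in> multi_indices 0" for m and x :: 'a
    unfolding monomial_fun_def using that by (intro prod.neutral) (auto simp: multi_indices_def)
  then show ?thesis by (simp add: p)
qed

lemma RT_poly_space_sum:
  "finite I \<Longrightarrow> (\<And>i. i \<in> I \<Longrightarrow> q i \<in> RT_poly_space k) \<Longrightarrow> (\<lambda>x. \<Sum>i\<in>I. q i x) \<in> RT_poly_space k"
proof (induction I rule: finite_induct)
  case (insert i I)
  then show ?case using RT_poly_space_comb[of "q i" k "\<lambda>x. \<Sum>i\<in>I. q i x" 1 1] by simp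
qed (simp add: RT_poly_space_zero)

text \<open>With a negligible frontier, integrals over \<open>\<Omega>\<close> and over the closed
  simplices can be exchanged.\<close>

locale fem = mesh \<Omega> \<tau> + bounded_domain \<Omega>
  for \<Omega> :: "'a::euclidean_space set" and \<tau> +
  assumes frontier_null: "negligible (frontier \<Omega>)"
begin

section \<open>Functions defined simplex by simplex\<close>

lemma mesh_compact: "T \<in> \<tau> \<Longrightarrow> compact T"
  using mesh_vertices compact_full_simplex by metis

lemma mesh_closure_interior: "T \<in> \<tau> \<Longrightarrow> closure (interior T) = T"
  using mesh_vertices full_simplex_closure_interior by metis

lemma mesh_convex: "T \<in> \<tau> \<Longrightarrow> convex T"
  using mesh_vertices convex_convex_hull by metis

lemma mesh_sets:
  assumes "T \<in> \<tau>"
  shows "T \<in> sets borel" "T \<inter> space lebesgue \<in> sets lebesgue"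
  using mesh_compact[OF assms] borel_compact lmeasurable_compact[of T] by auto

lemma AE_mesh_interior: "AE x in lebesgue. \<forall>T\<in>\<tau>. x \<in> T \<longrightarrow> x \<in> interior T"
proof -
  have "negligible (\<Union>T\<in>\<tau>. frontier T)"
    using finite_mesh mesh_convex by (intro negligible_Union) (auto intro: negligible_convex_frontier)
  then have "AE x in lebesgue. x \<notin> (\<Union>T\<in>\<tau>. frontier T)"
    unfolding negligible_iff_null_sets by (rule AE_not_in)
  then show ?thesis
  proof eventually_elim
    case (elim x)
    show ?case
    proof (intro ballI impI)
      fix T assume "T \<in> \<tau>" "x \<in> T"
      then show "x \<in> interior T" using elim closure_subset[of T] unfolding frontier_def by blast
    qed
  qed
qed

text \<open>Facets are null sets, so almost every point lies in exactly one simplex, and identities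
  between piecewise functions can be checked on one simplex at a time.\<close>

lemma AE_mesh:
  assumes "\<And>T. T \<in> \<tau> \<Longrightarrow> AE x in lebesgue_on T. P T x"
  shows "AE x in lebesgue_on \<Omega>. \<exists>T\<in>\<tau>. x \<in> T \<and> (\<forall>T'\<in>\<tau>. x \<in> T' \<longleftrightarrow> T' = T) \<and> P T x"
proof -
  have "AE x in lebesgue. \<forall>T\<in>\<tau>. x \<in> T \<longrightarrow> P T x"
    using assms finite_mesh mesh_sets by (intro AE_finite_allI) (auto simp: AE_restrict_space_iff)
  then have "AE x in lebesgue. x \<in> \<Omega> \<longrightarrow> (\<exists>T\<in>\<tau>. x \<in> T \<and> (\<forall>T'\<in>\<tau>. x \<in> T' \<longleftrightarrow> T' = T) \<and> P T x)"
    using AE_mesh_interior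
  proof eventually_elim
    case (elim x)
    show ?case
    proof
      assume "x \<in> \<Omega>"
      then obtain T where T: "T \<in> \<tau>" "x \<in> T" using Union_mesh closure_subset by blast
      then have "T' = T" if "T' \<in> \<tau>" "x \<in> T'" for T'
        using mesh_interior_disjoint[OF T(1) that(1)] elim(2) that by blast
      then show "\<exists>T\<in>\<tau>. x \<in> T \<and> (\<forall>T'\<in>\<tau>. x \<in> T' \<longleftrightarrow> T' = T) \<and> P T x"
        using T elim(1) by blast
    qed
  qed
  then show ?thesis unfolding AE_restrict_space_iff[OF dom_sets'] .
qed

lemma closure_eq_on:
  fixes p q :: "'a \<Rightarrow> 'b::euclidean_space"
  assumes T: "T \<in> \<tau>" and c: "continuous_on UNIV p" "continuous_on UNIV q"
    and eq: "\<And>x. x \<in> interior T \<Longrightarrow> p x = q x" and x: "x \<in> T"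
  shows "p x = q x"
proof -
  have "closed {x. p x = q x}" using c by (intro closed_Collect_eq)
  moreover have "interior T \<subseteq> {x. p x = q x}" using eq by blast
  ultimately have "closure (interior T) \<subseteq> {x. p x = q x}" by (intro closure_minimal)
  then show ?thesis using x mesh_closure_interior[OF T] by blast
qed

text \<open>Carries agreement almost everywhere to the boundary of the simplex, where normal
  components are evaluated.\<close>

lemma AE_eq_on:
  fixes p q :: "'a \<Rightarrow> 'b::euclidean_space"
  assumes T: "T \<in> \<tau>" and c: "continuous_on UNIV p" "continuous_on UNIV q"
    and eq: "AE x in lebesgue_on T. p x = q x" and x: "x \<in> T"
  shows "p x = q x"
proof (rule closure_eq_on[OF T c _ x])
  fix y assume y: "y \<in> interior T"
  have "AE x in lebesgue. x \<in> T \<longrightarrow> p x = q x" using eq unfolding AE_restrict_space_iff[OF mesh_sets(2)[OF T]] .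
  then have "AE x\<in>interior T in lebesgue. x \<in> {x. p x = q x}"
    by eventually_elim (use interior_subset in blast)
  moreover have "closed {x. p x = q x}" using c by (intro closed_Collect_eq)
  ultimately show "p y = q y" using mem_closed_if_AE_lebesgue_open[OF open_interior _ _ y] by blast
qed

text \<open>Extension by zero from a closed simplex. In sums, values on shared facets are counted
  more than once, which affects only a null set.\<close>

definition pw :: "'a set \<Rightarrow> ('a \<Rightarrow> 'b) \<Rightarrow> 'a \<Rightarrow> 'b::zero" where
  "pw T h x = (if x \<in> T then h x else 0)"

lemma pw_measurable:
  fixes h :: "'a \<Rightarrow> 'b::euclidean_space"
  assumes "T \<in> \<tau>" "continuous_on UNIV h"
  shows "pw T h \<in> borel_measurable borel"
  unfolding pw_def[abs_def]
  using mesh_sets(1)[OF assms(1)] assms(2)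
  by (intro measurable_If_set) (auto intro: borel_measurable_continuous_onI)

lemma pw_L2:
  fixes h :: "'a \<Rightarrow> 'b::euclidean_space"
  assumes "T \<in> \<tau>" "continuous_on UNIV h"
  shows "pw T h \<in> L2 \<Omega>"
proof -
  obtain B where B: "\<And>x. x \<in> closure \<Omega> \<Longrightarrow> norm (h x) \<le> B" using continuous_bounded[OF assms(2)] by blast
  have "norm (pw T h x) \<le> max B 0" for x
    using B[of x] Union_mesh assms(1) by (auto simp: pw_def le_max_iff_disj)
  then show ?thesis
    by (intro L2_bounded measurable_restrict_space1 measurable_completion) (auto simp: pw_measurable[OF assms])
qed

lemma pw_integral:
  fixes h :: "'a \<Rightarrow> real"
  assumes T: "T \<in> \<tau>" and h: "continuous_on UNIV h"
  shows "(\<integral>x. pw T h x \<partial>lebesgue_on \<Omega>) = (LINT x:T|lborel. h x)"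
proof -
  have m: "pw T h \<in> borel_measurable borel" by (rule pw_measurable[OF assms])
  have "AE x in lebesgue. x \<notin> frontier \<Omega>" using frontier_null by (simp add: negligible_iff_null_sets AE_not_in)
  then have ae: "AE x in lebesgue. indicator \<Omega> x *\<^sub>R pw T h x = pw T h x"
  proof eventually_elim
    case (elim x)
    have "x \<in> T \<Longrightarrow> x \<in> \<Omega>" using elim T Union_mesh dom_open unfolding frontier_def by (auto simp: interior_open)
    then show ?case by (auto simp: pw_def indicator_def)
  qed
  have "(\<integral>x. pw T h x \<partial>lebesgue_on \<Omega>) = (\<integral>x. indicator \<Omega> x *\<^sub>R pw T h x \<partial>lebesgue)"
    by (rule integral_restrict_space[OF dom_sets'])
  also have "\<dots> = (\<integral>x. pw T h x \<partial>lebesgue)"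
  proof (rule integral_cong_AE[OF _ _ ae])
    show "pw T h \<in> borel_measurable lebesgue" using m by (simp add: measurable_completion)
    show "(\<lambda>x. indicator \<Omega> x *\<^sub>R pw T h x) \<in> borel_measurable lebesgue"
      using m dom_open by (intro borel_measurable_scaleR borel_measurable_indicator measurable_completion) auto
  qed
  also have "\<dots> = (\<integral>x. pw T h x \<partial>lborel)" using m by (intro integral_completion) simp
  also have "\<dots> = (LINT x:T|lborel. h x)"
    unfolding set_lebesgue_integral_def by (intro Bochner_Integration.integral_cong) (auto simp: pw_def)
  finally show ?thesis .
qed

definition cone_field :: "'a set \<Rightarrow> 'a \<Rightarrow> ('a \<Rightarrow> real) \<Rightarrow> 'a \<Rightarrow> 'a" where
  "cone_field C v \<psi> = pw (convex hull C) (\<lambda>x. \<psi> x *\<^sub>R (x - v))"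

text \<open>The divergence taken on one simplex; \<open>real DIM('a)\<close> is the divergence of
  \<open>x - v\<close>.\<close>

definition cone_div :: "'a set \<Rightarrow> 'a \<Rightarrow> ('a \<Rightarrow> real) \<Rightarrow> ('a \<Rightarrow> 'a) \<Rightarrow> 'a \<Rightarrow> real" where
  "cone_div C v \<psi> g = pw (convex hull C) (\<lambda>x. real DIM('a) * \<psi> x + g x \<bullet> (x - v))"

lemma cone_continuous:
  assumes "has_grad \<psi> g"
  shows "continuous_on UNIV (\<lambda>x. \<psi> x *\<^sub>R (x - v))" "continuous_on UNIV (\<lambda>x. real DIM('a) * \<psi> x + g x \<bullet> (x - v))"
  using assms by (auto intro!: continuous_intros intro: has_grad_continuous has_grad_continuous_grad)

lemma cone_L2:
  assumes "convex hull C \<in> \<tau>" "has_grad \<psi> g"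
  shows "cone_field C v \<psi> \<in> L2 \<Omega>" "cone_div C v \<psi> g \<in> L2 \<Omega>"
  unfolding cone_field_def cone_div_def using assms cone_continuous by (auto intro!: pw_L2)

text \<open>Integration by parts on one simplex: the product rule for the divergence of
  \<open>\<phi> \<psi> (x - v)\<close>, with \<open>cone_flux\<close> as boundary term.\<close>

lemma cone_field_weak_div:
  assumes C: "convex hull C \<in> \<tau>" and \<psi>: "has_grad \<psi> g" and \<phi>: "\<phi> \<in> test_functions \<Omega>"
  shows "(\<integral>x. cone_field C v \<psi> x \<bullet> grad \<phi> x \<partial>lebesgue_on \<Omega>)
    = cone_flux C v (\<lambda>x. \<phi> x * \<psi> x) (\<lambda>x. \<phi> x *\<^sub>R g x + \<psi> x *\<^sub>R grad \<phi> x)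
      - (\<integral>x. \<phi> x * cone_div C v \<psi> g x \<partial>lebesgue_on \<Omega>)"
proof -
  note \<phi>g = test_has_grad[OF \<phi>]
  note prod = has_grad_mult[OF \<phi>g \<psi>]
  have "(\<integral>x. cone_field C v \<psi> x \<bullet> grad \<phi> x \<partial>lebesgue_on \<Omega>) + (\<integral>x. \<phi> x * cone_div C v \<psi> g x \<partial>lebesgue_on \<Omega>)
      = (\<integral>x. cone_field C v \<psi> x \<bullet> grad \<phi> x + \<phi> x * cone_div C v \<psi> g x \<partial>lebesgue_on \<Omega>)"
    using cone_L2[OF C \<psi>] test_L2[OF \<phi>] test_grad_L2[OF \<phi>]
    by (intro Bochner_Integration.integral_add[symmetric] L2_inner_integrable L2_mult_integrable) auto
  also have "\<dots> = (\<integral>x. pw (convex hull C) (\<lambda>x. real DIM('a) * (\<phi> x * \<psi> x) + (\<phi> x *\<^sub>R g x + \<psi> x *\<^sub>R grad \<phi> x) \<bullet> (x - v)) x \<partial>lebesgue_on \<Omega>)"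
    by (intro Bochner_Integration.integral_cong)
      (auto simp: cone_field_def cone_div_def pw_def inner_add_left inner_commute algebra_simps)
  also have "\<dots> = cone_flux C v (\<lambda>x. \<phi> x * \<psi> x) (\<lambda>x. \<phi> x *\<^sub>R g x + \<psi> x *\<^sub>R grad \<phi> x)"
    unfolding cone_flux_def by (intro pw_integral C cone_continuous(2)[OF prod])
  finally show ?thesis by simp
qed

lemma L2_zero: "(\<lambda>x. 0) \<in> L2 \<Omega>" by (intro continuous_L2 continuous_on_const)

lemma L2_sum:
  assumes "finite I" "\<And>i. i \<in> I \<Longrightarrow> f i \<in> L2 \<Omega>"
  shows "(\<lambda>x. \<Sum>i\<in>I. f i x) \<in> L2 \<Omega>"
  using assms
proof (induction I rule: finite_induct)
  case (insert i I)
  then show ?case using L2_comb[of "f i" "\<lambda>x. \<Sum>i\<in>I. f i x" 1 1] by simp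
qed (simp add: L2_zero)

text \<open>Continuity of normal components appears as cancellation of the fluxes for every test
  function, so no trace on a facet is formed.\<close>

lemma cone_sum_has_weak_div:
  assumes I: "finite I" and C: "\<And>i. i \<in> I \<Longrightarrow> convex hull (C i) \<in> \<tau>"
    and \<psi>: "\<And>i. i \<in> I \<Longrightarrow> has_grad (\<psi> i) (g i)"
    and flux: "\<And>\<phi>. \<phi> \<in> test_functions \<Omega> \<Longrightarrow>
      (\<Sum>i\<in>I. cone_flux (C i) (v i) (\<lambda>x. \<phi> x * \<psi> i x) (\<lambda>x. \<phi> x *\<^sub>R g i x + \<psi> i x *\<^sub>R grad \<phi> x)) = 0"
  shows "has_weak_div \<Omega> (\<lambda>x. \<Sum>i\<in>I. cone_field (C i) (v i) (\<psi> i) x) (\<lambda>x. \<Sum>i\<in>I. cone_div (C i) (v i) (\<psi> i) (g i) x)"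
  unfolding has_weak_div_def
proof
  fix \<phi> assume \<phi>: "\<phi> \<in> test_functions \<Omega>"
  have "(\<integral>x. (\<Sum>i\<in>I. cone_field (C i) (v i) (\<psi> i) x) \<bullet> grad \<phi> x \<partial>lebesgue_on \<Omega>)
      = (\<Sum>i\<in>I. \<integral>x. cone_field (C i) (v i) (\<psi> i) x \<bullet> grad \<phi> x \<partial>lebesgue_on \<Omega>)"
    unfolding inner_sum_left using C \<psi> \<phi>
    by (intro Bochner_Integration.integral_sum L2_inner_integrable cone_L2 test_grad_L2)
  also have "\<dots> = - (\<Sum>i\<in>I. \<integral>x. \<phi> x * cone_div (C i) (v i) (\<psi> i) (g i) x \<partial>lebesgue_on \<Omega>)"
    using flux[OF \<phi>] by (simp add: cone_field_weak_div[OF C \<psi> \<phi>] sum_subtractf)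
  also have "(\<Sum>i\<in>I. \<integral>x. \<phi> x * cone_div (C i) (v i) (\<psi> i) (g i) x \<partial>lebesgue_on \<Omega>)
      = (\<integral>x. \<phi> x * (\<Sum>i\<in>I. cone_div (C i) (v i) (\<psi> i) (g i) x) \<partial>lebesgue_on \<Omega>)"
    unfolding sum_distrib_left using C \<psi> \<phi>
    by (intro Bochner_Integration.integral_sum[symmetric] L2_mult_integrable cone_L2 test_L2)
  finally show "(\<integral>x. (\<Sum>i\<in>I. cone_field (C i) (v i) (\<psi> i) x) \<bullet> grad \<phi> x \<partial>lebesgue_on \<Omega>)
    = - (\<integral>x. \<phi> x * (\<Sum>i\<in>I. cone_div (C i) (v i) (\<psi> i) (g i) x) \<partial>lebesgue_on \<Omega>)" .
qed

lemma outward_normal_notin: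
  assumes "outward_unit_normal \<Omega> x n"
  shows "x \<notin> \<Omega>"
proof
  assume "x \<in> \<Omega>"
  obtain \<epsilon> where e: "\<epsilon> > 0" "\<Omega> \<inter> ball x \<epsilon> = {y \<in> ball x \<epsilon>. (y - x) \<bullet> n < 0}"
    using assms unfolding outward_unit_normal_def by blast
  have "x \<in> \<Omega> \<inter> ball x \<epsilon>" using \<open>x \<in> \<Omega>\<close> e(1) by simp
  then have "(x - x) \<bullet> n < 0" unfolding e(2) by blast
  then show False by simp
qed

text \<open>On facets containing \<open>v i\<close> the vector \<open>x - v i\<close> is tangential,
  so only the opposite facet can carry a normal component, and there \<open>bc\<close> makes the
  weight vanish. It is asked only at points outside \<open>\<Omega>\<close>, because outward normals
  exist only there; interior facets are thereby exempt.\<close>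

lemma cone_sum_RT_bc:
  assumes I: "finite I" and C: "\<And>i. i \<in> I \<Longrightarrow> full_simplex (C i)" "\<And>i. i \<in> I \<Longrightarrow> convex hull (C i) \<in> \<tau>"
      "\<And>i. i \<in> I \<Longrightarrow> v i \<in> C i"
    and \<psi>: "\<And>i. i \<in> I \<Longrightarrow> has_grad (\<psi> i) (g i)" "\<And>i. i \<in> I \<Longrightarrow> \<psi> i \<in> poly_space k"
    and flux: "\<And>\<phi>. \<phi> \<in> test_functions \<Omega> \<Longrightarrow>
      (\<Sum>i\<in>I. cone_flux (C i) (v i) (\<lambda>x. \<phi> x * \<psi> i x) (\<lambda>x. \<phi> x *\<^sub>R g i x + \<psi> i x *\<^sub>R grad \<phi> x)) = 0"
    and bc: "\<And>i x. i \<in> I \<Longrightarrow> x \<in> rel_interior (convex hull (C i - {v i})) \<Longrightarrow> x \<in> \<Gamma> \<Longrightarrow> x \<notin> \<Omega> \<Longrightarrow> \<psi> i x = 0"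
  shows "(\<lambda>x. \<Sum>i\<in>I. cone_field (C i) (v i) (\<psi> i) x) \<in> RT_bc (k + 1) \<Omega> \<tau> \<Gamma>"
    and "AE x in lebesgue_on \<Omega>. weak_div \<Omega> (\<lambda>x. \<Sum>i\<in>I. cone_field (C i) (v i) (\<psi> i) x) x
      = (\<Sum>i\<in>I. cone_div (C i) (v i) (\<psi> i) (g i) x)"
proof -
  define \<beta> where "\<beta> x = (\<Sum>i\<in>I. cone_field (C i) (v i) (\<psi> i) x)" for x
  have wd: "has_weak_div \<Omega> \<beta> (\<lambda>x. \<Sum>i\<in>I. cone_div (C i) (v i) (\<psi> i) (g i) x)"
    unfolding \<beta>_def[abs_def] by (rule cone_sum_has_weak_div[OF I C(2) \<psi>(1) flux])
  have L: "\<beta> \<in> L2 \<Omega>" "(\<lambda>x. \<Sum>i\<in>I. cone_div (C i) (v i) (\<psi> i) (g i) x) \<in> L2 \<Omega>"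
    unfolding \<beta>_def[abs_def] using I C \<psi> by (auto intro!: L2_sum cone_L2)
  have wde: "AE x in lebesgue_on \<Omega>. weak_div \<Omega> \<beta> x = (\<Sum>i\<in>I. cone_div (C i) (v i) (\<psi> i) (g i) x)"
    by (rule weak_div_eq[OF L wd])
  \<comment> \<open>Several cone fields may share a simplex, as in the bubbles, so the polynomial on
    \<open>T\<close> collects all of them.\<close>
  define b where "b T x = (\<Sum>i\<in>{i\<in>I. convex hull (C i) = T}. \<psi> i x *\<^sub>R (x - v i))" for T x
  have b: "b T \<in> RT_poly_space k" for T
    unfolding b_def[abs_def] using I \<psi>(2) by (intro RT_poly_space_sum RT_poly_space_cone) auto
  have \<beta>b: "AE x in lebesgue_on T. \<beta> x = b T x" if T: "T \<in> \<tau>" for T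
  proof -
    have "AE x in lebesgue. x \<in> T \<longrightarrow> \<beta> x = b T x"
      using AE_mesh_interior
    proof eventually_elim
      case (elim x)
      show ?case
      proof
        assume "x \<in> T"
        then have xT: "x \<in> interior T" using elim T by blast
        have iff: "x \<in> convex hull (C i) \<longleftrightarrow> convex hull (C i) = T" if "i \<in> I" for i
          using mesh_interior_disjoint[OF T C(2)[OF that] _ xT] \<open>x \<in> T\<close> by blast
        have "\<beta> x = (\<Sum>i\<in>I. if convex hull (C i) = T then \<psi> i x *\<^sub>R (x - v i) else 0)"
          unfolding \<beta>_def cone_field_def pw_def using iff by (intro sum.cong) auto
        also have "\<dots> = b T x" unfolding b_def using I by (simp only: sum.inter_filter)
        finally show "\<beta> x = b T x" .
      qed
    qed
    then show ?thesis unfolding AE_restrict_space_iff[OF mesh_sets(2)[OF T]] .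
  qed
  have RT: "\<beta> \<in> RT (k + 1) \<Omega> \<tau>"
  proof -
    have "b T \<in> RT_poly_space (k + 1 - 1)" for T using b[of T] by simp
    then have "\<forall>T\<in>\<tau>. \<exists>q\<in>RT_poly_space (k + 1 - 1). AE x in lebesgue_on T. \<beta> x = q x"
      using \<beta>b by (intro ballI bexI[of _ "b _"])
    then show ?thesis unfolding RT_def mem_Collect_eq by (rule conjI[OF HdivI[OF L wd]])
  qed
  have "\<beta> \<in> RT_bc (k + 1) \<Omega> \<tau> \<Gamma>"
    unfolding RT_bc_def
  proof (intro CollectI conjI RT ballI impI allI)
    fix T q F x n
    assume T: "T \<in> \<tau>" and q: "q \<in> RT_poly_space (k + 1 - 1)" and ae: "AE x in lebesgue_on T. \<beta> x = q x"
      and F: "F facet_of T" and x: "x \<in> \<Gamma> \<inter> rel_interior F" and n: "outward_unit_normal \<Omega> x n"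
    have FT: "F \<subseteq> T" "convex F"
      using facet_of_imp_subset[OF F] face_of_imp_convex[OF facet_of_imp_face_of[OF F]] by auto
    have xT: "x \<in> T" using x FT rel_interior_subset by blast
    \<comment> \<open>The boundary condition ranges over every polynomial that represents the field
      on \<open>T\<close>; each agrees with \<open>b T\<close> up to the boundary.\<close>
    have "AE x in lebesgue_on T. q x = b T x" using ae \<beta>b[OF T] by eventually_elim simp
    then have "q x = b T x"
      by (rule AE_eq_on[OF T RT_poly_space_continuous[OF q] RT_poly_space_continuous[OF b] _ xT])
    moreover have z: "\<psi> i x * ((x - v i) \<bullet> n) = 0" if i: "i \<in> {i\<in>I. convex hull (C i) = T}" for i
    proof -
      have iI: "i \<in> I" and iT: "convex hull (C i) = T" using i by auto
      have "\<not> affine_dependent (C i)" using C(1)[OF iI] by (simp add: full_simplex_def)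
      then obtain w where w: "w \<in> C i" "F = convex hull (C i - {w})"
        using F facet_of_convex_hull_affine_independent[of "C i" F] unfolding iT by blast
      show ?thesis
      proof (cases "w = v i")
        case True
        then have "\<psi> i x = 0" using bc[OF iI, of x] x w outward_normal_notin[OF n] by auto
        then show ?thesis by simp
      next
        case False
        then have "v i \<in> F" unfolding w(2) using C(3)[OF iI] by (intro hull_inc) auto
        moreover have "F \<subseteq> closure \<Omega>" using FT T Union_mesh by blast
        ultimately show ?thesis using outward_normal_orthogonal[OF n FT(2), of "v i"] x by simp
      qed
    qed
    then have "b T x \<bullet> n = 0" unfolding b_def inner_sum_left inner_scaleR_left by (intro sum.neutral ballI z)
    ultimately show "q x \<bullet> n = 0" by simp
  qed
  then show "(\<lambda>x. \<Sum>i\<in>I. cone_field (C i) (v i) (\<psi> i) x) \<in> RT_bc (k + 1) \<Omega> \<tau> \<Gamma>"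
    unfolding \<beta>_def[abs_def] .
  show "AE x in lebesgue_on \<Omega>. weak_div \<Omega> (\<lambda>x. \<Sum>i\<in>I. cone_field (C i) (v i) (\<psi> i) x) x
      = (\<Sum>i\<in>I. cone_div (C i) (v i) (\<psi> i) (g i) x)" using wde unfolding \<beta>_def[abs_def] .
qed

lemma cone_sum_integral:
  assumes I: "finite I" and C: "\<And>i. i \<in> I \<Longrightarrow> convex hull (C i) \<in> \<tau>"
    and \<psi>: "\<And>i. i \<in> I \<Longrightarrow> has_grad (\<psi> i) (g i)"
    and p: "\<And>T. T \<in> \<tau> \<Longrightarrow> continuous_on UNIV (p T)" "\<And>T. T \<in> \<tau> \<Longrightarrow> AE x in lebesgue_on T. u x = p T x"
    and um: "u \<in> borel_measurable (lebesgue_on \<Omega>)" and wm: "w \<in> borel_measurable (lebesgue_on \<Omega>)"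
    and w: "AE x in lebesgue_on \<Omega>. w x = (\<Sum>i\<in>I. cone_div (C i) (v i) (\<psi> i) (g i) x)"
  shows "(\<integral>x. u x * w x \<partial>lebesgue_on \<Omega>)
    = (\<Sum>i\<in>I. LINT x:convex hull (C i)|lborel. p (convex hull (C i)) x * (real DIM('a) * \<psi> i x + g i x \<bullet> (x - v i)))"
proof -
  define h where "h i x = p (convex hull (C i)) x * (real DIM('a) * \<psi> i x + g i x \<bullet> (x - v i))" for i x
  have h: "continuous_on UNIV (h i)" if "i \<in> I" for i
    unfolding h_def[abs_def] using p(1)[OF C[OF that]] cone_continuous(2)[OF \<psi>[OF that]]
    by (intro continuous_on_mult)
  have "AE x in lebesgue_on \<Omega>. \<exists>T\<in>\<tau>. x \<in> T \<and> (\<forall>T'\<in>\<tau>. x \<in> T' \<longleftrightarrow> T' = T) \<and> u x = p T x"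
    by (rule AE_mesh) (rule p(2))
  then have "AE x in lebesgue_on \<Omega>. u x * w x = (\<Sum>i\<in>I. pw (convex hull (C i)) (h i) x)"
    using w
  proof eventually_elim
    case (elim x)
    then obtain T where T: "T \<in> \<tau>" "\<And>T'. T' \<in> \<tau> \<Longrightarrow> x \<in> T' \<longleftrightarrow> T' = T" "u x = p T x" by blast
    have "u x * cone_div (C i) (v i) (\<psi> i) (g i) x = pw (convex hull (C i)) (h i) x" if "i \<in> I" for i
      using T(2)[OF C[OF that]] T(3) by (auto simp: cone_div_def pw_def h_def)
    then show ?case unfolding elim(2) sum_distrib_left by (rule sum.cong[OF refl])
  qed
  then have "(\<integral>x. u x * w x \<partial>lebesgue_on \<Omega>) = (\<integral>x. (\<Sum>i\<in>I. pw (convex hull (C i)) (h i) x) \<partial>lebesgue_on \<Omega>)"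
    using C h
    by (intro integral_cong_AE borel_measurable_times um wm borel_measurable_sum L2_measurable[OF pw_L2])
  also have "\<dots> = (\<Sum>i\<in>I. \<integral>x. pw (convex hull (C i)) (h i) x \<partial>lebesgue_on \<Omega>)"
    using C h by (intro Bochner_Integration.integral_sum L2_integrable pw_L2)
  also have "\<dots> = (\<Sum>i\<in>I. LINT x:convex hull (C i)|lborel. h i x)"
    using C h by (intro sum.cong refl pw_integral)
  finally show ?thesis unfolding h_def .
qed

lemma DG_rep:
  assumes "u \<in> DG k \<tau>"
  obtains p where "\<And>T. T \<in> \<tau> \<Longrightarrow> p T \<in> poly_space k" "\<And>T. T \<in> \<tau> \<Longrightarrow> AE x in lebesgue_on T. u x = p T x"
proof -
  have "\<forall>T\<in>\<tau>. \<exists>p. p \<in> poly_space k \<and> (AE x in lebesgue_on T. u x = p x)"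
    using assms unfolding DG_def by blast
  from bchoice[OF this] show ?thesis using that by blast
qed

lemma piecewise_L2:
  fixes u :: "'a \<Rightarrow> 'b::euclidean_space"
  assumes "\<And>T. T \<in> \<tau> \<Longrightarrow> continuous_on UNIV (p T)" "\<And>T. T \<in> \<tau> \<Longrightarrow> AE x in lebesgue_on T. u x = p T x"
  shows "u \<in> L2 \<Omega>"
proof -
  have s: "(\<lambda>x. \<Sum>T\<in>\<tau>. pw T (p T) x) \<in> L2 \<Omega>" using finite_mesh assms(1) by (intro L2_sum pw_L2)
  have "AE x in lebesgue_on \<Omega>. \<exists>T\<in>\<tau>. x \<in> T \<and> (\<forall>T'\<in>\<tau>. x \<in> T' \<longleftrightarrow> T' = T) \<and> u x = p T x"
    by (rule AE_mesh) (rule assms(2))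
  then have "AE x in lebesgue_on \<Omega>. (\<Sum>T\<in>\<tau>. pw T (p T) x) = u x"
  proof eventually_elim
    case (elim x)
    then obtain T where T: "T \<in> \<tau>" "\<And>T'. T' \<in> \<tau> \<Longrightarrow> x \<in> T' \<longleftrightarrow> T' = T" "u x = p T x" by blast
    have "(\<Sum>T'\<in>\<tau>. pw T' (p T') x) = (\<Sum>T'\<in>\<tau>. if T' = T then p T x else 0)"
      using T(2) by (intro sum.cong) (auto simp: pw_def)
    also have "\<dots> = u x" using T(1,3) finite_mesh by simp
    finally show ?case .
  qed
  then show ?thesis using s by (intro L2_AE_cong[OF s] measurable_AE[OF L2_measurable[OF s]])
qed

lemma DG_L2: "u \<in> DG k \<tau> \<Longrightarrow> u \<in> L2 \<Omega>"
  using DG_rep[of u k] piecewise_L2[of _ u] poly_space_continuous by metis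

end

section \<open>Surjectivity of the discrete divergence\<close>

lemma has_grad_const: "has_grad (\<lambda>x. c) (\<lambda>x. 0)"
  by (simp add: has_grad_def)

text \<open>The gradient is left unsimplified to match the flux condition of
  \<open>cone_sum_RT_bc\<close> for a constant weight.\<close>

lemma cone_flux_scale:
  assumes "full_simplex C" "has_grad \<phi> f"
  shows "cone_flux C v (\<lambda>x. \<phi> x * c) (\<lambda>x. \<phi> x *\<^sub>R 0 + c *\<^sub>R f x) = c * cone_flux C v \<phi> f"
proof -
  have "cone_flux C v (\<lambda>x. \<phi> x * c) (\<lambda>x. \<phi> x *\<^sub>R 0 + c *\<^sub>R f x)
      = (LINT x:convex hull C|lborel. c * (real DIM('a) * \<phi> x + f x \<bullet> (x - v)))"
    unfolding cone_flux_def by (simp add: algebra_simps)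
  then show ?thesis unfolding cone_flux_def by simp
qed

lemma nonneg_integral_zero_interior:
  fixes Q :: "'a::euclidean_space \<Rightarrow> real"
  assumes T: "compact T" and Q: "continuous_on UNIV Q" "\<And>x. x \<in> T \<Longrightarrow> 0 \<le> Q x"
    and 0: "(LINT x:T|lborel. Q x) = 0" and x: "x \<in> interior T"
  shows "Q x = 0"
proof -
  have "integrable lborel (\<lambda>x. indicator T x * Q x)"
    using set_integrable_compact[OF T continuous_on_subset[OF Q(1) subset_UNIV]] by (simp add: set_integrable_def)
  moreover have "AE x in lborel. 0 \<le> indicator T x * Q x" using Q(2) by (intro AE_I2) (auto simp: indicator_def)
  moreover have "(\<integral>x. indicator T x * Q x \<partial>lborel) = 0" using 0 by (simp add: set_lebesgue_integral_def)
  ultimately have "AE x in lborel. indicator T x * Q x = 0" using integral_nonneg_eq_0_iff_AE by blast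
  then have "AE x in lebesgue. indicator T x * Q x = 0" by (rule AE_completion)
  then have "AE x\<in>interior T in lebesgue. x \<in> {x. Q x = 0}"
  proof eventually_elim
    case (elim x)
    then show ?case using interior_subset[of T] by (auto simp: indicator_def split: if_splits)
  qed
  moreover have "closed {x. Q x = 0}" using Q(1) by (intro closed_Collect_eq continuous_on_const)
  ultimately show ?thesis using mem_closed_if_AE_lebesgue_open[OF open_interior _ _ x] by blast
qed

text \<open>With \<open>\<psi> v = bary C v * (v \<bullet> grad p)\<close> the sum of the fields \<open>\<psi> v (x - v)\<close> is an interior bubble,
  and its scalar product with \<open>grad p\<close> is minus the variance of \<open>v \<bullet> grad p\<close> with respect to the
  barycentric weights.\<close>

lemma bubble_orthogonal_const:
  fixes C :: "'a::euclidean_space set"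
  assumes C: "full_simplex C" and p: "p \<in> poly_space k"
    and orth: "\<And>\<psi> g. (\<And>v. v \<in> C \<Longrightarrow> has_grad (\<psi> v) (g v)) \<Longrightarrow> (\<And>v. v \<in> C \<Longrightarrow> \<psi> v \<in> poly_space k) \<Longrightarrow>
      (\<And>v x. v \<in> C \<Longrightarrow> x \<in> convex hull (C - {v}) \<Longrightarrow> \<psi> v x = 0) \<Longrightarrow>
      (\<Sum>v\<in>C. LINT x:convex hull C|lborel. p x * (real DIM('a) * \<psi> v x + g v x \<bullet> (x - v))) = 0"
  shows "\<exists>a. \<forall>x\<in>convex hull C. p x = a"
proof (cases k)
  case 0
  then show ?thesis using poly_space_0_const[of p] p by blast
next
  case (Suc l)
  let ?T = "convex hull C"
  have T: "compact ?T" by (rule compact_full_simplex[OF C])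
  obtain g where g: "has_grad p g" "\<And>n. (\<lambda>x. g x \<bullet> n) \<in> poly_space l"
    using poly_space_has_grad[OF p] Suc by auto
  \<comment> \<open>The components of the gradient have degree at most \<open>l\<close>, and the
    affine factor raises this to \<open>Suc l = k\<close>.\<close>
  define \<psi> where "\<psi> v x = bary C v x * (g x \<bullet> v)" for v x
  have \<psi>P: "\<psi> v \<in> poly_space k" if v: "v \<in> C" for v
  proof -
    obtain n c where "bary C v = (\<lambda>y. y \<bullet> n + c)" using bary_affine[OF C v] by fast
    then show ?thesis using poly_space_mult_affine[OF g(2)[of v], of n c] by (simp add: \<psi>_def[abs_def] Suc)
  qed
  then have "\<forall>v\<in>C. \<exists>h. has_grad (\<psi> v) h" using poly_space_has_grad by blast
  from bchoice[OF this] obtain h where h: "\<And>v. v \<in> C \<Longrightarrow> has_grad (\<psi> v) (h v)" by blast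
  have zero: "\<psi> v x = 0" if "v \<in> C" "x \<in> convex hull (C - {v})" for v x
    using that bary_mem_face[OF C, of "C - {v}" x] by (simp add: \<psi>_def)
  note cont = has_grad_continuous[OF g(1)] has_grad_continuous_grad[OF g(1)]
    has_grad_continuous[OF h] has_grad_continuous_grad[OF h]
  have part: "(LINT x:?T|lborel. p x * (real DIM('a) * \<psi> v x + h v x \<bullet> (x - v))) = - (LINT x:?T|lborel. \<psi> v x * (g x \<bullet> (x - v)))"
    if v: "v \<in> C" for v
  proof -
    \<comment> \<open>Integration by parts has no boundary term, since \<open>\<psi> v\<close>
      vanishes on the facet opposite \<open>v\<close>.\<close>
    have "cone_flux C v (\<lambda>x. p x * \<psi> v x) (\<lambda>x. p x *\<^sub>R h v x + \<psi> v x *\<^sub>R g x) = 0"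
      using zero[OF v] by (intro cone_flux_zero C v has_grad_mult g h) simp
    moreover have "cone_flux C v (\<lambda>x. p x * \<psi> v x) (\<lambda>x. p x *\<^sub>R h v x + \<psi> v x *\<^sub>R g x)
      = (LINT x:?T|lborel. p x * (real DIM('a) * \<psi> v x + h v x \<bullet> (x - v)) + \<psi> v x * (g x \<bullet> (x - v)))"
      unfolding cone_flux_def by (simp add: inner_add_left algebra_simps)
    moreover have "\<dots> = (LINT x:?T|lborel. p x * (real DIM('a) * \<psi> v x + h v x \<bullet> (x - v))) + (LINT x:?T|lborel. \<psi> v x * (g x \<bullet> (x - v)))"
      using v by (intro set_integral_add set_integrable_compact T continuous_intros cont)
    ultimately show ?thesis by simp
  qed
  have "(\<Sum>v\<in>C. LINT x:?T|lborel. p x * (real DIM('a) * \<psi> v x + h v x \<bullet> (x - v))) = 0"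
    by (rule orth[OF h \<psi>P zero])
  then have "(\<Sum>v\<in>C. LINT x:?T|lborel. \<psi> v x * (g x \<bullet> (x - v))) = 0"
    using part by (simp add: sum_negf)
  moreover have "(\<Sum>v\<in>C. LINT x:?T|lborel. \<psi> v x * (g x \<bullet> (x - v))) = (LINT x:?T|lborel. (\<Sum>v\<in>C. \<psi> v x * (g x \<bullet> (x - v))))"
    unfolding set_lebesgue_integral_def scaleR_sum_right
    by (intro Bochner_Integration.integral_sum[symmetric] set_integrable_compact[unfolded set_integrable_def]
        T continuous_intros cont)
  ultimately have int0: "(LINT x:?T|lborel. (\<Sum>v\<in>C. \<psi> v x * (g x \<bullet> (x - v)))) = 0" by simp
  define Q where "Q x = (\<Sum>v\<in>C. bary C v x * (g x \<bullet> v - g x \<bullet> x)\<^sup>2)" for x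
  have mean: "(\<Sum>v\<in>C. bary C v y * (z \<bullet> v)) = z \<bullet> y" for y z
    using arg_cong[OF bary_repr[OF C, of y], of "\<lambda>t. z \<bullet> t"] by (simp add: inner_sum_right)
  have "(\<Sum>v\<in>C. \<psi> v x * (g x \<bullet> (x - v))) = - Q x" for x
  proof -
    define m where "m = g x \<bullet> x"
    \<comment> \<open>The square is expanded around the mean \<open>m\<close>. The weights sum to
      one and have mean \<open>m\<close>, so the last two terms cancel.\<close>
    have "Q x = (\<Sum>v\<in>C. bary C v x * (g x \<bullet> v) * (g x \<bullet> v - m) - m * (bary C v x * (g x \<bullet> v)) + m\<^sup>2 * bary C v x)"
      unfolding Q_def m_def by (intro sum.cong) (auto simp: power2_eq_square algebra_simps)
    also have "\<dots> = (\<Sum>v\<in>C. bary C v x * (g x \<bullet> v) * (g x \<bullet> v - m)) - m * m + m\<^sup>2 * 1"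
      by (simp add: sum.distrib sum_subtractf sum_distrib_left[symmetric] mean bary_sum[OF C] m_def)
    also have "\<dots> = - (\<Sum>v\<in>C. \<psi> v x * (g x \<bullet> (x - v)))"
      by (simp add: power2_eq_square \<psi>_def m_def inner_diff_right sum_negf[symmetric] algebra_simps)
    finally show ?thesis by simp
  qed
  then have "(LINT x:?T|lborel. - Q x) = 0" using int0 by simp
  then have Qint: "(LINT x:?T|lborel. Q x) = 0" by (simp add: set_lebesgue_integral_def)
  have Qc: "continuous_on UNIV Q" unfolding Q_def[abs_def]
    by (intro continuous_intros bary_continuous[OF C] cont)
  have Q0: "0 \<le> Q x" if "x \<in> ?T" for x
    unfolding Q_def using that bary_mem[OF C, of x] by (intro sum_nonneg mult_nonneg_nonneg) auto
  have g0: "g x = 0" if x: "x \<in> interior ?T" for x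
  proof -
    have "Q x = 0" by (rule nonneg_integral_zero_interior[OF T Qc Q0 Qint x])
    have bp: "0 < bary C v x" if "v \<in> C" for v using x that bary_interior[OF C, of x] by blast
    have "\<forall>v\<in>C. bary C v x * (g x \<bullet> v - g x \<bullet> x)\<^sup>2 = 0"
      using \<open>Q x = 0\<close> bp full_simplex_finite[OF C] unfolding Q_def
      by (subst (asm) sum_nonneg_eq_0_iff) (auto simp: less_imp_le)
    then have eq: "g x \<bullet> v = g x \<bullet> x" if "v \<in> C" for v using bp[OF that] that by force
    \<comment> \<open>The inner product with \<open>g x\<close> is constant on the vertices, hence
      on the whole space by the barycentric representation; comparing \<open>x + g x\<close> with
      \<open>x\<close> leaves \<open>g x \<bullet> g x = 0\<close>.\<close>
    have "g x \<bullet> (x + g x) = (\<Sum>v\<in>C. bary C v (x + g x) * (g x \<bullet> v))" by (simp only: mean)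
    also have "\<dots> = (\<Sum>v\<in>C. bary C v (x + g x) * (g x \<bullet> x))" using eq by (intro sum.cong) auto
    also have "\<dots> = g x \<bullet> x" by (simp add: sum_distrib_right[symmetric] bary_sum[OF C])
    finally show ?thesis by (simp add: inner_add_right)
  qed
  have "\<exists>a. \<forall>x\<in>interior ?T. p x = a"
  proof (rule has_derivative_zero_constant)
    show "convex (interior ?T)" by (intro convex_interior convex_convex_hull)
    show "(p has_derivative (\<lambda>h. 0)) (at x within interior ?T)" if "x \<in> interior ?T" for x
    proof (rule has_derivative_at_withinI)
      have "(p has_derivative (\<lambda>h. g x \<bullet> h)) (at x)" using g(1) by (simp add: has_grad_def)
      then show "(p has_derivative (\<lambda>h. 0)) (at x)"
        by (rule has_derivative_eq_rhs) (simp add: fun_eq_iff g0[OF that])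
    qed
  qed
  then obtain a where a: "\<And>x. x \<in> interior ?T \<Longrightarrow> p x = a" by blast
  have "closed {x. p x = a}" by (intro closed_Collect_eq cont continuous_on_const)
  then have "closure (interior ?T) \<subseteq> {x. p x = a}" using a by (intro closure_minimal) auto
  then show ?thesis unfolding full_simplex_closure_interior[OF C] by blast
qed

context fem
begin

lemma RT_bc_Hdiv: "\<beta> \<in> RT_bc m \<Omega> \<tau> \<Gamma> \<Longrightarrow> \<beta> \<in> Hdiv \<Omega>"
  by (simp add: RT_bc_def RT_def)

text \<open>Translates orthogonality to the divergences of all discrete fields into an identity for
  one admissible family of weights.\<close>

lemma orthogonal_cone_sum:
  assumes orth: "\<And>\<beta>. \<beta> \<in> RT_bc (k + 1) \<Omega> \<tau> \<Gamma> \<Longrightarrow> (\<integral>x. u x * weak_div \<Omega> \<beta> x \<partial>lebesgue_on \<Omega>) = 0"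
    and u: "u \<in> L2 \<Omega>"
    and p: "\<And>T. T \<in> \<tau> \<Longrightarrow> p T \<in> poly_space k" "\<And>T. T \<in> \<tau> \<Longrightarrow> AE x in lebesgue_on T. u x = p T x"
    and I: "finite I" and C: "\<And>i. i \<in> I \<Longrightarrow> full_simplex (C i)" "\<And>i. i \<in> I \<Longrightarrow> convex hull (C i) \<in> \<tau>"
      "\<And>i. i \<in> I \<Longrightarrow> v i \<in> C i"
    and \<psi>: "\<And>i. i \<in> I \<Longrightarrow> has_grad (\<psi> i) (g i)" "\<And>i. i \<in> I \<Longrightarrow> \<psi> i \<in> poly_space k"
    and flux: "\<And>\<phi>. \<phi> \<in> test_functions \<Omega> \<Longrightarrow>
      (\<Sum>i\<in>I. cone_flux (C i) (v i) (\<lambda>x. \<phi> x * \<psi> i x) (\<lambda>x. \<phi> x *\<^sub>R g i x + \<psi> i x *\<^sub>R grad \<phi> x)) = 0"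
    and bc: "\<And>i x. i \<in> I \<Longrightarrow> x \<in> rel_interior (convex hull (C i - {v i})) \<Longrightarrow> x \<in> \<Gamma> \<Longrightarrow> x \<notin> \<Omega> \<Longrightarrow> \<psi> i x = 0"
  shows "(\<Sum>i\<in>I. LINT x:convex hull (C i)|lborel. p (convex hull (C i)) x * (real DIM('a) * \<psi> i x + g i x \<bullet> (x - v i))) = 0"
proof -
  let ?\<beta> = "\<lambda>x. \<Sum>i\<in>I. cone_field (C i) (v i) (\<psi> i) x"
  note RT = cone_sum_RT_bc[OF I C \<psi> flux bc]
  have "weak_div \<Omega> ?\<beta> \<in> L2 \<Omega>" using Hdiv_weak_div(1)[OF RT_bc_Hdiv[OF RT(1)]] .
  from cone_sum_integral[OF I C(2) \<psi>(1) poly_space_continuous[OF p(1)] p(2) L2_measurable[OF u] L2_measurable[OF this] RT(2)]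
  show ?thesis using orth[OF RT(1)] by simp
qed

lemma set_integral_const_on:
  assumes "T \<in> \<tau>" "\<And>x. x \<in> T \<Longrightarrow> q x = a"
  shows "(LINT x:T|lborel. q x * (c::real)) = a * c * measure lborel T"
proof -
  have "(LINT x:T|lborel. q x * c) = (LINT x:T|lborel. a * c)"
    using assms mesh_sets(1) by (intro set_lebesgue_integral_cong) auto
  also have "\<dots> = a * c * measure lborel T"
    using mesh_compact[OF assms(1)] mesh_sets(1)[OF assms(1)] by (simp add: set_lebesgue_integral_def)
  finally show ?thesis .
qed

text \<open>The dual form of surjectivity of the divergence onto \<open>DG\<close>: only zero is
  orthogonal to its range. The facet off \<open>\<Gamma>\<close> excludes the nonzero constants,
  which are orthogonal when normal components vanish on the whole boundary.\<close>

lemma div_orthogonal_zero: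
  assumes con: "connected \<Omega>" and F0: "boundary_facet C0 v0"
    and F0\<Gamma>: "\<And>x. x \<in> rel_interior (convex hull (C0 - {v0})) \<Longrightarrow> x \<notin> \<Gamma>"
    and u: "u \<in> DG k \<tau>"
    and orth: "\<And>\<beta>. \<beta> \<in> RT_bc (k + 1) \<Omega> \<tau> \<Gamma> \<Longrightarrow> (\<integral>x. u x * weak_div \<Omega> \<beta> x \<partial>lebesgue_on \<Omega>) = 0"
  shows "AE x in lebesgue_on \<Omega>. u x = 0"
proof -
  obtain p where p: "\<And>T. T \<in> \<tau> \<Longrightarrow> p T \<in> poly_space k" "\<And>T. T \<in> \<tau> \<Longrightarrow> AE x in lebesgue_on T. u x = p T x"
    using DG_rep[OF u] by blast
  have "\<exists>a. \<forall>x\<in>T. p T x = a" if T: "T \<in> \<tau>" for T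
  proof -
    obtain C where C: "full_simplex C" "T = convex hull C" using mesh_vertices[OF T] by blast
    have CT: "convex hull C \<in> \<tau>" using T C by simp
    have "\<exists>a. \<forall>x\<in>convex hull C. p (convex hull C) x = a"
    proof (rule bubble_orthogonal_const[OF C(1) p(1)[OF CT]])
      fix \<psi> g
      assume \<psi>: "\<And>v. v \<in> C \<Longrightarrow> has_grad (\<psi> v) (g v)" "\<And>v. v \<in> C \<Longrightarrow> \<psi> v \<in> poly_space k"
        and zero: "\<And>v x. v \<in> C \<Longrightarrow> x \<in> convex hull (C - {v}) \<Longrightarrow> \<psi> v x = 0"
      show "(\<Sum>v\<in>C. LINT x:convex hull C|lborel. p (convex hull C) x * (real DIM('a) * \<psi> v x + g v x \<bullet> (x - v))) = 0"
      proof (rule orthogonal_cone_sum[OF orth DG_L2[OF u] p, where C = "\<lambda>_. C" and v = "\<lambda>v. v"])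
        fix \<phi> assume "\<phi> \<in> test_functions \<Omega>"
        then show "(\<Sum>v\<in>C. cone_flux C v (\<lambda>x. \<phi> x * \<psi> v x) (\<lambda>x. \<phi> x *\<^sub>R g v x + \<psi> v x *\<^sub>R grad \<phi> x)) = 0"
          using zero by (intro sum.neutral ballI cone_flux_zero C(1) has_grad_mult test_has_grad \<psi>) simp_all
      next
        show "\<psi> v x = 0" if "v \<in> C" "x \<in> rel_interior (convex hull (C - {v}))" for v x
          using zero[OF that(1)] that(2) rel_interior_subset by blast
      qed (use C CT full_simplex_finite \<psi> in auto)
    qed
    then show ?thesis using C(2) by simp
  qed
  then have "\<forall>T\<in>\<tau>. \<exists>a. \<forall>x\<in>T. p T x = a" by blast
  from bchoice[OF this] obtain a where a: "\<And>T x. T \<in> \<tau> \<Longrightarrow> x \<in> T \<Longrightarrow> p T x = a T" by blast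
  have d: "real DIM('a) > 0" by simp
  have adj: "a (convex hull C') = 0"
    if C: "full_simplex C" "convex hull C \<in> \<tau>" "v \<in> C" and C': "full_simplex C'" "convex hull C' \<in> \<tau>" "v' \<in> C'"
      and eq: "C - {v} = C' - {v'}" and ne: "convex hull C \<noteq> convex hull C'" and 0: "a (convex hull C) = 0"
    for C v C' v'
  proof -
    let ?m = "measure lborel (convex hull C)" and ?m' = "measure lborel (convex hull C')"
    have m: "?m > 0" "?m' > 0" using simplex_measure_pos C C' by auto
    \<comment> \<open>Reciprocal volumes with opposite signs make the two fluxes through the common
      facet cancel, by \<open>cone_flux_facet\<close>.\<close>
    define k1 where "k1 = 1 / ?m"
    define k2 where "k2 = - 1 / ?m'"
    define c where "c i = (if i then k1 else k2)" for i
    have "(\<Sum>i\<in>UNIV. LINT x:convex hull (if i then C else C')|lborel.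
        p (convex hull (if i then C else C')) x * (real DIM('a) * c i + 0 \<bullet> (x - (if i then v else v')))) = 0"
    proof (rule orthogonal_cone_sum[OF orth DG_L2[OF u] p])
      fix \<phi> assume "\<phi> \<in> test_functions \<Omega>"
      note \<phi> = test_has_grad[OF this]
      have "(\<Sum>i\<in>UNIV. cone_flux (if i then C else C') (if i then v else v') (\<lambda>x. \<phi> x * c i) (\<lambda>x. \<phi> x *\<^sub>R 0 + c i *\<^sub>R grad \<phi> x))
          = (\<Sum>i\<in>UNIV. c i * cone_flux (if i then C else C') (if i then v else v') \<phi> (grad \<phi>))"
        using C(1) C'(1) by (intro sum.cong refl cone_flux_scale \<phi>) auto
      also have "\<dots> = cone_flux C v \<phi> (grad \<phi>) / ?m - cone_flux C' v' \<phi> (grad \<phi>) / ?m'"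
        by (simp add: UNIV_bool c_def k1_def k2_def)
      also have "\<dots> = 0" using cone_flux_facet[OF C(1,3) C'(1,3) eq \<phi>] by simp
      finally show "(\<Sum>i\<in>UNIV. cone_flux (if i then C else C') (if i then v else v') (\<lambda>x. \<phi> x * c i) (\<lambda>x. \<phi> x *\<^sub>R 0 + c i *\<^sub>R grad \<phi> x)) = 0" .
    next
      fix i x
      assume "x \<in> rel_interior (convex hull ((if i then C else C') - {if i then v else v'}))" "x \<notin> \<Omega>"
      \<comment> \<open>Vacuous: a shared facet has all its relative interior points in
        \<open>\<Omega>\<close>.\<close>
      then show "c i = 0"
        using mesh_facet_interior[OF C(1,2) C'(1,2) C(3) C'(3) eq ne, of x] eq by (cases i) auto
    qed (use C C' has_grad_const poly_space_const in auto)
    then have sum: "(LINT x:convex hull C|lborel. p (convex hull C) x * (real DIM('a) * k1))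
        + (LINT x:convex hull C'|lborel. p (convex hull C') x * (real DIM('a) * k2)) = 0"
      by (simp add: UNIV_bool c_def add.commute)
    have "(LINT x:convex hull C|lborel. p (convex hull C) x * (real DIM('a) * k1))
        = a (convex hull C) * (real DIM('a) * k1) * ?m"
      by (rule set_integral_const_on[OF C(2) a[OF C(2)]])
    moreover have "(LINT x:convex hull C'|lborel. p (convex hull C') x * (real DIM('a) * k2))
        = a (convex hull C') * (real DIM('a) * k2) * ?m'"
      by (rule set_integral_const_on[OF C'(2) a[OF C'(2)]])
    ultimately have "a (convex hull C) * (real DIM('a) * k1) * ?m + a (convex hull C') * (real DIM('a) * k2) * ?m' = 0"
      using sum by presburger
    \<comment> \<open>The divergences are the constants \<open>d * k1\<close> and
      \<open>d * k2\<close>, so the volumes cancel and the identity compares the two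
      constants.\<close>
    then have "a (convex hull C') * real DIM('a) = 0" using 0 m by (simp add: k1_def k2_def)
    then show ?thesis using d by simp
  qed
  have C0: "full_simplex C0" "convex hull C0 \<in> \<tau>" "v0 \<in> C0" using F0 by (auto simp: boundary_facet_def)
  have sum0: "(\<Sum>i\<in>{()}. LINT x:convex hull C0|lborel. p (convex hull C0) x * (real DIM('a) * 1 + 0 \<bullet> (x - v0))) = 0"
  proof (rule orthogonal_cone_sum[OF orth DG_L2[OF u] p, where \<psi> = "\<lambda>_ _. 1"])
    fix \<phi> assume \<phi>: "\<phi> \<in> test_functions \<Omega>"
    \<comment> \<open>Test functions vanish on the frontier, so a boundary facet may carry the
      weight one without producing a flux; the boundary condition does not touch it because its
      relative interior avoids \<open>\<Gamma>\<close>.\<close>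
    have "\<phi> x = 0" if "x \<in> convex hull (C0 - {v0})" for x
    proof (rule ccontr)
      assume "\<phi> x \<noteq> 0"
      then have "x \<in> \<Omega>" using \<phi> closure_subset[of "{x. \<phi> x \<noteq> 0}"] by (auto simp: test_functions_def)
      then show False using that boundary_facet_frontier[OF F0] dom_open by (auto simp: frontier_def interior_open)
    qed
    then have "cone_flux C0 v0 \<phi> (grad \<phi>) = 0" by (intro cone_flux_zero C0 test_has_grad[OF \<phi>])
    then show "(\<Sum>i\<in>{()}. cone_flux C0 v0 (\<lambda>x. \<phi> x * 1) (\<lambda>x. \<phi> x *\<^sub>R 0 + 1 *\<^sub>R grad \<phi> x)) = 0" by simp
  qed (use C0 F0\<Gamma> has_grad_const poly_space_const in auto)
  have "a (convex hull C0) * real DIM('a) * measure lborel (convex hull C0) = 0"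
  proof -
    have "(LINT x:convex hull C0|lborel. p (convex hull C0) x * real DIM('a))
        = a (convex hull C0) * real DIM('a) * measure lborel (convex hull C0)"
      by (rule set_integral_const_on[OF C0(2) a[OF C0(2)]])
    then show ?thesis using sum0 by simp
  qed
  then have a0: "a (convex hull C0) = 0" using d simplex_measure_pos[OF C0(1)] by simp
  have zero: "a T = 0" if "T \<in> \<tau>" for T
    using mesh_connected[OF con C0(2), of "\<lambda>T. a T = 0" T] a0 adj that by blast
  have "AE x in lebesgue_on \<Omega>. \<exists>T\<in>\<tau>. x \<in> T \<and> (\<forall>T'\<in>\<tau>. x \<in> T' \<longleftrightarrow> T' = T) \<and> u x = p T x"
    by (rule AE_mesh) (rule p(2))
  then show ?thesis by eventually_elim (use a zero in auto)
qed

end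

section \<open>Well-posedness\<close>

context fem
begin

lemma RT_bc_L2: "\<beta> \<in> RT_bc m \<Omega> \<tau> \<Gamma> \<Longrightarrow> \<beta> \<in> L2 \<Omega>"
  using RT_bc_Hdiv Hdiv_L2 by blast

section \<open>Linear structure of the discrete spaces\<close>

lemma DG_comb:
  assumes "u \<in> DG k \<tau>" "v \<in> DG k \<tau>"
  shows "(\<lambda>x. a * u x + b * v x) \<in> DG k \<tau>"
  unfolding DG_def
proof (intro CollectI ballI)
  fix T assume T: "T \<in> \<tau>"
  obtain p q where pq: "p \<in> poly_space k" "AE x in lebesgue_on T. u x = p x"
    "q \<in> poly_space k" "AE x in lebesgue_on T. v x = q x"
    using assms T unfolding DG_def by blast
  have "AE x in lebesgue_on T. a * u x + b * v x = a * p x + b * q x"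
    using pq(2,4) by eventually_elim simp
  then show "\<exists>p\<in>poly_space k. AE x in lebesgue_on T. a * u x + b * v x = p x"
    using poly_space_comb[OF pq(1,3)] by (intro bexI[of _ "\<lambda>x. a * p x + b * q x"])
qed

lemma DG_zero: "(\<lambda>x. 0) \<in> DG k \<tau>"
  unfolding DG_def using poly_space_zero by (intro CollectI ballI bexI[of _ "\<lambda>x. 0"]) auto

lemma RT_rep:
  assumes "v \<in> RT_bc (k + 1) \<Omega> \<tau> \<Gamma>" "T \<in> \<tau>"
  shows "\<exists>q. q \<in> RT_poly_space k \<and> (AE x in lebesgue_on T. v x = q x)"
proof -
  have "v \<in> RT (k + 1) \<Omega> \<tau>" using assms(1) by (simp add: RT_bc_def)
  then have "\<exists>q\<in>RT_poly_space (k + 1 - 1). AE x in lebesgue_on T. v x = q x" using assms(2) by (simp add: RT_def)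
  then show ?thesis by auto
qed

lemma RT_bc_normal:
  assumes "v \<in> RT_bc (k + 1) \<Omega> \<tau> \<Gamma>" "T \<in> \<tau>" "q \<in> RT_poly_space k" "AE x in lebesgue_on T. v x = q x"
    "F facet_of T" "x \<in> \<Gamma> \<inter> rel_interior F" "outward_unit_normal \<Omega> x n"
  shows "q x \<bullet> n = 0"
proof -
  have "\<forall>T\<in>\<tau>. \<forall>q\<in>RT_poly_space (k + 1 - 1). (AE x in lebesgue_on T. v x = q x) \<longrightarrow>
          (\<forall>F. F facet_of T \<longrightarrow>
             (\<forall>x\<in>\<Gamma> \<inter> rel_interior F. \<forall>n. outward_unit_normal \<Omega> x n \<longrightarrow> q x \<bullet> n = 0))"
    using assms(1) unfolding RT_bc_def mem_Collect_eq by (rule conjunct2)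
  then show ?thesis using assms(2-) by simp
qed

lemma RT_bc_comb:
  assumes v: "v \<in> RT_bc (k + 1) \<Omega> \<tau> \<Gamma>" "w \<in> RT_bc (k + 1) \<Omega> \<tau> \<Gamma>"
  shows "(\<lambda>x. a *\<^sub>R v x + b *\<^sub>R w x) \<in> RT_bc (k + 1) \<Omega> \<tau> \<Gamma>"
proof -
  have rep: "\<exists>q1 q2. q1 \<in> RT_poly_space k \<and> (AE x in lebesgue_on T. v x = q1 x) \<and>
      q2 \<in> RT_poly_space k \<and> (AE x in lebesgue_on T. w x = q2 x) \<and>
      (AE x in lebesgue_on T. a *\<^sub>R v x + b *\<^sub>R w x = a *\<^sub>R q1 x + b *\<^sub>R q2 x)" if T: "T \<in> \<tau>" for T
  proof -
    obtain q1 where q1: "q1 \<in> RT_poly_space k" "AE x in lebesgue_on T. v x = q1 x" using RT_rep[OF v(1) T] by blast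
    obtain q2 where q2: "q2 \<in> RT_poly_space k" "AE x in lebesgue_on T. w x = q2 x" using RT_rep[OF v(2) T] by blast
    have "AE x in lebesgue_on T. a *\<^sub>R v x + b *\<^sub>R w x = a *\<^sub>R q1 x + b *\<^sub>R q2 x"
      using q1(2) q2(2) by eventually_elim simp
    then show ?thesis using q1 q2 by blast
  qed
  have RT: "(\<lambda>x. a *\<^sub>R v x + b *\<^sub>R w x) \<in> RT (k + 1) \<Omega> \<tau>"
    unfolding RT_def mem_Collect_eq
  proof (intro conjI ballI)
    show "(\<lambda>x. a *\<^sub>R v x + b *\<^sub>R w x) \<in> Hdiv \<Omega>" using v by (intro Hdiv_comb RT_bc_Hdiv)
    fix T assume "T \<in> \<tau>"
    from rep[OF this] obtain q1 q2 where q: "q1 \<in> RT_poly_space k" "q2 \<in> RT_poly_space k"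
      "AE x in lebesgue_on T. a *\<^sub>R v x + b *\<^sub>R w x = a *\<^sub>R q1 x + b *\<^sub>R q2 x" by blast
    then show "\<exists>q\<in>RT_poly_space (k + 1 - 1). AE x in lebesgue_on T. a *\<^sub>R v x + b *\<^sub>R w x = q x"
      using RT_poly_space_comb[OF q(1,2)] by (intro bexI[of _ "\<lambda>x. a *\<^sub>R q1 x + b *\<^sub>R q2 x"]) simp_all
  qed
  show ?thesis
    unfolding RT_bc_def mem_Collect_eq
  proof (intro conjI RT ballI impI allI)
    fix T q F x n
    assume T: "T \<in> \<tau>" and q: "q \<in> RT_poly_space (k + 1 - 1)" and ae: "AE x in lebesgue_on T. a *\<^sub>R v x + b *\<^sub>R w x = q x"
      and F: "F facet_of T" and x: "x \<in> \<Gamma> \<inter> rel_interior F" and n: "outward_unit_normal \<Omega> x n"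
    from rep[OF T] obtain q1 q2 where q12: "q1 \<in> RT_poly_space k" "AE x in lebesgue_on T. v x = q1 x"
      "q2 \<in> RT_poly_space k" "AE x in lebesgue_on T. w x = q2 x"
      "AE x in lebesgue_on T. a *\<^sub>R v x + b *\<^sub>R w x = a *\<^sub>R q1 x + b *\<^sub>R q2 x" by blast
    have "AE x in lebesgue_on T. q x = a *\<^sub>R q1 x + b *\<^sub>R q2 x" using ae q12(5) by eventually_elim simp
    moreover have "x \<in> T" using x facet_of_imp_subset[OF F] rel_interior_subset by blast
    ultimately have "q x = a *\<^sub>R q1 x + b *\<^sub>R q2 x"
      by (intro AE_eq_on[OF T RT_poly_space_continuous[OF q] RT_poly_space_continuous[OF RT_poly_space_comb[OF q12(1,3)]]])
    then show "q x \<bullet> n = 0"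
      using RT_bc_normal[OF v(1) T q12(1,2) F x n] RT_bc_normal[OF v(2) T q12(3,4) F x n]
      by (simp add: inner_add_left)
  qed
qed

lemma zero_RT_bc: "(\<lambda>x. 0) \<in> RT_bc (k + 1) \<Omega> \<tau> \<Gamma>"
  using cone_sum_RT_bc(1)[of "{}" _ _ _ _ k \<Gamma>] by simp

text \<open>Supplies the separating functionals: vanishing moments on \<open>T\<close> make the
  integral of the square of \<open>p T\<close> vanish.\<close>

lemma piecewise_poly_moments:
  fixes u :: "'a \<Rightarrow> real"
  assumes p: "\<And>T. T \<in> \<tau> \<Longrightarrow> p T \<in> poly_space k" "\<And>T. T \<in> \<tau> \<Longrightarrow> AE x in lebesgue_on T. u x = p T x"
    and 0: "\<And>T m. T \<in> \<tau> \<Longrightarrow> m \<in> multi_indices k \<Longrightarrow> (\<integral>x. u x * pw T (monomial_fun m) x \<partial>lebesgue_on \<Omega>) = 0"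
  shows "AE x in lebesgue_on \<Omega>. u x = 0"
proof -
  have uL: "u \<in> L2 \<Omega>" by (rule piecewise_L2[OF poly_space_continuous[OF p(1)] p(2)])
  have mc: "continuous_on UNIV (monomial_fun m)" if "m \<in> multi_indices k" for m
    using poly_space_continuous[OF monomial_in_poly_space[OF that]] .
  have zero: "p T x = 0" if T: "T \<in> \<tau>" and x: "x \<in> interior T" for T x
  proof -
    obtain c where c: "\<And>x. p T x = (\<Sum>m\<in>multi_indices k. c m * monomial_fun m x)"
      using p(1)[OF T] by (auto simp: poly_space_alt)
    have pc: "continuous_on UNIV (p T)" by (rule poly_space_continuous[OF p(1)[OF T]])
    have L: "pw T (monomial_fun m) \<in> L2 \<Omega>" if "m \<in> multi_indices k" for m by (rule pw_L2[OF T mc[OF that]])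
    \<comment> \<open>The coefficients of \<open>p T\<close> itself combine the moments.\<close>
    have "0 = (\<Sum>m\<in>multi_indices k. c m * (\<integral>x. u x * pw T (monomial_fun m) x \<partial>lebesgue_on \<Omega>))"
      using 0[OF T] by simp
    also have "\<dots> = (\<integral>x. (\<Sum>m\<in>multi_indices k. c m * (u x * pw T (monomial_fun m) x)) \<partial>lebesgue_on \<Omega>)"
      using L2_mult_integrable[OF uL L] by (subst Bochner_Integration.integral_sum) auto
    also have "\<dots> = (\<integral>x. u x * pw T (p T) x \<partial>lebesgue_on \<Omega>)"
      by (intro Bochner_Integration.integral_cong refl)
        (simp add: pw_def c sum_distrib_left algebra_simps)
    also have "\<dots> = (\<integral>x. pw T (\<lambda>x. p T x * p T x) x \<partial>lebesgue_on \<Omega>)"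
    proof (rule integral_cong_AE)
      show "(\<lambda>x. u x * pw T (p T) x) \<in> borel_measurable (lebesgue_on \<Omega>)"
        by (intro borel_measurable_times L2_measurable[OF uL] L2_measurable[OF pw_L2[OF T pc]])
      show "pw T (\<lambda>x. p T x * p T x) \<in> borel_measurable (lebesgue_on \<Omega>)"
        by (intro L2_measurable[OF pw_L2[OF T]] continuous_on_mult pc)
      have "AE x in lebesgue_on \<Omega>. \<exists>T\<in>\<tau>. x \<in> T \<and> (\<forall>T'\<in>\<tau>. x \<in> T' \<longleftrightarrow> T' = T) \<and> u x = p T x"
        by (rule AE_mesh) (rule p(2))
      then show "AE x in lebesgue_on \<Omega>. u x * pw T (p T) x = pw T (\<lambda>x. p T x * p T x) x"
      proof eventually_elim
        case (elim x)
        then obtain S where S: "\<And>T'. T' \<in> \<tau> \<Longrightarrow> x \<in> T' \<longleftrightarrow> T' = S" "u x = p S x" by blast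
        show ?case
        proof (cases "x \<in> T")
          case True
          then show ?thesis using S(1)[OF T] S(2) by (simp add: pw_def)
        qed (simp add: pw_def)
      qed
    qed
    also have "\<dots> = (LINT x:T|lborel. p T x * p T x)"
      by (intro pw_integral T continuous_on_mult pc)
    finally have "(LINT x:T|lborel. p T x * p T x) = 0" by simp
    then have "p T x * p T x = 0"
      using nonneg_integral_zero_interior[OF mesh_compact[OF T], of "\<lambda>x. p T x * p T x" x] pc x
      by (auto intro: continuous_on_mult)
    then show ?thesis by simp
  qed
  have "AE x in lebesgue_on \<Omega>. \<exists>T\<in>\<tau>. x \<in> T \<and> (\<forall>T'\<in>\<tau>. x \<in> T' \<longleftrightarrow> T' = T) \<and> u x = p T x"
    by (rule AE_mesh) (rule p(2))
  then show ?thesis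
  proof eventually_elim
    case (elim x)
    then obtain T where T: "T \<in> \<tau>" "x \<in> T" "u x = p T x" by blast
    have "p T x = 0"
      by (rule closure_eq_on[OF T(1) poly_space_continuous[OF p(1)[OF T(1)]] continuous_on_const zero[OF T(1)] T(2)])
    then show ?case using T(3) by simp
  qed
qed

text \<open>The factor \<open>x\<close> in the local space raises the degree of the components to
  \<open>k + 1\<close>, hence moments up to \<open>Suc k\<close>.\<close>

lemma RT_component_moments:
  assumes v: "v \<in> RT_bc (k + 1) \<Omega> \<tau> \<Gamma>"
    and 0: "\<And>b T m. b \<in> Basis \<Longrightarrow> T \<in> \<tau> \<Longrightarrow> m \<in> multi_indices (Suc k) \<Longrightarrow>
      (\<integral>x. (v x \<bullet> b) * pw T (monomial_fun m) x \<partial>lebesgue_on \<Omega>) = 0"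
  shows "AE x in lebesgue_on \<Omega>. v x = 0"
proof -
  have "\<forall>T\<in>\<tau>. \<exists>q. q \<in> RT_poly_space k \<and> (AE x in lebesgue_on T. v x = q x)"
    using RT_rep[OF v] by blast
  from bchoice[OF this] obtain q where q: "\<And>T. T \<in> \<tau> \<Longrightarrow> q T \<in> RT_poly_space k"
    "\<And>T. T \<in> \<tau> \<Longrightarrow> AE x in lebesgue_on T. v x = q T x" by blast
  have "AE x in lebesgue_on \<Omega>. v x \<bullet> b = 0" if b: "b \<in> Basis" for b
  proof (rule piecewise_poly_moments[of "\<lambda>T x. q T x \<bullet> b" "Suc k"])
    show "(\<lambda>x. q T x \<bullet> b) \<in> poly_space (Suc k)" if "T \<in> \<tau>" for T
      by (rule RT_poly_space_inner[OF q(1)[OF that]])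
    show "AE x in lebesgue_on T. v x \<bullet> b = q T x \<bullet> b" if "T \<in> \<tau>" for T
      using q(2)[OF that] by eventually_elim simp
    show "(\<integral>x. (v x \<bullet> b) * pw T (monomial_fun m) x \<partial>lebesgue_on \<Omega>) = 0"
      if "T \<in> \<tau>" "m \<in> multi_indices (Suc k)" for T m by (rule 0[OF b that])
  qed
  then have "AE x in lebesgue_on \<Omega>. \<forall>b\<in>Basis. v x \<bullet> b = 0"
    by (intro AE_finite_allI) auto
  then show ?thesis by eventually_elim (simp add: euclidean_eq_iff[where 'a = 'a])
qed

text \<open>A triple \<open>(u, v, \<alpha>)\<close> is encoded as one function into a product, so that
  \<open>symmetric_form_solvable\<close> applies.\<close>

definition trial :: "nat \<Rightarrow> 'a set \<Rightarrow> ('a \<Rightarrow> real \<times> 'a \<times> 'a) set" where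
  "trial k \<Gamma> = {w. (\<lambda>x. fst (w x)) \<in> DG k \<tau> \<and> (\<lambda>x. fst (snd (w x))) \<in> RT_bc (k + 1) \<Omega> \<tau> \<Gamma> \<and>
    (\<lambda>x. snd (snd (w x))) \<in> RT_bc (k + 1) \<Omega> \<tau> \<Gamma>}"

text \<open>The sum of the left-hand sides of both equations. Adding them makes the system one
  symmetric form.\<close>

definition saddle :: "real \<Rightarrow> real \<Rightarrow> ('a \<Rightarrow> real \<times> 'a \<times> 'a) \<Rightarrow> ('a \<Rightarrow> real \<times> 'a \<times> 'a) \<Rightarrow> real" where
  "saddle c0 c1 w z =
     form_a \<Omega> c0 c1 (\<lambda>x. fst (w x), \<lambda>x. fst (snd (w x))) (\<lambda>x. fst (z x), \<lambda>x. fst (snd (z x)))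
     + form_b \<Omega> (\<lambda>x. fst (z x), \<lambda>x. fst (snd (z x))) (\<lambda>x. snd (snd (w x)))
     + form_b \<Omega> (\<lambda>x. fst (w x), \<lambda>x. fst (snd (w x))) (\<lambda>x. snd (snd (z x)))"

lemma saddle_sym: "saddle c0 c1 w z = saddle c0 c1 z w"
  by (simp add: saddle_def form_a_def inner_commute mult.commute)

lemma trialI:
  "u \<in> DG k \<tau> \<Longrightarrow> v \<in> RT_bc (k + 1) \<Omega> \<tau> \<Gamma> \<Longrightarrow> \<alpha> \<in> RT_bc (k + 1) \<Omega> \<tau> \<Gamma> \<Longrightarrow> (\<lambda>x. (u x, v x, \<alpha> x)) \<in> trial k \<Gamma>"
  by (simp add: trial_def)

lemma trialD:
  assumes "w \<in> trial k \<Gamma>"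
  shows "(\<lambda>x. fst (w x)) \<in> DG k \<tau>" "(\<lambda>x. fst (snd (w x))) \<in> RT_bc (k + 1) \<Omega> \<tau> \<Gamma>"
    "(\<lambda>x. snd (snd (w x))) \<in> RT_bc (k + 1) \<Omega> \<tau> \<Gamma>"
  using assms unfolding trial_def by auto

lemma trial_lin_closed: "lin_closed (trial k \<Gamma>)"
  unfolding lin_closed_def
proof (intro conjI ballI allI)
  have "(\<lambda>x. (0, 0, 0)) \<in> trial k \<Gamma>" by (intro trialI DG_zero zero_RT_bc)
  then show "trial k \<Gamma> \<noteq> {}" by blast
  fix w z a b assume "w \<in> trial k \<Gamma>" "z \<in> trial k \<Gamma>"
  note w = trialD[OF this(1)] and z = trialD[OF this(2)]
  show "(\<lambda>x. a *\<^sub>R w x + b *\<^sub>R z x) \<in> trial k \<Gamma>"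
    using DG_comb[OF w(1) z(1)] RT_bc_comb[OF w(2) z(2)] RT_bc_comb[OF w(3) z(3)] by (simp add: trial_def)
qed

section \<open>Bilinearity of the forms on the discrete spaces\<close>

lemma form_b_lin1:
  assumes "u \<in> DG k \<tau>" "u' \<in> DG k \<tau>" "v \<in> RT_bc (k + 1) \<Omega> \<tau> \<Gamma>" "v' \<in> RT_bc (k + 1) \<Omega> \<tau> \<Gamma>"
    "\<beta> \<in> RT_bc (k + 1) \<Omega> \<tau> \<Gamma>"
  shows "form_b \<Omega> (\<lambda>x. a * u x + b * u' x, \<lambda>x. a *\<^sub>R v x + b *\<^sub>R v' x) \<beta>
    = a * form_b \<Omega> (u, v) \<beta> + b * form_b \<Omega> (u', v') \<beta>"
proof -
  note i = L2_inner_integrable[OF RT_bc_L2[OF assms(5)] RT_bc_L2[OF assms(3)]]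
    L2_inner_integrable[OF RT_bc_L2[OF assms(5)] RT_bc_L2[OF assms(4)]]
    L2_mult_integrable[OF DG_L2[OF assms(1)] Hdiv_weak_div(1)[OF RT_bc_Hdiv[OF assms(5)]]]
    L2_mult_integrable[OF DG_L2[OF assms(2)] Hdiv_weak_div(1)[OF RT_bc_Hdiv[OF assms(5)]]]
  have "form_b \<Omega> (\<lambda>x. a * u x + b * u' x, \<lambda>x. a *\<^sub>R v x + b *\<^sub>R v' x) \<beta>
      = (\<integral>x. a * (\<beta> x \<bullet> v x + u x * weak_div \<Omega> \<beta> x) + b * (\<beta> x \<bullet> v' x + u' x * weak_div \<Omega> \<beta> x) \<partial>lebesgue_on \<Omega>)"
    unfolding form_b_def case_prod_conv
    by (intro Bochner_Integration.integral_cong refl) (simp add: inner_add_right algebra_simps)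
  also have "\<dots> = a * form_b \<Omega> (u, v) \<beta> + b * form_b \<Omega> (u', v') \<beta>"
    unfolding form_b_def case_prod_conv using i by simp
  finally show ?thesis .
qed

lemma form_b_lin2:
  assumes "u \<in> DG k \<tau>" "v \<in> RT_bc (k + 1) \<Omega> \<tau> \<Gamma>" "\<beta> \<in> RT_bc (k + 1) \<Omega> \<tau> \<Gamma>" "\<beta>' \<in> RT_bc (k + 1) \<Omega> \<tau> \<Gamma>"
  shows "form_b \<Omega> (u, v) (\<lambda>x. a *\<^sub>R \<beta> x + b *\<^sub>R \<beta>' x) = a * form_b \<Omega> (u, v) \<beta> + b * form_b \<Omega> (u, v) \<beta>'"
proof -
  note i = L2_inner_integrable[OF RT_bc_L2[OF assms(3)] RT_bc_L2[OF assms(2)]]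
    L2_inner_integrable[OF RT_bc_L2[OF assms(4)] RT_bc_L2[OF assms(2)]]
    L2_mult_integrable[OF DG_L2[OF assms(1)] Hdiv_weak_div(1)[OF RT_bc_Hdiv[OF assms(3)]]]
    L2_mult_integrable[OF DG_L2[OF assms(1)] Hdiv_weak_div(1)[OF RT_bc_Hdiv[OF assms(4)]]]
  let ?c = "\<lambda>x. a *\<^sub>R \<beta> x + b *\<^sub>R \<beta>' x"
  have c: "?c \<in> RT_bc (k + 1) \<Omega> \<tau> \<Gamma>" by (rule RT_bc_comb[OF assms(3,4)])
  have "AE x in lebesgue_on \<Omega>. ?c x \<bullet> v x + u x * weak_div \<Omega> ?c x
      = a * (\<beta> x \<bullet> v x + u x * weak_div \<Omega> \<beta> x) + b * (\<beta>' x \<bullet> v x + u x * weak_div \<Omega> \<beta>' x)"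
    using Hdiv_comb(2)[OF RT_bc_Hdiv[OF assms(3)] RT_bc_Hdiv[OF assms(4)], of a b]
    by eventually_elim (simp add: inner_add_left algebra_simps)
  then have "form_b \<Omega> (u, v) ?c
      = (\<integral>x. a * (\<beta> x \<bullet> v x + u x * weak_div \<Omega> \<beta> x) + b * (\<beta>' x \<bullet> v x + u x * weak_div \<Omega> \<beta>' x) \<partial>lebesgue_on \<Omega>)"
    unfolding form_b_def case_prod_conv
    by (intro integral_cong_AE borel_measurable_add borel_measurable_times borel_measurable_inner borel_measurable_const
        L2_measurable[OF RT_bc_L2[OF c]] L2_measurable[OF RT_bc_L2[OF assms(2)]] L2_measurable[OF DG_L2[OF assms(1)]]
        L2_measurable[OF RT_bc_L2[OF assms(3)]] L2_measurable[OF RT_bc_L2[OF assms(4)]]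
        L2_measurable[OF Hdiv_weak_div(1)[OF RT_bc_Hdiv[OF c]]]
        L2_measurable[OF Hdiv_weak_div(1)[OF RT_bc_Hdiv[OF assms(3)]]]
        L2_measurable[OF Hdiv_weak_div(1)[OF RT_bc_Hdiv[OF assms(4)]]])
  also have "\<dots> = a * form_b \<Omega> (u, v) \<beta> + b * form_b \<Omega> (u, v) \<beta>'"
    unfolding form_b_def case_prod_conv using i by simp
  finally show ?thesis .
qed

lemma form_a_lin:
  assumes "u \<in> DG k \<tau>" "v \<in> RT_bc (k + 1) \<Omega> \<tau> \<Gamma>" "\<phi> \<in> DG k \<tau>" "\<phi>' \<in> DG k \<tau>"
    "\<psi> \<in> RT_bc (k + 1) \<Omega> \<tau> \<Gamma>" "\<psi>' \<in> RT_bc (k + 1) \<Omega> \<tau> \<Gamma>"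
  shows "form_a \<Omega> c0 c1 (u, v) (\<lambda>x. a * \<phi> x + b * \<phi>' x, \<lambda>x. a *\<^sub>R \<psi> x + b *\<^sub>R \<psi>' x)
    = a * form_a \<Omega> c0 c1 (u, v) (\<phi>, \<psi>) + b * form_a \<Omega> c0 c1 (u, v) (\<phi>', \<psi>')"
proof -
  note D = Hdiv_weak_div(1)[OF RT_bc_Hdiv]
  let ?c = "\<lambda>x. a *\<^sub>R \<psi> x + b *\<^sub>R \<psi>' x"
  have c: "?c \<in> RT_bc (k + 1) \<Omega> \<tau> \<Gamma>" by (rule RT_bc_comb[OF assms(5,6)])
  have 1: "(\<integral>x. v x \<bullet> ?c x \<partial>lebesgue_on \<Omega>) = a * (\<integral>x. v x \<bullet> \<psi> x \<partial>lebesgue_on \<Omega>) + b * (\<integral>x. v x \<bullet> \<psi>' x \<partial>lebesgue_on \<Omega>)"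
    using L2_inner_integrable[OF RT_bc_L2[OF assms(2)] RT_bc_L2[OF assms(5)]]
      L2_inner_integrable[OF RT_bc_L2[OF assms(2)] RT_bc_L2[OF assms(6)]]
    by (simp add: inner_add_right)
  have 2: "(\<integral>x. u x * (a * \<phi> x + b * \<phi>' x) \<partial>lebesgue_on \<Omega>)
      = a * (\<integral>x. u x * \<phi> x \<partial>lebesgue_on \<Omega>) + b * (\<integral>x. u x * \<phi>' x \<partial>lebesgue_on \<Omega>)"
  proof -
    have "(\<integral>x. u x * (a * \<phi> x + b * \<phi>' x) \<partial>lebesgue_on \<Omega>) = (\<integral>x. a * (u x * \<phi> x) + b * (u x * \<phi>' x) \<partial>lebesgue_on \<Omega>)"
      by (intro Bochner_Integration.integral_cong refl) (simp add: algebra_simps)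
    then show ?thesis
      using L2_mult_integrable[OF DG_L2[OF assms(1)] DG_L2[OF assms(3)]] L2_mult_integrable[OF DG_L2[OF assms(1)] DG_L2[OF assms(4)]]
      by simp
  qed
  have "AE x in lebesgue_on \<Omega>. weak_div \<Omega> v x * weak_div \<Omega> ?c x
      = a * (weak_div \<Omega> v x * weak_div \<Omega> \<psi> x) + b * (weak_div \<Omega> v x * weak_div \<Omega> \<psi>' x)"
    using Hdiv_comb(2)[OF RT_bc_Hdiv[OF assms(5)] RT_bc_Hdiv[OF assms(6)], of a b]
    by eventually_elim (simp add: algebra_simps)
  then have "(\<integral>x. weak_div \<Omega> v x * weak_div \<Omega> ?c x \<partial>lebesgue_on \<Omega>)
      = (\<integral>x. a * (weak_div \<Omega> v x * weak_div \<Omega> \<psi> x) + b * (weak_div \<Omega> v x * weak_div \<Omega> \<psi>' x) \<partial>lebesgue_on \<Omega>)"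
    by (intro integral_cong_AE borel_measurable_add borel_measurable_times borel_measurable_const
        L2_measurable[OF D[OF c]] L2_measurable[OF D[OF assms(2)]] L2_measurable[OF D[OF assms(5)]] L2_measurable[OF D[OF assms(6)]])
  also have "\<dots> = a * (\<integral>x. weak_div \<Omega> v x * weak_div \<Omega> \<psi> x \<partial>lebesgue_on \<Omega>)
      + b * (\<integral>x. weak_div \<Omega> v x * weak_div \<Omega> \<psi>' x \<partial>lebesgue_on \<Omega>)"
    using L2_mult_integrable[OF D[OF assms(2)] D[OF assms(5)]] L2_mult_integrable[OF D[OF assms(2)] D[OF assms(6)]] by simp
  finally show ?thesis unfolding form_a_def case_prod_conv 1 2 by (simp add: algebra_simps)
qed

lemma saddle_lin:
  assumes w: "w \<in> trial k \<Gamma>"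
  shows "lin_on (trial k \<Gamma>) (saddle c0 c1 w)"
  unfolding lin_on_def
proof (intro ballI allI)
  fix y z a b assume "y \<in> trial k \<Gamma>" "z \<in> trial k \<Gamma>"
  note w = trialD[OF w] and y = trialD[OF this(1)] and z = trialD[OF this(2)]
  show "saddle c0 c1 w (\<lambda>x. a *\<^sub>R y x + b *\<^sub>R z x) = a * saddle c0 c1 w y + b * saddle c0 c1 w z"
    using form_a_lin[OF w(1,2) y(1) z(1) y(2) z(2), of c0 c1 a b] form_b_lin1[OF y(1) z(1) y(2) z(2) w(3), of a b]
      form_b_lin2[OF w(1,2) y(3) z(3), of a b]
    by (simp add: saddle_def algebra_simps)
qed

lemma form_b_null:
  assumes "\<beta> \<in> RT_bc (k + 1) \<Omega> \<tau> \<Gamma>"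
    and "(AE x in lebesgue_on \<Omega>. u x = 0 \<and> v x = 0) \<or> (AE x in lebesgue_on \<Omega>. \<beta> x = 0)"
  shows "form_b \<Omega> (u, v) \<beta> = 0"
proof -
  have "AE x in lebesgue_on \<Omega>. \<beta> x \<bullet> v x + u x * weak_div \<Omega> \<beta> x = 0"
    using assms(2)
  proof
    assume "AE x in lebesgue_on \<Omega>. u x = 0 \<and> v x = 0"
    then show ?thesis by eventually_elim simp
  next
    assume b: "AE x in lebesgue_on \<Omega>. \<beta> x = 0"
    show ?thesis using b weak_div_null[OF RT_bc_Hdiv[OF assms(1)] b] by eventually_elim simp
  qed
  then show ?thesis unfolding form_b_def case_prod_conv by (rule integral_eq_zero_AE)
qed

lemma form_a_null:
  assumes "\<psi> \<in> RT_bc (k + 1) \<Omega> \<tau> \<Gamma>" and 0: "AE x in lebesgue_on \<Omega>. \<phi> x = 0 \<and> \<psi> x = 0"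
  shows "form_a \<Omega> c0 c1 (u, v) (\<phi>, \<psi>) = 0"
proof -
  have "AE x in lebesgue_on \<Omega>. \<psi> x = 0" using 0 by eventually_elim simp
  from weak_div_null[OF RT_bc_Hdiv[OF assms(1)] this]
  have "AE x in lebesgue_on \<Omega>. weak_div \<Omega> v x * weak_div \<Omega> \<psi> x = 0" by eventually_elim simp
  moreover have "AE x in lebesgue_on \<Omega>. v x \<bullet> \<psi> x = 0" "AE x in lebesgue_on \<Omega>. u x * \<phi> x = 0"
    using 0 by (eventually_elim, simp)+
  ultimately show ?thesis unfolding form_a_def case_prod_conv by (simp add: integral_eq_zero_AE)
qed

lemma saddle_null:
  assumes "z \<in> trial k \<Gamma>" "w \<in> trial k \<Gamma>" "AE x in lebesgue_on \<Omega>. z x = 0"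
  shows "saddle c0 c1 w z = 0"
proof -
  have 1: "AE x in lebesgue_on \<Omega>. fst (z x) = 0 \<and> fst (snd (z x)) = 0" using assms(3) by eventually_elim simp
  have 2: "AE x in lebesgue_on \<Omega>. snd (snd (z x)) = 0" using assms(3) by eventually_elim simp
  show ?thesis unfolding saddle_def
    using form_a_null[OF trialD(2)[OF assms(1)] 1] form_b_null[OF trialD(3)[OF assms(2)], of "\<lambda>x. fst (z x)" "\<lambda>x. fst (snd (z x))"]
      form_b_null[OF trialD(3)[OF assms(1)]] 1 2 by simp
qed

text \<open>Test triples with zero entries recover the two equations from their sum; the value of
  \<open>f\<close> at zero enters when only the third entry is tested.\<close>

lemma discrete_solution_iff:
  assumes f: "f (\<lambda>x. 0) = 0"
  shows "discrete_solution \<Omega> \<tau> \<Gamma> k c0 c1 f u v \<alpha> \<longleftrightarrow>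
    (\<lambda>x. (u x, v x, \<alpha> x)) \<in> trial k \<Gamma> \<and>
    (\<forall>z\<in>trial k \<Gamma>. saddle c0 c1 (\<lambda>x. (u x, v x, \<alpha> x)) z = f (\<lambda>x. fst (z x)))" (is "?L \<longleftrightarrow> ?R")
proof
  assume L: ?L
  then have m: "u \<in> DG k \<tau>" "v \<in> RT_bc (k + 1) \<Omega> \<tau> \<Gamma>" "\<alpha> \<in> RT_bc (k + 1) \<Omega> \<tau> \<Gamma>"
    and e: "\<And>\<phi> \<psi>. \<phi> \<in> DG k \<tau> \<Longrightarrow> \<psi> \<in> RT_bc (k + 1) \<Omega> \<tau> \<Gamma> \<Longrightarrow>
        form_a \<Omega> c0 c1 (u, v) (\<phi>, \<psi>) + form_b \<Omega> (\<phi>, \<psi>) \<alpha> = f \<phi>"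
      "\<And>\<beta>. \<beta> \<in> RT_bc (k + 1) \<Omega> \<tau> \<Gamma> \<Longrightarrow> form_b \<Omega> (u, v) \<beta> = 0"
    unfolding discrete_solution_def by blast+
  show ?R
  proof (intro conjI trialI m ballI)
    fix z assume "z \<in> trial k \<Gamma>"
    note z = trialD[OF this]
    show "saddle c0 c1 (\<lambda>x. (u x, v x, \<alpha> x)) z = f (\<lambda>x. fst (z x))"
      using e(1)[OF z(1,2)] e(2)[OF z(3)] by (simp add: saddle_def)
  qed
next
  assume R: ?R
  then have m: "u \<in> DG k \<tau>" "v \<in> RT_bc (k + 1) \<Omega> \<tau> \<Gamma>" "\<alpha> \<in> RT_bc (k + 1) \<Omega> \<tau> \<Gamma>"
    by (auto simp: trial_def)
  have e: "form_a \<Omega> c0 c1 (u, v) (\<phi>, \<psi>) + form_b \<Omega> (\<phi>, \<psi>) \<alpha> + form_b \<Omega> (u, v) \<beta> = f \<phi>"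
    if "\<phi> \<in> DG k \<tau>" "\<psi> \<in> RT_bc (k + 1) \<Omega> \<tau> \<Gamma>" "\<beta> \<in> RT_bc (k + 1) \<Omega> \<tau> \<Gamma>" for \<phi> \<psi> \<beta>
    using bspec[OF conjunct2[OF R] trialI[OF that]] by (simp add: saddle_def)
  show ?L
    unfolding discrete_solution_def
  proof (intro conjI ballI m)
    fix \<phi> \<psi> assume h: "\<phi> \<in> DG k \<tau>" "\<psi> \<in> RT_bc (k + 1) \<Omega> \<tau> \<Gamma>"
    show "form_a \<Omega> c0 c1 (u, v) (\<phi>, \<psi>) + form_b \<Omega> (\<phi>, \<psi>) \<alpha> = f \<phi>"
      using e[OF h zero_RT_bc] form_b_null[OF zero_RT_bc, of u v] by simp
  next
    fix \<beta> assume h: "\<beta> \<in> RT_bc (k + 1) \<Omega> \<tau> \<Gamma>"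
    show "form_b \<Omega> (u, v) \<beta> = 0"
      using e[OF DG_zero zero_RT_bc h] f form_a_null[OF zero_RT_bc, of "\<lambda>x. 0" c0 c1 u v]
        form_b_null[OF m(3), of "\<lambda>x. 0" "\<lambda>x. 0"] by simp
  qed
qed

section \<open>Nondegeneracy and solvability\<close>

lemma square_integral_zero:
  fixes v :: "'a \<Rightarrow> 'b::euclidean_space"
  assumes "v \<in> L2 \<Omega>" "(\<integral>x. v x \<bullet> v x \<partial>lebesgue_on \<Omega>) = 0"
  shows "AE x in lebesgue_on \<Omega>. v x = 0"
proof -
  have "AE x in lebesgue_on \<Omega>. v x \<bullet> v x = 0"
    using assms L2_inner_integrable[OF assms(1,1)] integral_nonneg_eq_0_iff_AE[of "lebesgue_on \<Omega>" "\<lambda>x. v x \<bullet> v x"]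
    by simp
  then show ?thesis by eventually_elim simp
qed

text \<open>Testing with the field itself leaves its squared norm, because the product of
  \<open>u\<close> with the divergence vanishes in either case. The two alternatives serve
  \<open>v\<close>, which is free of divergence, and \<open>\<alpha>\<close>, which is paired with
  zero.\<close>

lemma form_b_self:
  assumes v: "v \<in> RT_bc (k + 1) \<Omega> \<tau> \<Gamma>" and b: "form_b \<Omega> (u, v) v = 0"
    and 0: "(AE x in lebesgue_on \<Omega>. u x = 0) \<or> (AE x in lebesgue_on \<Omega>. weak_div \<Omega> v x = 0)"
    and u: "u \<in> L2 \<Omega>"
  shows "AE x in lebesgue_on \<Omega>. v x = 0"
proof (rule square_integral_zero[OF RT_bc_L2[OF v]])
  have "AE x in lebesgue_on \<Omega>. u x * weak_div \<Omega> v x = 0"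
    using 0
  proof
    assume "AE x in lebesgue_on \<Omega>. u x = 0"
    then show ?thesis by eventually_elim simp
  next
    assume "AE x in lebesgue_on \<Omega>. weak_div \<Omega> v x = 0"
    then show ?thesis by eventually_elim simp
  qed
  then have "(\<integral>x. u x * weak_div \<Omega> v x \<partial>lebesgue_on \<Omega>) = 0" by (rule integral_eq_zero_AE)
  then show "(\<integral>x. v x \<bullet> v x \<partial>lebesgue_on \<Omega>) = 0"
    using b L2_inner_integrable[OF RT_bc_L2[OF v] RT_bc_L2[OF v]]
      L2_mult_integrable[OF u Hdiv_weak_div(1)[OF RT_bc_Hdiv[OF v]]]
    unfolding form_b_def case_prod_conv by (simp add: Bochner_Integration.integral_add)
qed

lemma saddle_nondegenerate:
  assumes con: "connected \<Omega>" and c0: "c0 \<ge> 0" and c1: "c1 \<ge> 0"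
    and F0: "c1 = 0 \<Longrightarrow> \<exists>C0 v0. boundary_facet C0 v0 \<and> (\<forall>x\<in>rel_interior (convex hull (C0 - {v0})). x \<notin> \<Gamma>)"
    and w: "w \<in> trial k \<Gamma>" and 0: "\<And>z. z \<in> trial k \<Gamma> \<Longrightarrow> saddle c0 c1 w z = 0"
  shows "AE x in lebesgue_on \<Omega>. w x = 0"
proof -
  define u where "u x = fst (w x)" for x
  define v where "v x = fst (snd (w x))" for x
  define \<alpha> where "\<alpha> x = snd (snd (w x))" for x
  have m: "u \<in> DG k \<tau>" "v \<in> RT_bc (k + 1) \<Omega> \<tau> \<Gamma>" "\<alpha> \<in> RT_bc (k + 1) \<Omega> \<tau> \<Gamma>"
    using trialD[OF w] by (simp_all add: u_def[abs_def] v_def[abs_def] \<alpha>_def[abs_def])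
  have wu: "w = (\<lambda>x. (u x, v x, \<alpha> x))" by (simp add: u_def v_def \<alpha>_def)
  have "discrete_solution \<Omega> \<tau> \<Gamma> k c0 c1 (\<lambda>_. 0) u v \<alpha>"
    using w 0 unfolding discrete_solution_iff[where f = "\<lambda>_. 0", OF refl] wu[symmetric] by simp
  then have e: "\<And>\<phi> \<psi>. \<phi> \<in> DG k \<tau> \<Longrightarrow> \<psi> \<in> RT_bc (k + 1) \<Omega> \<tau> \<Gamma> \<Longrightarrow>
        form_a \<Omega> c0 c1 (u, v) (\<phi>, \<psi>) + form_b \<Omega> (\<phi>, \<psi>) \<alpha> = 0"
      "\<And>\<beta>. \<beta> \<in> RT_bc (k + 1) \<Omega> \<tau> \<Gamma> \<Longrightarrow> form_b \<Omega> (u, v) \<beta> = 0"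
    unfolding discrete_solution_def by blast+
  note uL = DG_L2[OF m(1)] and D = Hdiv_weak_div(1)[OF RT_bc_Hdiv]
  \<comment> \<open>Choosing \<open>\<beta> = \<alpha>\<close> in the second equation removes the
    coupling term from the first.\<close>
  have "form_a \<Omega> c0 c1 (u, v) (u, v) = 0" using e(1)[OF m(1,2)] e(2)[OF m(3)] by simp
  then have s: "c0 * (\<integral>x. v x \<bullet> v x \<partial>lebesgue_on \<Omega>) + (\<integral>x. weak_div \<Omega> v x \<bullet> weak_div \<Omega> v x \<partial>lebesgue_on \<Omega>)
      + c1 * (\<integral>x. u x \<bullet> u x \<partial>lebesgue_on \<Omega>) = 0"
    by (simp add: form_a_def)
  have nv: "0 \<le> (\<integral>x. v x \<bullet> v x \<partial>lebesgue_on \<Omega>)" by (intro Bochner_Integration.integral_nonneg) simp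
  have nd: "0 \<le> (\<integral>x. weak_div \<Omega> v x \<bullet> weak_div \<Omega> v x \<partial>lebesgue_on \<Omega>)" by (intro Bochner_Integration.integral_nonneg) simp
  have nu: "0 \<le> (\<integral>x. u x \<bullet> u x \<partial>lebesgue_on \<Omega>)" by (intro Bochner_Integration.integral_nonneg) simp
  have "(\<integral>x. weak_div \<Omega> v x \<bullet> weak_div \<Omega> v x \<partial>lebesgue_on \<Omega>) = 0"
    and u1: "c1 * (\<integral>x. u x \<bullet> u x \<partial>lebesgue_on \<Omega>) = 0"
    using s nd mult_nonneg_nonneg[OF c0 nv] mult_nonneg_nonneg[OF c1 nu] by linarith+
  then have dv: "AE x in lebesgue_on \<Omega>. weak_div \<Omega> v x = 0"
    by (intro square_integral_zero D[OF m(2)])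
  then have v0: "AE x in lebesgue_on \<Omega>. v x = 0"
    by (intro form_b_self[OF m(2) e(2)[OF m(2)] _ uL] disjI2)
  have u0: "AE x in lebesgue_on \<Omega>. u x = 0"
  proof (cases "c1 = 0")
    case False
    then show ?thesis using u1 by (intro square_integral_zero uL) simp
  next
    case True
    from F0[OF True] obtain C0 v0 where F: "boundary_facet C0 v0" "\<And>x. x \<in> rel_interior (convex hull (C0 - {v0})) \<Longrightarrow> x \<notin> \<Gamma>"
      by blast
    show ?thesis
    proof (rule div_orthogonal_zero[OF con F m(1)])
      fix \<beta> assume \<beta>: "\<beta> \<in> RT_bc (k + 1) \<Omega> \<tau> \<Gamma>"
      have "AE x in lebesgue_on \<Omega>. \<beta> x \<bullet> v x = 0" using v0 by eventually_elim simp
      then have "(\<integral>x. \<beta> x \<bullet> v x \<partial>lebesgue_on \<Omega>) = 0" by (rule integral_eq_zero_AE)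
      then show "(\<integral>x. u x * weak_div \<Omega> \<beta> x \<partial>lebesgue_on \<Omega>) = 0"
        using e(2)[OF \<beta>] L2_inner_integrable[OF RT_bc_L2[OF \<beta>] RT_bc_L2[OF m(2)]] L2_mult_integrable[OF uL D[OF \<beta>]]
        unfolding form_b_def case_prod_conv by (simp add: Bochner_Integration.integral_add)
    qed
  qed
  \<comment> \<open>The first equation with \<open>\<phi> = 0\<close> and
    \<open>\<psi> = \<alpha>\<close>: \<open>form_a\<close> drops out because \<open>v\<close> and
    its divergence vanish.\<close>
  have b0: "form_b \<Omega> (\<lambda>x. 0, \<alpha>) \<alpha> = 0"
  proof -
    have "form_a \<Omega> c0 c1 (u, v) (\<lambda>x. 0, \<alpha>) = 0"
    proof -
      have "AE x in lebesgue_on \<Omega>. v x \<bullet> \<alpha> x = 0" using v0 by eventually_elim simp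
      moreover have "AE x in lebesgue_on \<Omega>. weak_div \<Omega> v x * weak_div \<Omega> \<alpha> x = 0" using dv by eventually_elim simp
      ultimately show ?thesis unfolding form_a_def case_prod_conv by (simp add: integral_eq_zero_AE)
    qed
    then show ?thesis using e(1)[OF DG_zero m(3)] by simp
  qed
  have "AE x in lebesgue_on \<Omega>. (0 :: real) = 0" by simp
  from form_b_self[OF m(3) b0 disjI1[OF this] L2_zero]
  have "AE x in lebesgue_on \<Omega>. \<alpha> x = 0" .
  then have "AE x in lebesgue_on \<Omega>. (u x, v x, \<alpha> x) = 0"
    using u0 v0 by eventually_elim (simp add: zero_prod_def)
  then show ?thesis by (simp only: u_def v_def \<alpha>_def prod.collapse)
qed

lemma discrete_well_posed:
  assumes con: "connected \<Omega>" and c0: "c0 \<ge> 0" and c1: "c1 \<ge> 0"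
    and F0: "c1 = 0 \<Longrightarrow> \<exists>C0 v0. boundary_facet C0 v0 \<and> (\<forall>x\<in>rel_interior (convex hull (C0 - {v0})). x \<notin> \<Gamma>)"
    and f: "linear_functional_on \<Omega> (DG k \<tau>) f"
  shows "\<exists>u v \<alpha>. discrete_solution \<Omega> \<tau> \<Gamma> k c0 c1 f u v \<alpha> \<and>
    (\<forall>u' v' \<alpha>'. discrete_solution \<Omega> \<tau> \<Gamma> k c0 c1 f u' v' \<alpha>' \<longrightarrow>
      (AE x in lebesgue_on \<Omega>. u' x = u x \<and> v' x = v x \<and> \<alpha>' x = \<alpha> x))"
proof -
  have flin: "f (\<lambda>x. a * u x + b * v x) = a * f u + b * f v" if "u \<in> DG k \<tau>" "v \<in> DG k \<tau>" for u v a b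
    using f that unfolding linear_functional_on_def by blast
  have fae: "f u = f v" if "u \<in> DG k \<tau>" "v \<in> DG k \<tau>" "AE x in lebesgue_on \<Omega>. u x = v x" for u v
    using f that unfolding linear_functional_on_def by blast
  have f0: "f (\<lambda>x. 0) = 0" using flin[OF DG_zero DG_zero, of 0 0] by simp
  define Z where "Z = {w :: 'a \<Rightarrow> real \<times> 'a \<times> 'a. AE x in lebesgue_on \<Omega>. w x = 0}"
  txt \<open>The separating functionals are the moments of the components against monomials on each simplex;
    \<open>None\<close> stands for \<open>u\<close>, \<open>Some (b, True)\<close> and \<open>Some (b, False)\<close> for the components of \<open>v\<close> and \<open>\<alpha>\<close>.\<close>
  define I where "I = (insert None (Some ` ((Basis :: 'a set) \<times> {False, True}))) \<times> \<tau> \<times> (multi_indices (Suc k) :: ('a \<Rightarrow> nat) set)"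
  define comp where "comp j y = (case j of None \<Rightarrow> fst y | Some (b, i) \<Rightarrow> (if i then fst (snd y) else snd (snd y)) \<bullet> b)"
    for j :: "('a \<times> bool) option" and y :: "real \<times> 'a \<times> 'a"
  define l where "l i w = (\<integral>x. comp (fst i) (w x) * pw (fst (snd i)) (monomial_fun (snd (snd i))) x \<partial>lebesgue_on \<Omega>)"
    for i and w :: "'a \<Rightarrow> real \<times> 'a \<times> 'a"
  have fin: "finite I" unfolding I_def
    by (intro finite_cartesian_product finite_insert[THEN iffD2] finite_imageI finite_Basis finite_mesh
        finite_multi_indices finite.emptyI)
  have compL: "(\<lambda>x. comp j (w x)) \<in> L2 \<Omega>" if w: "w \<in> trial k \<Gamma>" for j w
  proof (cases j)
    case None
    then show ?thesis using DG_L2[OF trialD(1)[OF w]] by (simp add: comp_def)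
  next
    case (Some bi)
    obtain b i where bi: "bi = (b, i)" by (cases bi)
    have "(\<lambda>x. g x \<bullet> b) \<in> L2 \<Omega>" if "g \<in> RT_bc (k + 1) \<Omega> \<tau> \<Gamma>" for g
    proof -
      have "\<forall>T\<in>\<tau>. \<exists>q. q \<in> RT_poly_space k \<and> (AE x in lebesgue_on T. g x = q x)" using RT_rep[OF that] by blast
      from bchoice[OF this] obtain q where q: "\<And>T. T \<in> \<tau> \<Longrightarrow> q T \<in> RT_poly_space k"
        "\<And>T. T \<in> \<tau> \<Longrightarrow> AE x in lebesgue_on T. g x = q T x" by blast
      show ?thesis
      proof (rule piecewise_L2)
        show "continuous_on UNIV (\<lambda>x. q T x \<bullet> b)" if "T \<in> \<tau>" for T
          by (rule poly_space_continuous[OF RT_poly_space_inner[OF q(1)[OF that]]])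
        show "AE x in lebesgue_on T. g x \<bullet> b = q T x \<bullet> b" if "T \<in> \<tau>" for T
          using q(2)[OF that] by eventually_elim simp
      qed
    qed
    then show ?thesis using trialD(2,3)[OF w] by (cases i) (simp_all add: comp_def Some bi)
  qed
  have monoL: "pw T (monomial_fun m) \<in> L2 \<Omega>" if "T \<in> \<tau>" "m \<in> multi_indices (Suc k)" for T and m :: "'a \<Rightarrow> nat"
    using poly_space_continuous[OF monomial_in_poly_space[OF that(2)]] by (rule pw_L2[OF that(1)])
  have complin: "comp j (a *\<^sub>R y + b *\<^sub>R z) = a * comp j y + b * comp j z" for j a b y z
    by (auto simp: comp_def inner_add_left split: option.splits)
  have llin: "lin_on (trial k \<Gamma>) (l i)" if i: "i \<in> I" for i
    unfolding lin_on_def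
  proof (intro ballI allI)
    fix y z a b assume y: "y \<in> trial k \<Gamma>" and z: "z \<in> trial k \<Gamma>"
    have mL: "pw (fst (snd i)) (monomial_fun (snd (snd i))) \<in> L2 \<Omega>" using i by (intro monoL) (auto simp: I_def)
    show "l i (\<lambda>x. a *\<^sub>R y x + b *\<^sub>R z x) = a * l i y + b * l i z"
      unfolding l_def complin
      using L2_mult_integrable[OF compL[OF y, of "fst i"] mL] L2_mult_integrable[OF compL[OF z, of "fst i"] mL]
      by (simp add: distrib_right mult.assoc)
  qed
  have sep: "w \<in> Z" if w: "w \<in> trial k \<Gamma>" and l0: "\<And>i. i \<in> I \<Longrightarrow> l i w = 0" for w
  proof -
    note t = trialD[OF w]
    obtain p where p: "\<And>T. T \<in> \<tau> \<Longrightarrow> p T \<in> poly_space k" "\<And>T. T \<in> \<tau> \<Longrightarrow> AE x in lebesgue_on T. fst (w x) = p T x"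
      using DG_rep[OF t(1)] by blast
    have 1: "AE x in lebesgue_on \<Omega>. fst (w x) = 0"
    proof (rule piecewise_poly_moments[of p k])
      show "(\<integral>x. fst (w x) * pw T (monomial_fun m) x \<partial>lebesgue_on \<Omega>) = 0" if T: "T \<in> \<tau>" and m: "m \<in> multi_indices k" for T m
      proof -
        have "m \<in> multi_indices (Suc k)" using m by (fastforce simp: multi_indices_def PiE_def Pi_def)
        then have "(None, T, m) \<in> I" using T by (simp add: I_def)
        from l0[OF this] show ?thesis by (simp add: l_def comp_def)
      qed
    qed (use p in auto)
    have 2: "AE x in lebesgue_on \<Omega>. fst (snd (w x)) = 0"
    proof (rule RT_component_moments[OF t(2)])
      fix b T and m :: "'a \<Rightarrow> nat" assume "b \<in> (Basis :: 'a set)" "T \<in> \<tau>" "m \<in> multi_indices (Suc k)"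
      then have "(Some (b, True), T, m) \<in> I" by (simp add: I_def)
      from l0[OF this] show "(\<integral>x. (fst (snd (w x)) \<bullet> b) * pw T (monomial_fun m) x \<partial>lebesgue_on \<Omega>) = 0"
        by (simp add: l_def comp_def)
    qed
    have 3: "AE x in lebesgue_on \<Omega>. snd (snd (w x)) = 0"
    proof (rule RT_component_moments[OF t(3)])
      fix b T and m :: "'a \<Rightarrow> nat" assume "b \<in> (Basis :: 'a set)" "T \<in> \<tau>" "m \<in> multi_indices (Suc k)"
      then have "(Some (b, False), T, m) \<in> I" by (simp add: I_def)
      from l0[OF this] show "(\<integral>x. (snd (snd (w x)) \<bullet> b) * pw T (monomial_fun m) x \<partial>lebesgue_on \<Omega>) = 0"
        by (simp add: l_def comp_def)
    qed
    have "AE x in lebesgue_on \<Omega>. w x = 0"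
      using 1 2 3 by eventually_elim (simp add: prod_eq_iff)
    then show ?thesis by (simp add: Z_def)
  qed
  have F: "lin_on (trial k \<Gamma>) (\<lambda>w. f (\<lambda>x. fst (w x)))"
    unfolding lin_on_def using flin trialD(1) by (simp add: fst_add fst_scaleR)
  have Fnull: "f (\<lambda>x. fst (w x)) = 0" if "w \<in> trial k \<Gamma>" "w \<in> Z" for w
  proof -
    have "AE x in lebesgue_on \<Omega>. w x = 0" using that(2) by (simp add: Z_def)
    then have "AE x in lebesgue_on \<Omega>. fst (w x) = 0" by eventually_elim simp
    then show ?thesis using fae[OF trialD(1)[OF that(1)] DG_zero] f0 by simp
  qed
  have null: "saddle c0 c1 u w = 0" if "u \<in> trial k \<Gamma>" "w \<in> trial k \<Gamma>" "w \<in> Z" for u w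
    using saddle_null[OF that(2,1)] that(3) by (simp add: Z_def)
  have nondeg: "w \<in> Z" if "w \<in> trial k \<Gamma>" "\<And>u. u \<in> trial k \<Gamma> \<Longrightarrow> saddle c0 c1 w u = 0" for w
    using saddle_nondegenerate[OF con c0 c1 F0 that] by (simp add: Z_def)
  have "\<exists>w\<in>trial k \<Gamma>. \<forall>u\<in>trial k \<Gamma>. saddle c0 c1 w u = f (\<lambda>x. fst (u x))"
    by (rule symmetric_form_solvable[OF trial_lin_closed fin llin sep saddle_sym saddle_lin null nondeg F Fnull])
  then obtain w where w: "w \<in> trial k \<Gamma>" "\<And>z. z \<in> trial k \<Gamma> \<Longrightarrow> saddle c0 c1 w z = f (\<lambda>x. fst (z x))" by blast
  define u v \<alpha> where "u = (\<lambda>x. fst (w x))" and "v = (\<lambda>x. fst (snd (w x)))" and "\<alpha> = (\<lambda>x. snd (snd (w x)))"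
  have wu: "w = (\<lambda>x. (u x, v x, \<alpha> x))" by (simp add: u_def v_def \<alpha>_def)
  note iff = discrete_solution_iff[where f = f and k = k, OF f0]
  have "discrete_solution \<Omega> \<tau> \<Gamma> k c0 c1 f u v \<alpha>" unfolding iff wu[symmetric] using w by blast
  moreover have "AE x in lebesgue_on \<Omega>. u' x = u x \<and> v' x = v x \<and> \<alpha>' x = \<alpha> x"
    if "discrete_solution \<Omega> \<tau> \<Gamma> k c0 c1 f u' v' \<alpha>'" for u' v' \<alpha>'
  proof -
    define y where "y = (\<lambda>x. (u' x, v' x, \<alpha>' x))"
    have y: "y \<in> trial k \<Gamma>" "\<And>z. z \<in> trial k \<Gamma> \<Longrightarrow> saddle c0 c1 y z = f (\<lambda>x. fst (z x))"
      using that unfolding iff y_def by blast+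
    define d where "d = (\<lambda>x. 1 *\<^sub>R y x + (-1) *\<^sub>R w x)"
    have dW: "d \<in> trial k \<Gamma>" unfolding d_def by (rule lin_closedD[OF trial_lin_closed y(1) w(1)])
    \<comment> \<open>\<open>saddle_lin\<close> concerns the second argument; symmetry transfers it
      to a difference of solutions in the first.\<close>
    have "saddle c0 c1 d z = 0" if z: "z \<in> trial k \<Gamma>" for z
      using lin_onD[OF saddle_lin[OF z, of c0 c1] y(1) w(1), of 1 "-1"] y(2)[OF z] w(2)[OF z]
        saddle_sym[of c0 c1 z] unfolding d_def[symmetric] by simp
    then have "AE x in lebesgue_on \<Omega>. d x = 0" using nondeg[OF dW] by (simp add: Z_def)
    then show ?thesis by eventually_elim (simp add: d_def y_def wu zero_prod_def)
  qed
  ultimately show ?thesis by blast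
qed

end

text \<open>Elements of \<open>DG\<close> may jump across facets and then have no square integrable
  weak gradient, so membership in \<open>V_dual\<close> does not constrain \<open>f\<close> on them.
  The pairing with such functions is the linear functional of the last assumption.\<close>

theorem corollary12:
  fixes \<Omega> \<Gamma>\<^sub>0 \<Gamma>\<^sub>3 :: "'a::euclidean_space set"
    and \<tau> :: "real \<Rightarrow> 'a set set"
    and c\<^sub>0 c\<^sub>1 h :: real
    and k :: nat
    and f :: "('a \<Rightarrow> real) \<Rightarrow> real"
  assumes "DIM('a) = 2 \<or> DIM('a) = 3"
    and "polytopal_domain \<Omega>"
    and "boundary_partition \<Omega> \<Gamma>\<^sub>0 \<Gamma>\<^sub>3"
    and "c\<^sub>0 \<ge> 0"
    and "c\<^sub>1 > 0 \<or> (c\<^sub>1 \<ge> 0 \<and> \<Gamma>\<^sub>0 \<noteq> {})"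
    and "\<And>h. h \<in> {0<..1} \<Longrightarrow> simplicial_mesh \<Omega> (\<tau> h)"
    and "\<And>h. h \<in> {0<..1} \<Longrightarrow> mesh_resolves \<Omega> \<Gamma>\<^sub>0 \<Gamma>\<^sub>3 (\<tau> h)"
    and "quasiuniform \<Omega> \<tau>"
    and "h \<in> {0<..1}"
    and "f \<in> V_dual \<Omega>"
    and "linear_functional_on \<Omega> (DG k (\<tau> h)) f"
  shows "\<exists>u v \<alpha>. discrete_solution \<Omega> (\<tau> h) \<Gamma>\<^sub>3 k c\<^sub>0 c\<^sub>1 f u v \<alpha> \<and>
           (\<forall>u' v' \<alpha>'. discrete_solution \<Omega> (\<tau> h) \<Gamma>\<^sub>3 k c\<^sub>0 c\<^sub>1 f u' v' \<alpha>' \<longrightarrow>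
              (AE x in lebesgue_on \<Omega>. u' x = u x \<and> v' x = v x \<and> \<alpha>' x = \<alpha> x))"
proof -
  have dom: "open \<Omega>" "connected \<Omega>" "bounded \<Omega>" "lipschitz_boundary \<Omega>"
    using assms(2) by (auto simp: polytopal_domain_def)
  have pieces: "boundary_piece \<Omega> \<Gamma>\<^sub>0" "boundary_piece \<Omega> \<Gamma>\<^sub>3" "frontier \<Omega> = \<Gamma>\<^sub>0 \<union> \<Gamma>\<^sub>3"
    "(top_of_set (frontier \<Omega>)) interior_of (\<Gamma>\<^sub>0 \<inter> \<Gamma>\<^sub>3) = {}"
    using assms(3) by (auto simp: boundary_partition_def)
  have piece_null: "negligible \<Gamma>" if "boundary_piece \<Omega> \<Gamma>" for \<Gamma>
  proof -
    obtain \<G> where G: "finite \<G>" "\<Gamma> = \<Union>\<G>" "\<And>G. G \<in> \<G> \<Longrightarrow> polytope G \<and> aff_dim G = int DIM('a) - 1"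
      using \<open>boundary_piece \<Omega> \<Gamma>\<close> unfolding boundary_piece_def by blast
    have "negligible G" if "G \<in> \<G>" for G
    proof -
      have "interior G = {}" using aff_dim_nonempty_interior[of G] G(3)[OF that] by linarith
      moreover have "convex G" using G(3)[OF that] polytope_imp_convex by blast
      ultimately show ?thesis by (simp add: negligible_convex_interior)
    qed
    then show ?thesis unfolding G(2) using G(1) by (intro negligible_Union) auto
  qed
  interpret fem \<Omega> "\<tau> h"
  proof
    show "simplicial_mesh \<Omega> (\<tau> h)" by (rule assms(6)[OF assms(9)])
    show "interior (closure \<Omega>) = \<Omega>" by (rule lipschitz_boundary_regular[OF dom(1,4)])
    show "negligible (frontier \<Omega>)" unfolding pieces(3) using pieces piece_null by (intro negligible_Un)
  qed (use dom in auto)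
  \<comment> \<open>Needed in both directions, a facet in one part against a flat piece of the
    other; hence the abstract pair \<open>\<Gamma>\<close>, \<open>\<Gamma>'\<close>.\<close>
  have overlap: False
    if F: "boundary_facet C v" "x \<in> rel_interior (convex hull (C - {v}))" "convex hull (C - {v}) \<subseteq> \<Gamma>"
      and G: "polytope G" "aff_dim G = int DIM('a) - 1" "G \<subseteq> frontier \<Omega>" "x \<in> G" "G \<subseteq> \<Gamma>'"
      and "\<Gamma> \<inter> \<Gamma>' = \<Gamma>\<^sub>0 \<inter> \<Gamma>\<^sub>3" for C v x \<Gamma> \<Gamma>' G
  proof -
    have "(top_of_set (frontier \<Omega>)) interior_of (convex hull (C - {v}) \<inter> G)
        \<subseteq> (top_of_set (frontier \<Omega>)) interior_of (\<Gamma>\<^sub>0 \<inter> \<Gamma>\<^sub>3)"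
      using F(3) G(5) that(9) by (intro interior_of_mono) blast
    then show False using boundary_facet_overlap[OF F(1,2) G(1-4)] pieces(4) by blast
  qed
  \<comment> \<open>A flat piece of \<open>\<Gamma>\<^sub>0\<close> meets the relative interior of
    some boundary facet. The mesh assigns this facet to one part; \<open>overlap\<close> excludes
    \<open>\<Gamma>\<^sub>3\<close>, and then excludes that any relative interior point of the facet
    lies on \<open>\<Gamma>\<^sub>3\<close>.\<close>
  have facet: "\<exists>C v. boundary_facet C v \<and> (\<forall>x\<in>rel_interior (convex hull (C - {v})). x \<notin> \<Gamma>\<^sub>3)" if "\<Gamma>\<^sub>0 \<noteq> {}"
  proof -
    obtain \<G>0 where G0: "\<Gamma>\<^sub>0 = \<Union>\<G>0" "\<And>G. G \<in> \<G>0 \<Longrightarrow> polytope G \<and> aff_dim G = int DIM('a) - 1 \<and> G \<subseteq> frontier \<Omega>"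
      using pieces(1) unfolding boundary_piece_def by blast
    obtain \<G>3 where G3: "\<Gamma>\<^sub>3 = \<Union>\<G>3" "\<And>G. G \<in> \<G>3 \<Longrightarrow> polytope G \<and> aff_dim G = int DIM('a) - 1 \<and> G \<subseteq> frontier \<Omega>"
      using pieces(2) unfolding boundary_piece_def by blast
    obtain G where G: "G \<in> \<G>0" using \<open>\<Gamma>\<^sub>0 \<noteq> {}\<close> G0(1) by blast
    have Gp: "polytope G" "aff_dim G = int DIM('a) - 1" "G \<subseteq> frontier \<Omega>" "G \<subseteq> \<Gamma>\<^sub>0" using G0 G by auto
    obtain C v x where F: "boundary_facet C v" "x \<in> rel_interior (convex hull (C - {v}))" "x \<in> G"
      using frontier_polytope_facet[OF Gp(1-3)] by blast
    have C: "full_simplex C" "convex hull C \<in> \<tau> h" "v \<in> C" using F(1) by (auto simp: boundary_facet_def)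
    have "convex hull (C - {v}) facet_of convex hull C"
    proof -
      have "convex hull (C - {v}) \<noteq> {}" using F(2) rel_interior_subset by blast
      then show ?thesis using C facet_of_convex_hull_affine_independent[of C "convex hull (C - {v})"]
        unfolding full_simplex_def by blast
    qed
    then have "convex hull (C - {v}) \<subseteq> \<Gamma>\<^sub>0 \<or> convex hull (C - {v}) \<subseteq> \<Gamma>\<^sub>3"
      using assms(7)[OF assms(9)] C(2) boundary_facet_frontier[OF F(1)] unfolding mesh_resolves_def by blast
    moreover have "\<not> convex hull (C - {v}) \<subseteq> \<Gamma>\<^sub>3"
      using overlap[OF F(1,2) _ Gp(1-3) F(3) Gp(4) Int_commute] by blast
    ultimately have sub: "convex hull (C - {v}) \<subseteq> \<Gamma>\<^sub>0" by blast
    have "y \<notin> \<Gamma>\<^sub>3" if y: "y \<in> rel_interior (convex hull (C - {v}))" for y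
    proof
      assume "y \<in> \<Gamma>\<^sub>3"
      then obtain G' where G': "G' \<in> \<G>3" "y \<in> G'" using G3(1) by blast
      then show False using overlap[OF F(1) y sub, of G' "\<Gamma>\<^sub>3"] G3 by blast
    qed
    then show ?thesis using F(1) by blast
  qed
  have c1: "c\<^sub>1 \<ge> 0" "c\<^sub>1 = 0 \<Longrightarrow> \<Gamma>\<^sub>0 \<noteq> {}" using assms(5) by auto
  show ?thesis
    by (rule discrete_well_posed[OF dom(2) assms(4) c1(1) facet[OF c1(2)] assms(11)])
qed

end
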